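(* Let $X_1,X_2,\dots$ be free copies of a self-adjoint random variable with variance $1$ in a tracial noncommutative probability space $(\mathcal{A},\tau)$. Then, as $n\to\infty$, $$Q_n=\frac1n\sum_{1\le k<j\le n}i(X_kX_j-X_jX_k)$$ converges in distribution to a random variable $Y$ with $R$-transform $R_Y(z)=\tan(z)$.
   Context: A tracial noncommutative probability space $(\mathcal{A},\tau)$ is a von Neumann algebra with a normal faithful tracial state. Free cumulants $K_n:\mathcal{A}^n\to\mathbb{C}$ are defined implicitly by $\tau(X_1\cdots X_n)=\sum_{\pi\in NC(n)}\prod_{B\in\pi}K_{|B|}(X_i: i\in B)$, where $NC(n)$ is the set of noncrossing partitions of $\{1,\dots,n\}$; $K_n(X)=K_n(X,\dots,X)$. The $R$-transform is $R_X(z)=\sum_{n\ge0}K_{n+1}(X)z^n$. Convergence in distribution $X_n\to X$ means $\tau(X_n^m)\to\tau(X^m)$ for all $m\in\mathbb{N}$, equivalently $K_m(X_n)\to K_m(X)$ for all $m$. The variance of $X$ is $\tau(X^2)-\tau(X)^2$; the mean is not assumed to vanish. The limit law $\mu_Y$ is called the free tangent law. *)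

theory Defs
  imports "HOL-Analysis.Analysis" "HOL-Library.Disjoint_Sets"
begin

section \<open>Complex Hilbert spaces\<close>

class scaleC =
  fixes scaleC :: "complex \<Rightarrow> 'a \<Rightarrow> 'a"  (infixr \<open>*\<^sub>C\<close> 75)

class complex_vector = scaleC + ab_group_add +
  assumes scaleC_add_right: "a *\<^sub>C (x + y) = a *\<^sub>C x + a *\<^sub>C y"
    and scaleC_add_left: "(a + b) *\<^sub>C x = a *\<^sub>C x + b *\<^sub>C x"
    and scaleC_scaleC: "a *\<^sub>C b *\<^sub>C x = (a * b) *\<^sub>C x"
    and scaleC_one: "1 *\<^sub>C x = x"

text \<open>The inner product is conjugate-linear in the first and linear in the second argument.
  Additivity in the first argument and definiteness follow from the axioms.\<close>

class chilbert_space = banach + complex_vector +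
  fixes cinner :: "'a \<Rightarrow> 'a \<Rightarrow> complex"
  assumes scaleR_scaleC: "r *\<^sub>R x = complex_of_real r *\<^sub>C x"
    and cinner_commute: "cinner x y = cnj (cinner y x)"
    and cinner_add_right: "cinner x (y + z) = cinner x y + cinner x z"
    and cinner_scaleC_right: "cinner x (c *\<^sub>C y) = c * cinner x y"
    and cinner_norm: "cinner x x = complex_of_real ((norm x)\<^sup>2)"


section \<open>The Hilbert space of square-summable sequences\<close>

text \<open>An existential statement about von Neumann algebras needs a concrete Hilbert space.
  A single bounded random variable can always be realised on a separable one.\<close>

typedef ell2 = "{f :: nat \<Rightarrow> complex. summable (\<lambda>n. (cmod (f n))\<^sup>2)}"
  morphisms ell2_nth Abs_ell2
  by (rule exI[of _ "\<lambda>_. 0"]) simp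

setup_lifting type_definition_ell2

lemma summable_ell2_nth: "summable (\<lambda>n. (cmod (ell2_nth x n))\<^sup>2)"
  using ell2_nth[of x] by simp

lemma ell2_eqI: "(\<And>n. ell2_nth x n = ell2_nth y n) \<Longrightarrow> x = y"
  by (metis ell2_nth_inverse ext)

lemma power2_norm_add_le: "(norm (a + b))\<^sup>2 \<le> 2 * (norm a)\<^sup>2 + 2 * (norm b)\<^sup>2"
  for a b :: "'a::real_normed_vector"
proof -
  have "(norm (a + b))\<^sup>2 \<le> (norm a + norm b)\<^sup>2"
    by (intro power_mono norm_triangle_ineq) auto
  also have "\<dots> \<le> 2 * (norm a)\<^sup>2 + 2 * (norm b)\<^sup>2"
    using zero_le_power2[of "norm a - norm b"] by (simp add: power2_sum power2_diff)
  finally show ?thesis .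
qed

lemma square_summable_add:
  fixes f g :: "nat \<Rightarrow> complex"
  assumes "summable (\<lambda>n. (cmod (f n))\<^sup>2)" "summable (\<lambda>n. (cmod (g n))\<^sup>2)"
  shows "summable (\<lambda>n. (cmod (f n + g n))\<^sup>2)"
proof (rule summable_comparison_test'[where N = 0])
  show "summable (\<lambda>n. 2 * (cmod (f n))\<^sup>2 + 2 * (cmod (g n))\<^sup>2)"
    by (intro summable_add summable_mult assms)
  show "norm ((cmod (f n + g n))\<^sup>2) \<le> 2 * (cmod (f n))\<^sup>2 + 2 * (cmod (g n))\<^sup>2" for n
    using power2_norm_add_le[of "f n" "g n"] by simp
qed

lemma square_summable_scale:
  fixes f :: "nat \<Rightarrow> complex"
  assumes "summable (\<lambda>n. (cmod (f n))\<^sup>2)"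
  shows "summable (\<lambda>n. (cmod (c * f n))\<^sup>2)"
  using summable_mult[OF assms, of "(cmod c)\<^sup>2"] by (simp add: norm_mult power_mult_distrib)

instantiation ell2 :: complex_vector
begin

lift_definition zero_ell2 :: ell2 is "\<lambda>_. 0" by simp
lift_definition plus_ell2 :: "ell2 \<Rightarrow> ell2 \<Rightarrow> ell2" is "\<lambda>f g n. f n + g n"
  by (rule square_summable_add)
lift_definition uminus_ell2 :: "ell2 \<Rightarrow> ell2" is "\<lambda>f n. - f n" by simp
definition minus_ell2 :: "ell2 \<Rightarrow> ell2 \<Rightarrow> ell2" where "minus_ell2 x y = x + - y"
lift_definition scaleC_ell2 :: "complex \<Rightarrow> ell2 \<Rightarrow> ell2" is "\<lambda>c f n. c * f n"
  by (rule square_summable_scale)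

lemma ell2_nth_simps [simp]:
  "ell2_nth 0 n = 0"
  "ell2_nth (x + y) n = ell2_nth x n + ell2_nth y n"
  "ell2_nth (- x) n = - ell2_nth x n"
  "ell2_nth (x - y) n = ell2_nth x n - ell2_nth y n"
  "ell2_nth (c *\<^sub>C x) n = c * ell2_nth x n"
  by (simp_all add: minus_ell2_def zero_ell2.rep_eq plus_ell2.rep_eq uminus_ell2.rep_eq
      scaleC_ell2.rep_eq)

instance
proof
  fix x y z :: ell2 and a b :: complex
  show "x + y + z = x + (y + z)" "x + y = y + x" "0 + x = x" "- x + x = 0" "x - y = x + - y"
    "a *\<^sub>C (x + y) = a *\<^sub>C x + a *\<^sub>C y" "(a + b) *\<^sub>C x = a *\<^sub>C x + b *\<^sub>C x"
    "a *\<^sub>C b *\<^sub>C x = (a * b) *\<^sub>C x" "1 *\<^sub>C x = x"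
    by (rule ell2_eqI, simp add: algebra_simps)+
qed

end

lemma sqrt_sum_le_norm_ell2:
  "L2_set (\<lambda>n. cmod (ell2_nth x n)) {..<N} \<le> sqrt (\<Sum>n. (cmod (ell2_nth x n))\<^sup>2)"
  unfolding L2_set_def
  by (intro real_sqrt_le_mono sum_le_suminf summable_ell2_nth) auto

lemma norm_ell2_leI:
  assumes "\<And>N. L2_set (\<lambda>n. cmod (ell2_nth x n)) {..<N} \<le> C"
  shows "sqrt (\<Sum>n. (cmod (ell2_nth x n))\<^sup>2) \<le> C"
proof (rule LIMSEQ_le_const2)
  show "(\<lambda>N. L2_set (\<lambda>n. cmod (ell2_nth x n)) {..<N})
      \<longlonglongrightarrow> sqrt (\<Sum>n. (cmod (ell2_nth x n))\<^sup>2)"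
    unfolding L2_set_def by (intro tendsto_real_sqrt summable_LIMSEQ summable_ell2_nth)
qed (use assms in auto)

instantiation ell2 :: real_normed_vector
begin

definition norm_ell2 :: "ell2 \<Rightarrow> real" where
  "norm_ell2 x = sqrt (\<Sum>n. (cmod (ell2_nth x n))\<^sup>2)"
definition scaleR_ell2 :: "real \<Rightarrow> ell2 \<Rightarrow> ell2" where
  "scaleR_ell2 r x = complex_of_real r *\<^sub>C x"
definition sgn_ell2 :: "ell2 \<Rightarrow> ell2" where
  "sgn_ell2 x = inverse (norm x) *\<^sub>R x"
definition dist_ell2 :: "ell2 \<Rightarrow> ell2 \<Rightarrow> real" where
  "dist_ell2 x y = norm (x - y)"
definition uniformity_ell2 :: "(ell2 \<times> ell2) filter" where
  "uniformity_ell2 = (INF e\<in>{0<..}. principal {(x, y). dist x y < e})"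
definition open_ell2 :: "ell2 set \<Rightarrow> bool" where
  "open_ell2 U \<longleftrightarrow> (\<forall>x\<in>U. \<forall>\<^sub>F (x', y) in uniformity. x' = x \<longrightarrow> y \<in> U)"

instance
proof
  fix x y :: ell2 and a b :: real
  show "a *\<^sub>R (x + y) = a *\<^sub>R x + a *\<^sub>R y" "(a + b) *\<^sub>R x = a *\<^sub>R x + b *\<^sub>R x"
    "a *\<^sub>R b *\<^sub>R x = (a * b) *\<^sub>R x" "1 *\<^sub>R x = x"
    by (simp_all add: scaleR_ell2_def scaleC_add_right scaleC_add_left scaleC_scaleC scaleC_one)
  show "norm x = 0 \<longleftrightarrow> x = 0"
  proof
    assume "norm x = 0"
    hence "(\<Sum>n. (cmod (ell2_nth x n))\<^sup>2) = 0"
      by (simp add: norm_ell2_def)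
    hence "(cmod (ell2_nth x n))\<^sup>2 = 0" for n
      using suminf_eq_zero_iff[OF summable_ell2_nth] by fastforce
    thus "x = 0" by (intro ell2_eqI) simp
  qed (simp add: norm_ell2_def)
  show "norm (x + y) \<le> norm x + norm y"
    unfolding norm_ell2_def
  proof (rule norm_ell2_leI)
    fix N
    have "L2_set (\<lambda>n. cmod (ell2_nth (x + y) n)) {..<N}
        \<le> L2_set (\<lambda>n. cmod (ell2_nth x n) + cmod (ell2_nth y n)) {..<N}"
      by (intro L2_set_mono) (auto intro: norm_triangle_ineq)
    also have "\<dots> \<le> L2_set (\<lambda>n. cmod (ell2_nth x n)) {..<N} + L2_set (\<lambda>n. cmod (ell2_nth y n)) {..<N}"
      by (rule L2_set_triangle_ineq)
    also have "\<dots> \<le> sqrt (\<Sum>n. (cmod (ell2_nth x n))\<^sup>2) + sqrt (\<Sum>n. (cmod (ell2_nth y n))\<^sup>2)"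
      by (intro add_mono sqrt_sum_le_norm_ell2)
    finally show "L2_set (\<lambda>n. cmod (ell2_nth (x + y) n)) {..<N} \<le> \<dots>" .
  qed
  show "norm (a *\<^sub>R x) = \<bar>a\<bar> * norm x"
    by (simp add: norm_ell2_def scaleR_ell2_def norm_mult power_mult_distrib
        suminf_mult[OF summable_ell2_nth] real_sqrt_mult)
qed (simp_all add: sgn_ell2_def dist_ell2_def uniformity_ell2_def open_ell2_def)

end

lemma summable_cinner_ell2: "summable (\<lambda>n. cnj (ell2_nth x n) * ell2_nth y n)"
proof (rule summable_comparison_test'[where N = 0])
  show "summable (\<lambda>n. (cmod (ell2_nth x n))\<^sup>2 + (cmod (ell2_nth y n))\<^sup>2)"
    by (intro summable_add summable_ell2_nth)
  show "norm (cnj (ell2_nth x n) * ell2_nth y n) \<le> (cmod (ell2_nth x n))\<^sup>2 + (cmod (ell2_nth y n))\<^sup>2" for n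
  proof -
    have "2 * (cmod (ell2_nth x n) * cmod (ell2_nth y n)) \<le> (cmod (ell2_nth x n))\<^sup>2 + (cmod (ell2_nth y n))\<^sup>2"
      using zero_le_power2[of "cmod (ell2_nth x n) - cmod (ell2_nth y n)"] by (simp add: power2_diff)
    moreover have "0 \<le> cmod (ell2_nth x n) * cmod (ell2_nth y n)" by simp
    ultimately show ?thesis unfolding norm_mult complex_mod_cnj by linarith
  qed
qed

instance ell2 :: banach
proof
  fix X :: "nat \<Rightarrow> ell2"
  assume X: "Cauchy X"
  have nth_le: "cmod (ell2_nth x k) \<le> norm x" for x k
    using member_le_L2_set[of "{..<Suc k}" k "\<lambda>n. cmod (ell2_nth x n)"]
      sqrt_sum_le_norm_ell2[of x "Suc k"] by (simp add: norm_ell2_def)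
  have "Cauchy (\<lambda>n. ell2_nth (X n) k)" for k
  proof (rule CauchyI)
    fix e :: real assume "e > 0"
    then obtain M where "\<forall>m\<ge>M. \<forall>n\<ge>M. norm (X m - X n) < e"
      using CauchyD[OF X] by blast
    thus "\<exists>M. \<forall>m\<ge>M. \<forall>n\<ge>M. norm (ell2_nth (X m) k - ell2_nth (X n) k) < e"
      using nth_le[of "X _ - X _" k] by (metis ell2_nth_simps(4) le_less_trans)
  qed
  hence "convergent (\<lambda>n. ell2_nth (X n) k)" for k
    by (rule Cauchy_convergent)
  hence g: "(\<lambda>n. ell2_nth (X n) k) \<longlonglongrightarrow> lim (\<lambda>n. ell2_nth (X n) k)" for k
    by (simp add: convergent_LIMSEQ_iff)
  define g where "g = (\<lambda>k. lim (\<lambda>n. ell2_nth (X n) k))"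
  have g: "(\<lambda>n. ell2_nth (X n) k) \<longlonglongrightarrow> g k" for k
    unfolding g_def by (rule g)
  have tail: "\<exists>M. \<forall>m\<ge>M. \<forall>N. L2_set (\<lambda>k. cmod (ell2_nth (X m) k - g k)) {..<N} \<le> e"
    if pos: "e > 0" for e
  proof -
    obtain M where M: "\<forall>m\<ge>M. \<forall>n\<ge>M. norm (X m - X n) < e"
      using CauchyD[OF X pos] by blast
    have "L2_set (\<lambda>k. cmod (ell2_nth (X m) k - g k)) {..<N} \<le> e" if "m \<ge> M" for m N
    proof (rule LIMSEQ_le_const2)
      show "(\<lambda>n. L2_set (\<lambda>k. cmod (ell2_nth (X m) k - ell2_nth (X n) k)) {..<N})
          \<longlonglongrightarrow> L2_set (\<lambda>k. cmod (ell2_nth (X m) k - g k)) {..<N}"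
        unfolding L2_set_def by (intro tendsto_intros g)
      have "L2_set (\<lambda>k. cmod (ell2_nth (X m) k - ell2_nth (X n) k)) {..<N} \<le> e" if "n \<ge> M" for n
        using sqrt_sum_le_norm_ell2[of "X m - X n" N] M \<open>m \<ge> M\<close> that
        by (fastforce simp: norm_ell2_def)
      thus "\<exists>M. \<forall>n\<ge>M. L2_set (\<lambda>k. cmod (ell2_nth (X m) k - ell2_nth (X n) k)) {..<N} \<le> e"
        by blast
    qed
    thus ?thesis by blast
  qed
  have diff: "summable (\<lambda>k. (cmod (ell2_nth (X m) k - g k))\<^sup>2)"
    if "\<forall>N. L2_set (\<lambda>k. cmod (ell2_nth (X m) k - g k)) {..<N} \<le> e" for m e
  proof (rule summableI_nonneg_bounded[where x = "e\<^sup>2"])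
    fix N
    show "(\<Sum>k<N. (cmod (ell2_nth (X m) k - g k))\<^sup>2) \<le> e\<^sup>2"
      using spec[OF that, of N] unfolding L2_set_def by (rule sqrt_le_D)
  qed simp
  have "summable (\<lambda>k. (cmod (g k))\<^sup>2)"
  proof -
    obtain m where "\<forall>N. L2_set (\<lambda>k. cmod (ell2_nth (X m) k - g k)) {..<N} \<le> 1"
      using tail[of 1] by auto
    from square_summable_add[OF square_summable_scale[OF diff[OF this], of "- 1"]
        summable_ell2_nth[of "X m"]]
    show ?thesis by simp
  qed
  hence x: "ell2_nth (Abs_ell2 g) k = g k" for k
    by (simp add: Abs_ell2_inverse)
  have "X \<longlonglongrightarrow> Abs_ell2 g"
  proof (rule LIMSEQ_I)
    fix r :: real assume "r > 0"
    then obtain M where M: "\<forall>m\<ge>M. \<forall>N. L2_set (\<lambda>k. cmod (ell2_nth (X m) k - g k)) {..<N} \<le> r / 2"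
      using tail[of "r / 2"] by auto
    have "norm (X m - Abs_ell2 g) \<le> r / 2" if "m \<ge> M" for m
      unfolding norm_ell2_def using M that by (intro norm_ell2_leI) (simp add: x)
    thus "\<exists>M. \<forall>m\<ge>M. norm (X m - Abs_ell2 g) < r"
      using \<open>r > 0\<close> by (intro exI[of _ M]) fastforce
  qed
  thus "convergent X" by (auto simp: convergent_def)
qed

instantiation ell2 :: chilbert_space
begin

definition cinner_ell2 :: "ell2 \<Rightarrow> ell2 \<Rightarrow> complex" where
  "cinner_ell2 x y = (\<Sum>n. cnj (ell2_nth x n) * ell2_nth y n)"

instance
proof
  fix x y z :: ell2 and r :: real and c :: complex
  show "r *\<^sub>R x = complex_of_real r *\<^sub>C x" by (rule scaleR_ell2_def)
  have "(\<lambda>n. cnj (cnj (ell2_nth y n) * ell2_nth x n)) sums cnj (cinner y x)"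
    unfolding cinner_ell2_def sums_cnj by (rule summable_sums[OF summable_cinner_ell2])
  thus "cinner x y = cnj (cinner y x)"
    unfolding cinner_ell2_def by (simp add: sums_iff mult.commute)
  show "cinner x (y + z) = cinner x y + cinner x z"
    unfolding cinner_ell2_def
    by (simp add: distrib_left suminf_add[OF summable_cinner_ell2 summable_cinner_ell2])
  show "cinner x (c *\<^sub>C y) = c * cinner x y"
    unfolding cinner_ell2_def
    by (simp add: mult.left_commute suminf_mult[OF summable_cinner_ell2])
  have "cinner x x = (\<Sum>n. complex_of_real ((cmod (ell2_nth x n))\<^sup>2))"
    unfolding cinner_ell2_def by (intro arg_cong[where f = suminf] ext)
      (metis complex_norm_square mult.commute)
  also have "\<dots> = complex_of_real (\<Sum>n. (cmod (ell2_nth x n))\<^sup>2)"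
    using suminf_of_real[OF summable_ell2_nth[of x], where 'a = complex] by simp
  also have "\<dots> = complex_of_real ((norm x)\<^sup>2)"
    by (simp add: norm_ell2_def suminf_nonneg summable_ell2_nth)
  finally show "cinner x x = complex_of_real ((norm x)\<^sup>2)" .
qed

end


section \<open>Bounded operators and von Neumann algebras\<close>

typedef (overloaded) 'h cop =
  "{f :: 'h::chilbert_space \<Rightarrow> 'h. bounded_linear f \<and> (\<forall>c x. f (c *\<^sub>C x) = c *\<^sub>C f x)}"
  morphisms cop_apply Abs_cop
  by (rule exI[of _ "\<lambda>x. x"]) (simp add: bounded_linear_ident)

setup_lifting type_definition_cop

lemma scaleC_zero_right [simp]: "a *\<^sub>C (0 :: 'a::complex_vector) = 0"
  using scaleC_add_right[of a 0 "0 :: 'a"] by simp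

lemma scaleC_minus_right: "a *\<^sub>C (- x :: 'a::complex_vector) = - (a *\<^sub>C x)"
  using scaleC_add_right[of a x "- x"] by (simp add: eq_neg_iff_add_eq_0 add.commute)

lemma norm_scaleC: "norm (c *\<^sub>C x :: 'h::chilbert_space) = cmod c * norm x"
proof -
  have "cinner (c *\<^sub>C x) (c *\<^sub>C x) = c * (cnj c * cinner x x)"
    by (metis cinner_scaleC_right cinner_commute complex_cnj_mult)
  hence "complex_of_real ((norm (c *\<^sub>C x))\<^sup>2) = complex_of_real ((cmod c * norm x)\<^sup>2)"
    by (simp add: cinner_norm power_mult_distrib complex_norm_square mult.assoc del: of_real_power)
  hence "(norm (c *\<^sub>C x))\<^sup>2 = (cmod c * norm x)\<^sup>2"
    using of_real_eq_iff by blast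
  thus ?thesis by (simp add: power2_eq_iff_nonneg)
qed

lemma bounded_linear_scaleC: "bounded_linear (\<lambda>x :: 'h::chilbert_space. c *\<^sub>C x)"
proof (rule bounded_linear_intro[where K = "cmod c"])
  fix r :: real and x y :: 'h
  show "c *\<^sub>C (x + y) = c *\<^sub>C x + c *\<^sub>C y" by (rule scaleC_add_right)
  show "c *\<^sub>C (r *\<^sub>R x) = r *\<^sub>R (c *\<^sub>C x)"
    by (simp add: scaleR_scaleC scaleC_scaleC mult.commute)
  show "norm (c *\<^sub>C x) \<le> norm x * cmod c" by (simp add: norm_scaleC mult.commute)
qed

instantiation cop :: (chilbert_space) "{ring, monoid_mult, complex_vector}"
begin

lift_definition zero_cop :: "'a cop" is "\<lambda>_. 0" by simp
lift_definition plus_cop :: "'a cop \<Rightarrow> 'a cop \<Rightarrow> 'a cop" is "\<lambda>f g x. f x + g x"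
  by (auto intro: bounded_linear_add simp: scaleC_add_right)
lift_definition uminus_cop :: "'a cop \<Rightarrow> 'a cop" is "\<lambda>f x. - f x"
  by (auto intro: bounded_linear_minus simp: scaleC_minus_right)
definition minus_cop :: "'a cop \<Rightarrow> 'a cop \<Rightarrow> 'a cop" where "minus_cop S T = S + - T"
lift_definition scaleC_cop :: "complex \<Rightarrow> 'a cop \<Rightarrow> 'a cop" is "\<lambda>c f x. c *\<^sub>C f x"
  by (auto intro: bounded_linear_compose[OF bounded_linear_scaleC]
      simp: scaleC_scaleC mult.commute)
lift_definition one_cop :: "'a cop" is "\<lambda>x. x" by (simp add: bounded_linear_ident)
lift_definition times_cop :: "'a cop \<Rightarrow> 'a cop \<Rightarrow> 'a cop" is "\<lambda>f g x. f (g x)"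
  by (auto intro: bounded_linear_compose)

instance
proof
  fix S T U :: "'a cop" and a b :: complex
  show "S - T = S + - T" by (rule minus_cop_def)
  show "S * (T + U) = S * T + S * U"
    by transfer (auto simp: linear_add bounded_linear.linear)
qed (transfer; simp add: fun_eq_iff add_ac scaleC_add_right scaleC_add_left scaleC_scaleC
    scaleC_one)+

end

definition is_adjoint :: "'h::chilbert_space cop \<Rightarrow> 'h cop \<Rightarrow> bool" where
  "is_adjoint S T \<longleftrightarrow> (\<forall>x y. cinner (cop_apply S x) y = cinner x (cop_apply T y))"

definition selfadjoint :: "'h::chilbert_space cop \<Rightarrow> bool" where
  "selfadjoint T \<longleftrightarrow> is_adjoint T T"

definition positive_cop :: "'h::chilbert_space cop \<Rightarrow> bool" where
  "positive_cop T \<longleftrightarrow> (\<forall>x. cinner x (cop_apply T x) \<in> \<real>\<^sub>\<ge>\<^sub>0)"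

definition loewner_le :: "'h::chilbert_space cop \<Rightarrow> 'h cop \<Rightarrow> bool"  (infix \<open>\<preceq>\<^sub>L\<close> 50) where
  "S \<preceq>\<^sub>L T \<longleftrightarrow> positive_cop (T - S)"

definition commutant :: "'h::chilbert_space cop set \<Rightarrow> 'h cop set" where
  "commutant A = {T. \<forall>S\<in>A. S * T = T * S}"

text \<open>That a von Neumann algebra is a unital subalgebra is part of the bicommutant equation.\<close>

definition von_neumann_algebra :: "'h::chilbert_space cop set \<Rightarrow> bool" where
  "von_neumann_algebra A \<longleftrightarrow>
     (\<forall>T\<in>A. \<exists>S\<in>A. is_adjoint S T) \<and> commutant (commutant A) = A"


section \<open>Tracial noncommutative probability spaces\<close>

text \<open>Only the values of \<^term>\<open>\<tau>\<close> on \<^term>\<open>A\<close> matter. Normality says that \<^term>\<open>\<tau>\<close>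
  preserves least upper bounds of upward directed sets of positive elements that have one
  in \<^term>\<open>A\<close>.\<close>

locale tracial_ncps =
  fixes A :: "'h::chilbert_space cop set" and \<tau> :: "'h cop \<Rightarrow> complex"
  assumes von_neumann: "von_neumann_algebra A"
    and add: "\<lbrakk>S \<in> A; T \<in> A\<rbrakk> \<Longrightarrow> \<tau> (S + T) = \<tau> S + \<tau> T"
    and scale: "T \<in> A \<Longrightarrow> \<tau> (c *\<^sub>C T) = c * \<tau> T"
    and unit: "\<tau> 1 = 1"
    and positive: "\<lbrakk>T \<in> A; positive_cop T\<rbrakk> \<Longrightarrow> \<tau> T \<in> \<real>\<^sub>\<ge>\<^sub>0"
    and faithful: "\<lbrakk>T \<in> A; positive_cop T; \<tau> T = 0\<rbrakk> \<Longrightarrow> T = 0"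
    and tracial: "\<lbrakk>S \<in> A; T \<in> A\<rbrakk> \<Longrightarrow> \<tau> (S * T) = \<tau> (T * S)"
    and normal: "\<lbrakk>F \<subseteq> {S \<in> A. positive_cop S}; F \<noteq> {};
        \<forall>S\<in>F. \<forall>S'\<in>F. \<exists>U\<in>F. S \<preceq>\<^sub>L U \<and> S' \<preceq>\<^sub>L U;
        T \<in> A; \<forall>S\<in>F. S \<preceq>\<^sub>L T; \<forall>U\<in>A. (\<forall>S\<in>F. S \<preceq>\<^sub>L U) \<longrightarrow> T \<preceq>\<^sub>L U\<rbrakk>
        \<Longrightarrow> Re (\<tau> T) = (SUP S\<in>F. Re (\<tau> S))"

definition variance :: "('a::monoid_mult \<Rightarrow> complex) \<Rightarrow> 'a \<Rightarrow> complex" where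
  "variance \<tau> X = \<tau> (X ^ 2) - (\<tau> X)\<^sup>2"

text \<open>The two variables may live in different probability spaces.\<close>

definition same_distribution ::
    "('a::monoid_mult \<Rightarrow> complex) \<Rightarrow> 'a \<Rightarrow> ('b::monoid_mult \<Rightarrow> complex) \<Rightarrow> 'b \<Rightarrow> bool" where
  "same_distribution \<tau> X \<sigma> Y \<longleftrightarrow> (\<forall>m. \<tau> (X ^ m) = \<sigma> (Y ^ m))"

definition converges_in_distribution ::
    "('a::monoid_mult \<Rightarrow> complex) \<Rightarrow> (nat \<Rightarrow> 'a) \<Rightarrow> ('b::monoid_mult \<Rightarrow> complex) \<Rightarrow> 'b \<Rightarrow> bool" where
  "converges_in_distribution \<tau> X \<sigma> Y \<longleftrightarrow> (\<forall>m. (\<lambda>n. \<tau> (X n ^ m)) \<longlonglongrightarrow> \<sigma> (Y ^ m))"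


section \<open>Freeness\<close>

inductive_set generated_algebra :: "'a::{ring,monoid_mult,complex_vector} \<Rightarrow> 'a set"
  for X :: 'a where
  one: "1 \<in> generated_algebra X"
| gen: "X \<in> generated_algebra X"
| add: "\<lbrakk>S \<in> generated_algebra X; T \<in> generated_algebra X\<rbrakk> \<Longrightarrow> S + T \<in> generated_algebra X"
| scale: "S \<in> generated_algebra X \<Longrightarrow> c *\<^sub>C S \<in> generated_algebra X"
| mult: "\<lbrakk>S \<in> generated_algebra X; T \<in> generated_algebra X\<rbrakk> \<Longrightarrow> S * T \<in> generated_algebra X"

text \<open>A word is a nonempty list of pairs \<open>(i, a)\<close> with \<open>a\<close> a centred element of the
  subalgebra with index \<open>i\<close>; the word is alternating if neighbouring indices are distinct.\<close>

definition free_subalgebras ::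
    "('a::monoid_mult \<Rightarrow> complex) \<Rightarrow> 'i set \<Rightarrow> ('i \<Rightarrow> 'a set) \<Rightarrow> bool" where
  "free_subalgebras \<tau> I B \<longleftrightarrow>
     (\<forall>w. w \<noteq> [] \<and> (\<forall>(i, a)\<in>set w. i \<in> I \<and> a \<in> B i \<and> \<tau> a = 0) \<and> distinct_adj (map fst w)
        \<longrightarrow> \<tau> (prod_list (map snd w)) = 0)"

text \<open>This is meant for self-adjoint variables, for which the generated unital algebra is
  closed under adjoints.\<close>

definition free_variables ::
    "('a::{ring,monoid_mult,complex_vector} \<Rightarrow> complex) \<Rightarrow> 'i set \<Rightarrow> ('i \<Rightarrow> 'a) \<Rightarrow> bool" where
  "free_variables \<tau> I X \<longleftrightarrow> free_subalgebras \<tau> I (\<lambda>i. generated_algebra (X i))"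


section \<open>Free cumulants and the R-transform\<close>

definition noncrossing :: "nat set set \<Rightarrow> bool" where
  "noncrossing P \<longleftrightarrow>
     (\<forall>B\<in>P. \<forall>C\<in>P. B \<noteq> C \<longrightarrow> \<not> (\<exists>a b c d. a < b \<and> b < c \<and> c < d \<and> a \<in> B \<and> c \<in> B \<and> b \<in> C \<and> d \<in> C))"

definition NC :: "nat \<Rightarrow> nat set set set" where
  "NC n = {P. partition_on {..<n} P \<and> noncrossing P}"

lemma length_nths_block:
  assumes "P \<in> NC n - {{{..<n}}}" "B \<in> P" "n = length xs"
  shows "length (nths xs B) < length xs"
proof -
  from assms have P: "partition_on {..<n} P" "P \<noteq> {{..<n}}" by (auto simp: NC_def)
  have sub: "B \<subseteq> {..<n}" using P(1) assms(2) by (auto simp: partition_on_def)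
  have "B \<noteq> {..<n}"
  proof
    assume B: "B = {..<n}"
    have "C = B" if "C \<in> P" for C
    proof (rule ccontr)
      assume "C \<noteq> B"
      hence "C \<inter> B = {}" using P(1) that assms(2) by (auto simp: partition_on_def disjoint_def)
      moreover have "C \<subseteq> B" "C \<noteq> {}" using P(1) that B by (auto simp: partition_on_def)
      ultimately show False by blast
    qed
    thus False using P(2) assms(2) B by blast
  qed
  moreover have "{i. i < length xs \<and> i \<in> B} = B" using sub assms(3) by auto
  ultimately show ?thesis
    using sub psubset_card_mono[of "{..<n}" B] assms(3) by (auto simp: length_nths)
qed

text \<open>The moment-cumulant formula, solved for the summand of the one-block partition.
  Positions are counted from 0, so that \<^term>\<open>nths xs B\<close> lists the arguments of the
  block \<^term>\<open>B\<close> in increasing order of position.\<close>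

function free_cumulant :: "('a::monoid_mult \<Rightarrow> complex) \<Rightarrow> 'a list \<Rightarrow> complex" where
  "free_cumulant \<tau> xs =
     \<tau> (prod_list xs)
     - (\<Sum>P \<in> NC (length xs) - {{{..<length xs}}}. \<Prod>B\<in>P. free_cumulant \<tau> (nths xs B))"
  by pat_completeness auto
termination
  by (relation "Wellfounded.measure (\<lambda>(\<tau>, xs). length xs)") (auto intro: length_nths_block)

declare free_cumulant.simps [simp del]

lemma finite_NC: "finite (NC n)"
  by (rule finite_subset[of _ "Pow (Pow {..<n})"]) (auto simp: NC_def partition_on_def)

lemma moment_cumulant_formula:
  assumes "xs \<noteq> []"
  shows "\<tau> (prod_list xs) = (\<Sum>P\<in>NC (length xs). \<Prod>B\<in>P. free_cumulant \<tau> (nths xs B))"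
proof -
  let ?n = "length xs"
  have "{{..<?n}} \<in> NC ?n"
    using assms by (auto simp: NC_def noncrossing_def partition_on_def)
  moreover have "nths xs {..<?n} = xs" by (simp add: nths_upt_eq_take)
  ultimately show ?thesis
    by (subst sum.remove[OF finite_NC, of "{{..<?n}}"])
      (auto simp: free_cumulant.simps[of \<tau> xs])
qed

definition R_transform :: "('a::monoid_mult \<Rightarrow> complex) \<Rightarrow> 'a \<Rightarrow> complex fps" where
  "R_transform \<tau> X = Abs_fps (\<lambda>n. free_cumulant \<tau> (replicate (n + 1) X))"

end

theory Submission
  imports Defs
begin

text \<open>The commutator does not see the mean, so \<open>Q\<^sub>n\<close> is the quadratic form
  \<open>\<Sum> E\<^sub>n(x, y) Z\<^sub>x Z\<^sub>y\<close> in the centred variables with the Hermitian kernel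
  \<open>E\<^sub>n(x, y) = (i/n) sgn(y - x)\<close>. In \<open>\<tau>(Q\<^sub>n\<^sup>m)\<close> only words survive in which every
  letter occurs twice; there the mixed moments are those of free semicircular variables. For these
  the moments of a quadratic form are exactly those with free cumulants \<open>Tr(E\<^sub>n\<^sup>s)\<close>, as both
  sides satisfy the recursion that splits off the first block of a noncrossing partition.
  The generating function of the traces is rational and explicit,
  \<open>\<Sum> Tr(E\<^sub>n\<^sup>s\<^sup>+\<^sup>1) z\<^sup>s = i (v\<^sup>n\<^sup>-\<^sup>1 - u\<^sup>n\<^sup>-\<^sup>1) / (u\<^sup>n + v\<^sup>n)\<close> with \<open>u = 1 + i z / n\<close> and
  \<open>v = 1 - i z / n\<close>, and tends coefficientwise to \<open>tan z\<close>.

  The limit moments are positive semidefinite and grow at most exponentially, so orthogonal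
  polynomials give a bounded selfadjoint Jacobi operator \<open>Y\<close> with these moments in a vector state.
  That state is faithful and normal on the commutative von Neumann algebra generated by \<open>Y\<close>.\<close>

text \<open>The recursion does not close on moments alone, so both sides carry a parameter for an
  unfinished first block: \<open>free_moment\<close> has a surplus of elements already removed,
  \<open>fock_moment_with\<close> an arbitrary first kernel. Removing an element raises the surplus
  by one; contracting a letter multiplies the first kernel by \<open>E\<close>. The two steps match
  because Tr(E^s) is the cumulant of order s. All growth estimates have one source: kernel entries
  of size 1/n make every trace at most 1 in modulus, uniformly in n. The bound passes to the
  coefficients of tan, and together with the Catalan count of noncrossing partitions it bounds the
  limit moments by 2 * 4^k and hence the Jacobi coefficients by 4. The obstacle in constructing
  \<open>Y\<close> is that the limit functional is only known to be positive semidefinite, so the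
  orthogonal polynomials may reach a null vector after finitely many steps, although the operator
  has to live on an infinite-dimensional space. For normality the difficulty is that directed sets
  are arbitrary, while strong limits are available along increasing sequences.\<close>

section \<open>Free cumulants of a given moment sequence\<close>

text \<open>At \<open>s = 0\<close> these are the moments with free cumulants
  \<open>\<kappa>\<close>. In the second equation the first point either closes its block, or
  \<open>p\<close> points are nested between it and the next element of its block, which then starts
  the remaining \<open>n - p\<close> points. The value \<open>\<kappa> 0\<close> is never
  read.\<close>

fun free_moment :: "(nat \<Rightarrow> 'a::comm_ring_1) \<Rightarrow> nat \<Rightarrow> nat \<Rightarrow> 'a" where
  "free_moment \<kappa> s 0 = 1"
| "free_moment \<kappa> s (Suc n) = \<kappa> (Suc s) * free_moment \<kappa> 0 n
     + (\<Sum>p<n. free_moment \<kappa> 0 p * free_moment \<kappa> (Suc s) (n - p))"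

lemma tendsto_free_moment:
  fixes \<kappa> :: "nat \<Rightarrow> 'a::{real_normed_field}"
  assumes "\<And>s. ((\<lambda>N. \<kappa>' N s) \<longlongrightarrow> \<kappa> s) F"
  shows "((\<lambda>N. free_moment (\<kappa>' N) s n) \<longlongrightarrow> free_moment \<kappa> s n) F"
proof (induction n arbitrary: s rule: less_induct)
  case (less n)
  show ?case
  proof (cases n)
    case (Suc k)
    show ?thesis unfolding Suc free_moment.simps
      by (intro tendsto_intros assms less.IH) (auto simp: Suc)
  qed auto
qed

text \<open>The surplus enters only through the index of a cumulant, so it has no effect when all
  cumulants are 1. Both summands of the recursion then merge into the Catalan recursion.\<close>

lemma free_moment_one_Suc:
  "free_moment (\<lambda>_. 1) s (Suc n) =
     (\<Sum>p\<le>n. free_moment (\<lambda>_. 1 :: 'a::comm_ring_1) 0 p * free_moment (\<lambda>_. 1) 0 (n - p))"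
proof -
  have indep: "free_moment (\<lambda>_. 1 :: 'a) s n = free_moment (\<lambda>_. 1) 0 n" for s n
  proof (induction n arbitrary: s rule: less_induct)
    case (less n)
    show ?case
    proof (cases n)
      case (Suc k)
      have eq: "free_moment (\<lambda>_. 1 :: 'a) (Suc s) (k - p) = free_moment (\<lambda>_. 1) (Suc 0) (k - p)"
        if "p < k" for p s
        using less.IH[of "k - p"] Suc that by (metis diff_le_self less_Suc_eq_le)
      have "(\<Sum>p<k. free_moment (\<lambda>_. 1 :: 'a) 0 p * free_moment (\<lambda>_. 1) (Suc s) (k - p)) =
          (\<Sum>p<k. free_moment (\<lambda>_. 1) 0 p * free_moment (\<lambda>_. 1) (Suc 0) (k - p))"
        by (intro sum.cong refl arg_cong2[where f = "(*)"] eq) auto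
      thus ?thesis unfolding Suc free_moment.simps by simp
    qed auto
  qed
  show ?thesis
    by (simp add: indep[of "Suc s"] lessThan_Suc_atMost[symmetric])
qed

text \<open>The partial sums S of the Catalan generating function at 1/4 satisfy S' <= 1 + S^2 / 4
  from one to the next, because the triangle of a Cauchy product lies in a square. The bound 2 is
  the fixed point of x = 1 + x^2 / 4.\<close>

lemma free_moment_one_le: "free_moment (\<lambda>_. 1 :: real) 0 n \<le> 2 * 4 ^ n"
proof -
  define c where "c = free_moment (\<lambda>_. 1 :: real) 0"
  have c0: "c n \<ge> 0" for n
  proof (induction n rule: less_induct)
    case (less n)
    show ?case
    proof (cases n)
      case (Suc k)
      show ?thesis unfolding c_def Suc free_moment_one_Suc
        unfolding c_def[symmetric] by (intro sum_nonneg mult_nonneg_nonneg less) (auto simp: Suc)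
    qed (simp add: c_def)
  qed
  have bound: "(\<Sum>n\<le>N. c n / 4 ^ n) \<le> 2" for N
  proof (induction N)
    case (Suc N)
    have "(\<Sum>n\<le>Suc N. c n / 4 ^ n) = 1 + (\<Sum>n\<le>N. c (Suc n) / 4 ^ Suc n)"
      by (subst sum.atMost_Suc_shift) (simp add: c_def)
    also have "(\<Sum>n\<le>N. c (Suc n) / 4 ^ Suc n) = (\<Sum>n\<le>N. \<Sum>p\<le>n. c p / 4 ^ p * (c (n - p) / 4 ^ (n - p))) / 4"
      unfolding c_def free_moment_one_Suc sum_divide_distrib
      by (intro sum.cong) (auto simp: power_add[symmetric])
    also have "(\<Sum>n\<le>N. \<Sum>p\<le>n. c p / 4 ^ p * (c (n - p) / 4 ^ (n - p)))
        = (\<Sum>(p, q)\<in>{(p, q). p + q \<le> N}. c p / 4 ^ p * (c q / 4 ^ q))"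
      by (subst sum.triangle_reindex_eq) (auto intro!: sum.cong)
    also have "\<dots> \<le> (\<Sum>(p, q)\<in>{..N} \<times> {..N}. c p / 4 ^ p * (c q / 4 ^ q))"
      by (intro sum_mono2) (auto intro!: mult_nonneg_nonneg divide_nonneg_nonneg c0)
    also have "\<dots> = (\<Sum>n\<le>N. c n / 4 ^ n) ^ 2"
      by (simp add: power2_eq_square sum_product sum.cartesian_product)
    also have "\<dots> \<le> 2 ^ 2"
      by (intro power_mono Suc sum_nonneg divide_nonneg_nonneg c0) auto
    finally show ?case by simp
  qed (simp add: c_def)
  have "c n / 4 ^ n \<le> (\<Sum>k\<le>n. c k / 4 ^ k)"
    by (rule member_le_sum) (auto intro: divide_nonneg_nonneg c0)
  also note bound[of n]
  finally show ?thesis by (simp add: c_def field_simps)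
qed

text \<open>The recursion has nonnegative coefficients, so the case of all cumulants equal to 1
  dominates. This is the origin of the growth rate 4 of the limit moments.\<close>

lemma norm_free_moment_le:
  fixes \<kappa> :: "nat \<Rightarrow> 'a::real_normed_field"
  assumes "\<And>s. norm (\<kappa> s) \<le> 1"
  shows "norm (free_moment \<kappa> s n) \<le> 2 * 4 ^ n"
proof -
  have "norm (free_moment \<kappa> s n) \<le> free_moment (\<lambda>_. 1) s n" for s
  proof (induction n arbitrary: s rule: less_induct)
    case (less n)
    show ?case
    proof (cases n)
      case (Suc k)
      have "norm (free_moment \<kappa> s n) \<le> norm (\<kappa> (Suc s)) * norm (free_moment \<kappa> 0 k) +
          (\<Sum>p<k. norm (free_moment \<kappa> 0 p) * norm (free_moment \<kappa> (Suc s) (k - p)))"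
        unfolding Suc free_moment.simps norm_mult[symmetric]
        by (intro norm_triangle_mono norm_sum order.refl)
      also have "\<dots> \<le> 1 * free_moment (\<lambda>_. 1) 0 k +
          (\<Sum>p<k. free_moment (\<lambda>_. 1) 0 p * free_moment (\<lambda>_. 1) (Suc s) (k - p))"
        by (intro add_mono mult_mono' sum_mono less.IH assms norm_ge_zero) (auto simp: Suc)
      finally show ?thesis by (simp add: Suc)
    qed auto
  qed
  moreover have "free_moment (\<lambda>_. 1 :: real) s n = free_moment (\<lambda>_. 1) 0 n"
    by (cases n) (simp_all only: free_moment_one_Suc free_moment.simps(1))
  ultimately show ?thesis using free_moment_one_le[of n] by (metis order.trans)
qed

section \<open>Splitting a noncrossing partition at the second element of its first block\<close>

definition NC_on :: "nat set \<Rightarrow> nat set set set" where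
  "NC_on S = {P. partition_on S P \<and> noncrossing P}"

text \<open>Intended for \<open>P\<close> on the gap strictly between \<open>a\<close> and
  \<open>p\<close> and for \<open>P'\<close> on the points from \<open>p\<close> onwards;
  \<open>a\<close> is put in front of the block of \<open>p\<close>.\<close>

definition glue :: "nat \<Rightarrow> nat \<Rightarrow> nat set set \<times> nat set set \<Rightarrow> nat set set" where
  "glue a p = (\<lambda>(P, P'). P \<union> (\<lambda>B. if p \<in> B then insert a B else B) ` P')"

definition unglue :: "nat \<Rightarrow> nat \<Rightarrow> nat set set \<Rightarrow> nat set set \<times> nat set set" where
  "unglue a p P = ({B \<in> P. B \<subseteq> {a<..<p}}, (\<lambda>B. B - {a}) ` {B \<in> P. \<not> B \<subseteq> {a<..<p}})"

definition NC_next :: "nat \<Rightarrow> nat \<Rightarrow> nat \<Rightarrow> nat set set set" where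
  "NC_next a b p = {P \<in> NC_on {a..<b}. \<exists>B\<in>P. a \<in> B \<and> p \<in> B \<and> B \<inter> {a<..<p} = {}}"

lemma noncrossingD:
  assumes "noncrossing P" "B \<in> P" "C \<in> P" "w \<in> B" "y \<in> B" "x \<in> C" "z \<in> C" "w < x" "x < y" "y < z"
  shows "B = C"
  using assms unfolding noncrossing_def by meson

lemma noncrossingI:
  assumes "\<And>B C w x y z. \<lbrakk>B \<in> P; C \<in> P; B \<noteq> C; w \<in> B; y \<in> B; x \<in> C; z \<in> C; w < x; x < y; y < z\<rbrakk> \<Longrightarrow> False"
  shows "noncrossing P"
  using assms unfolding noncrossing_def by meson

lemma NC_onD:
  assumes "P \<in> NC_on S"
  shows "\<Union>P = S" "\<And>B. B \<in> P \<Longrightarrow> B \<subseteq> S" "\<And>B. B \<in> P \<Longrightarrow> B \<noteq> {}"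
    "\<And>B C x. B \<in> P \<Longrightarrow> C \<in> P \<Longrightarrow> x \<in> B \<Longrightarrow> x \<in> C \<Longrightarrow> B = C" "noncrossing P"
proof -
  have P: "\<Union>P = S" "disjoint P" "{} \<notin> P" "noncrossing P"
    using assms by (simp_all add: NC_on_def partition_on_def)
  show "\<Union>P = S" "noncrossing P" by fact+
  show "B \<subseteq> S" if "B \<in> P" for B using that P(1) by blast
  show "B \<noteq> {}" if "B \<in> P" for B using that P(3) by blast
  show "B = C" if "B \<in> P" "C \<in> P" "x \<in> B" "x \<in> C" for B C x
    using disjointD[OF P(2) that(1,2)] that(3,4) by blast
qed

lemma NC_onI:
  assumes "\<Union>P = S" "\<And>B. B \<in> P \<Longrightarrow> B \<noteq> {}"
    "\<And>B C x. B \<in> P \<Longrightarrow> C \<in> P \<Longrightarrow> x \<in> B \<Longrightarrow> x \<in> C \<Longrightarrow> B = C" "noncrossing P"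
  shows "P \<in> NC_on S"
proof -
  have "disjoint P" by (rule disjointI) (use assms(3) in blast)
  moreover have "{} \<notin> P" using assms(2) by blast
  ultimately show ?thesis using assms(1,4) by (simp add: NC_on_def partition_on_def)
qed

lemma finite_NC_on: "finite S \<Longrightarrow> finite (NC_on S)"
  by (rule finite_subset[of _ "Pow (Pow S)"]) (auto simp: NC_on_def partition_on_def)

lemma glue_in_NC_next:
  assumes P: "P \<in> NC_on {Suc a..<p}" and P': "P' \<in> NC_on {p..<b}" and p: "a < p" "p < b"
  shows "glue a p (P, P') \<in> NC_next a b p"
proof -
  note D = NC_onD[OF P] and D' = NC_onD[OF P']
  let ?g = "\<lambda>B. if p \<in> B then insert a B else B"
  have "p \<in> \<Union>P'" using D'(1) p by simp
  then obtain B\<^sub>0 where B\<^sub>0: "B\<^sub>0 \<in> P'" "p \<in> B\<^sub>0" by blast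
  have sub: "\<And>x. x \<in> B \<Longrightarrow> a < x \<and> x < p" if "B \<in> P" for B
    using D(2)[OF that] by auto
  have sub': "\<And>x. x \<in> B \<Longrightarrow> p \<le> x \<and> x < b" if "B \<in> P'" for B
    using D'(2)[OF that] by auto
  have sub'': "x = a \<and> p \<in> B \<or> x \<in> B" if "B \<in> P'" "x \<in> ?g B" for B x
    using that by (auto split: if_splits)
  have "glue a p (P, P') \<in> NC_on {a..<b}"
  proof (rule NC_onI)
    have "\<Union>(?g ` P') = insert a (\<Union>P')"
      using B\<^sub>0 by (auto split: if_splits)
    thus "\<Union>(glue a p (P, P')) = {a..<b}"
      using D(1) D'(1) p by (auto simp: glue_def)
    show "B \<noteq> {}" if "B \<in> glue a p (P, P')" for B
      using that D(3) D'(3) by (auto simp: glue_def)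
    show "B = C" if "B \<in> glue a p (P, P')" "C \<in> glue a p (P, P')" "x \<in> B" "x \<in> C" for B C x
    proof -
      consider "B \<in> P" "C \<in> P" | C' where "B \<in> P" "C' \<in> P'" "C = ?g C'"
        | B' where "B' \<in> P'" "B = ?g B'" "C \<in> P" | B' C' where "B' \<in> P'" "C' \<in> P'" "B = ?g B'" "C = ?g C'"
        using \<open>B \<in> _\<close> \<open>C \<in> _\<close> by (auto simp: glue_def)
      thus ?thesis
      proof cases
        case 1 thus ?thesis using D(4) that by blast
      next
        case 2
        thus ?thesis using sub[of B x] sub'[of C' x] sub''[of C' x] that by force
      next
        case 3
        thus ?thesis using sub[of C x] sub'[of B' x] sub''[of B' x] that by force
      next
        case 4
        have "a \<notin> B'" "a \<notin> C'" using sub'[OF 4(1), of a] sub'[OF 4(2), of a] p by auto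
        hence "x \<in> B' \<and> x \<in> C' \<or> p \<in> B' \<and> p \<in> C'"
          using sub''[OF 4(1), of x] sub''[OF 4(2), of x] that(3,4) 4(3,4) by blast
        hence "B' = C'" using D'(4)[OF 4(1,2)] by blast
        thus ?thesis using 4 by simp
      qed
    qed
    show "noncrossing (glue a p (P, P'))"
    proof (rule noncrossingI)
      fix B C w x y z
      assume *: "B \<in> glue a p (P, P')" "C \<in> glue a p (P, P')" "B \<noteq> C"
        "w \<in> B" "y \<in> B" "x \<in> C" "z \<in> C" "w < x" "x < y" "y < z"
      consider "B \<in> P" "C \<in> P" | C' where "B \<in> P" "C' \<in> P'" "C = ?g C'"
        | B' where "B' \<in> P'" "B = ?g B'" "C \<in> P" | B' C' where "B' \<in> P'" "C' \<in> P'" "B = ?g B'" "C = ?g C'"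
        using *(1,2) by (auto simp: glue_def)
      thus False
      proof cases
        case 1 thus False using noncrossingD[OF D(5)] * by blast
      next
        case 2
        thus False using sub[of B w] sub[of B y] sub'[of C' x] sub''[of C' x] * by force
      next
        case 3
        thus False using sub[of C x] sub[of C z] sub'[of B' y] sub''[of B' y] * by force
      next
        case 4
        have "x \<in> C'" "y \<in> B'" "z \<in> C'"
          using 4 * sub''[of C' x] sub''[of B' y] sub''[of C' z] sub'[of B' w] sub''[of B' w] p by force+
        \<comment> \<open>A crossing that uses the added point \<open>a\<close> is moved to
          \<open>p\<close>: this point lies in the same block of \<open>P'\<close> and is still to
          the left of \<open>x\<close>.\<close>
        moreover have "\<exists>w'\<in>B'. w' < x"
        proof (cases "w = a \<and> p \<in> B'")
          case True
          hence "x \<noteq> p" using D'(4)[of B' C' p] 4 * \<open>x \<in> C'\<close> by auto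
          thus ?thesis using True sub'[of C' x] 4 \<open>x \<in> C'\<close> by (intro bexI[of _ p]) auto
        next
          case False
          thus ?thesis using sub''[of B' w] 4 * by blast
        qed
        ultimately have "B' = C'" using noncrossingD[OF D'(5)] 4(1,2) *(9,10) by blast
        hence "B = C" using 4(3,4) by simp
        thus False using *(3) by contradiction
      qed
    qed
  qed
  moreover have "insert a B\<^sub>0 \<in> glue a p (P, P')" using B\<^sub>0 by (auto simp: glue_def)
  moreover have "insert a B\<^sub>0 \<inter> {a<..<p} = {}" by (auto dest: sub'[OF B\<^sub>0(1)])
  moreover have "a \<in> insert a B\<^sub>0" "p \<in> insert a B\<^sub>0" using B\<^sub>0(2) by auto
  ultimately show ?thesis unfolding NC_next_def
    by (intro CollectI conjI bexI[of _ "insert a B\<^sub>0"])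
qed

text \<open>A block with points x < p < y would cross \<open>A\<close> in the pattern a < x < p < y.
  This is why the gap and the remainder can be partitioned independently.\<close>

lemma NC_next_other_block:
  assumes P: "P \<in> NC_next a b p" and A: "A \<in> P" "a \<in> A" "p \<in> A" "a < p"
    and B: "B \<in> P" "B \<noteq> A"
  shows "B \<subseteq> {a<..<p} \<or> B \<subseteq> {p<..<b}"
proof (rule ccontr)
  note D = NC_onD[of P "{a..<b}"]
  have NC: "P \<in> NC_on {a..<b}" using P by (auto simp: NC_next_def)
  have *: "a < x \<and> x < b \<and> x \<noteq> p" if "x \<in> B" for x
    using that A B D(2)[OF NC B(1)] D(4)[OF NC, of A B x] by (metis atLeastLessThan_iff le_neq_implies_less subsetD)
  assume "\<not> (B \<subseteq> {a<..<p} \<or> B \<subseteq> {p<..<b})"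
  then obtain x y where "x \<in> B" "y \<in> B" "x < p" "p < y"
    using * by (metis greaterThanLessThan_iff linorder_neqE_nat subsetI)
  thus False using noncrossingD[OF D(5)[OF NC], of A B a p x y] A B * by auto
qed

lemma unglue_in_NC_on:
  assumes P: "P \<in> NC_next a b p" and p: "a < p" "p < b"
  shows "unglue a p P \<in> NC_on {Suc a..<p} \<times> NC_on {p..<b}"
proof -
  have NC: "P \<in> NC_on {a..<b}" using P by (auto simp: NC_next_def)
  note D = NC_onD[OF NC]
  obtain A where A: "A \<in> P" "a \<in> A" "p \<in> A" and A': "A \<inter> {a<..<p} = {}"
    using P by (auto simp: NC_next_def)
  note other = NC_next_other_block[OF P A p(1)]
  have A'': "A - {a} \<subseteq> {p..<b}" using D(2)[OF A(1)] A' by (force simp: subset_iff disjoint_iff)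
  have "{B \<in> P. B \<subseteq> {a<..<p}} \<in> NC_on {Suc a..<p}"
  proof (rule NC_onI)
    show "\<Union>{B \<in> P. B \<subseteq> {a<..<p}} = {Suc a..<p}"
    proof (intro equalityI subsetI)
      fix x assume x: "x \<in> {Suc a..<p}"
      hence "x \<in> \<Union>P" using D(1) p by auto
      then obtain B where B: "B \<in> P" "x \<in> B" by auto
      moreover have "B \<noteq> A" using B A' x by auto
      ultimately show "x \<in> \<Union>{B \<in> P. B \<subseteq> {a<..<p}}" using other[of B] x by fastforce
    qed auto
    show "noncrossing {B \<in> P. B \<subseteq> {a<..<p}}"
      using D(5) unfolding noncrossing_def by blast
  qed (use D in blast)+
  moreover have "(\<lambda>B. B - {a}) ` {B \<in> P. \<not> B \<subseteq> {a<..<p}} \<in> NC_on {p..<b}"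
  proof (rule NC_onI)
    have sub: "\<Union>((\<lambda>B. B - {a}) ` {B \<in> P. \<not> B \<subseteq> {a<..<p}}) \<subseteq> {p..<b}"
      using A'' other by fastforce
    have sup: "x \<in> \<Union>((\<lambda>B. B - {a}) ` {B \<in> P. \<not> B \<subseteq> {a<..<p}})" if "x \<in> {p..<b}" for x
    proof -
      have "x \<in> \<Union>P" using D(1) p that by auto
      then obtain B where B: "B \<in> P" "x \<in> B" by auto
      moreover have "\<not> B \<subseteq> {a<..<p}" using B that by auto
      ultimately show ?thesis using that p by auto
    qed
    show "\<Union>((\<lambda>B. B - {a}) ` {B \<in> P. \<not> B \<subseteq> {a<..<p}}) = {p..<b}"
      by (rule equalityI[OF sub subsetI[OF sup]])
    show "B \<noteq> {}" if B: "B \<in> (\<lambda>B. B - {a}) ` {B \<in> P. \<not> B \<subseteq> {a<..<p}}" for B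
    proof -
      obtain B' where B': "B' \<in> P" "B = B' - {a}" using B by auto
      show ?thesis
      proof (cases "B' = A")
        case True thus ?thesis using A p B' by auto
      next
        case False thus ?thesis using other[of B'] B' D(3)[of B'] p by fastforce
      qed
    qed
    show "B = C" if "B \<in> (\<lambda>B. B - {a}) ` {B \<in> P. \<not> B \<subseteq> {a<..<p}}"
      "C \<in> (\<lambda>B. B - {a}) ` {B \<in> P. \<not> B \<subseteq> {a<..<p}}" "x \<in> B" "x \<in> C" for B C x
      using that D(4) by auto
    show "noncrossing ((\<lambda>B. B - {a}) ` {B \<in> P. \<not> B \<subseteq> {a<..<p}})"
    proof (rule noncrossingI)
      fix B C w x y z
      assume *: "B \<in> (\<lambda>B. B - {a}) ` {B \<in> P. \<not> B \<subseteq> {a<..<p}}"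
        "C \<in> (\<lambda>B. B - {a}) ` {B \<in> P. \<not> B \<subseteq> {a<..<p}}" "B \<noteq> C"
        "w \<in> B" "y \<in> B" "x \<in> C" "z \<in> C" "w < x" "x < y" "y < z"
      then obtain B' C' where "B' \<in> P" "C' \<in> P" "B = B' - {a}" "C = C' - {a}" by auto
      thus False using noncrossingD[OF D(5), of B' C' w y x z] * by auto
    qed
  qed
  ultimately show ?thesis by (simp add: unglue_def)
qed

lemma Collect_Un_split:
  assumes "\<And>B. B \<in> P \<Longrightarrow> \<phi> B" "\<And>B. B \<in> R \<Longrightarrow> \<not> \<phi> B"
  shows "{B \<in> P \<union> R. \<phi> B} = P" "{B \<in> P \<union> R. \<not> \<phi> B} = R"
  using assms by blast+

lemma unglue_glue:
  assumes P: "P \<in> NC_on {Suc a..<p}" and P': "P' \<in> NC_on {p..<b}" and p: "a < p" "p < b"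
  shows "unglue a p (glue a p (P, P')) = (P, P')"
proof -
  note D = NC_onD[OF P] and D' = NC_onD[OF P']
  let ?g = "\<lambda>B. if p \<in> B then insert a B else B"
  have 1: "B \<subseteq> {a<..<p}" if "B \<in> P" for B using D(2)[OF that] by auto
  have 2: "\<not> ?g B \<subseteq> {a<..<p}" if B: "B \<in> P'" for B
  proof -
    obtain x where "x \<in> B" using D'(3)[OF B] by blast
    moreover have "p \<le> x" using D'(2)[OF B] \<open>x \<in> B\<close> by auto
    ultimately show ?thesis by auto
  qed
  have 3: "?g B - {a} = B" if "B \<in> P'" for B
    using D'(2)[OF that] p by auto
  have "\<not> C \<subseteq> {a<..<p}" if C: "C \<in> ?g ` P'" for C
  proof -
    obtain B where eq: "C = ?g B" and "B \<in> P'" using C by blast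
    show ?thesis unfolding eq by (rule 2) fact
  qed
  note N = this
  have filter: "{B \<in> P \<union> ?g ` P'. B \<subseteq> {a<..<p}} = P"
    "{B \<in> P \<union> ?g ` P'. \<not> B \<subseteq> {a<..<p}} = ?g ` P'"
    by (rule Collect_Un_split[of P "\<lambda>B. B \<subseteq> {a<..<p}" "?g ` P'", OF 1 N]; assumption)+
  have "(\<lambda>B. ?g B - {a}) ` P' = (\<lambda>B. B) ` P'"
    by (rule image_cong[OF refl 3])
  hence "(\<lambda>B. B - {a}) ` ?g ` P' = P'"
    unfolding image_image image_ident .
  thus ?thesis unfolding unglue_def glue_def prod.case filter by (simp only:)
qed

lemma glue_unglue:
  assumes P: "P \<in> NC_next a b p" and p: "a < p" "p < b"
  shows "glue a p (unglue a p P) = P"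
proof -
  have NC: "P \<in> NC_on {a..<b}" using P by (auto simp: NC_next_def)
  note D = NC_onD[OF NC]
  obtain A where A: "A \<in> P" "a \<in> A" "p \<in> A" and A': "A \<inter> {a<..<p} = {}"
    using P by (auto simp: NC_next_def)
  note other = NC_next_other_block[OF P A p(1)]
  let ?g = "\<lambda>B. if p \<in> B then insert a B else B"
  have "?g (B - {a}) = B" if "B \<in> P" for B
  proof (cases "B = A")
    case False
    hence "p \<notin> B" "a \<notin> B" using D(4)[OF that A(1)] A by blast+
    thus ?thesis by auto
  qed (use A p in auto)
  hence "?g ` (\<lambda>B. B - {a}) ` {B \<in> P. \<not> B \<subseteq> {a<..<p}} = {B \<in> P. \<not> B \<subseteq> {a<..<p}}"
    unfolding image_image by force
  thus ?thesis unfolding glue_def unglue_def by auto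
qed

lemma bij_betw_glue:
  assumes "a < p" "p < b"
  shows "bij_betw (glue a p) (NC_on {Suc a..<p} \<times> NC_on {p..<b}) (NC_next a b p)"
proof (rule bij_betw_byWitness[where f' = "unglue a p"])
  show "\<forall>x\<in>NC_on {Suc a..<p} \<times> NC_on {p..<b}. unglue a p (glue a p x) = x"
    using unglue_glue assms by blast
  show "\<forall>P\<in>NC_next a b p. glue a p (unglue a p P) = P"
    using glue_unglue assms by blast
  show "glue a p ` (NC_on {Suc a..<p} \<times> NC_on {p..<b}) \<subseteq> NC_next a b p"
    using glue_in_NC_next assms by blast
  show "unglue a p ` NC_next a b p \<subseteq> NC_on {Suc a..<p} \<times> NC_on {p..<b}"
    using unglue_in_NC_on assms by blast
qed

lemma bij_betw_insert_singleton:
  assumes "a < b"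
  shows "bij_betw (insert {a}) (NC_on {Suc a..<b}) {P \<in> NC_on {a..<b}. {a} \<in> P}"
proof (rule bij_betw_byWitness[where f' = "\<lambda>P. P - {{a}}"])
  have notin: "{a} \<notin> P" if "P \<in> NC_on {Suc a..<b}" for P
    using NC_onD(2)[OF that, of "{a}"] by auto
  thus "\<forall>P\<in>NC_on {Suc a..<b}. insert {a} P - {{a}} = P" by blast
  show "insert {a} ` NC_on {Suc a..<b} \<subseteq> {P \<in> NC_on {a..<b}. {a} \<in> P}"
  proof clarify
    fix P assume P: "P \<in> NC_on {Suc a..<b}"
    note D = NC_onD[OF P]
    have "insert {a} P \<in> NC_on {a..<b}"
    proof (rule NC_onI)
      show "\<Union>(insert {a} P) = {a..<b}" using D(1) assms by auto
      show "B \<noteq> {}" if "B \<in> insert {a} P" for B using that D(3) by auto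
      show "B = C" if "B \<in> insert {a} P" "C \<in> insert {a} P" "x \<in> B" "x \<in> C" for B C x
        using that D(2,4) by fastforce
      show "noncrossing (insert {a} P)"
      proof (rule noncrossingI)
        fix B C w x y z
        assume "B \<in> insert {a} P" "C \<in> insert {a} P" "B \<noteq> C"
          "w \<in> B" "y \<in> B" "x \<in> C" "z \<in> C" "w < x" "x < y" "y < z"
        moreover from this have "B \<noteq> {a}" "C \<noteq> {a}" by auto
        ultimately show False using noncrossingD[OF D(5)] by blast
      qed
    qed
    thus "insert {a} P \<in> NC_on {a..<b} \<and> {a} \<in> insert {a} P" by simp
  qed
  show "(\<lambda>P. P - {{a}}) ` {P \<in> NC_on {a..<b}. {a} \<in> P} \<subseteq> NC_on {Suc a..<b}"
  proof clarify
    fix P assume P: "P \<in> NC_on {a..<b}" "{a} \<in> P"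
    note D = NC_onD[OF P(1)]
    show "P - {{a}} \<in> NC_on {Suc a..<b}"
    proof (rule NC_onI)
      have "\<Union>(P - {{a}}) = \<Union>P - {a}" using D(4)[OF P(2)] by fastforce
      thus "\<Union>(P - {{a}}) = {Suc a..<b}" using D(1) assms by auto
      show "noncrossing (P - {{a}})" using D(5) unfolding noncrossing_def by blast
    qed (use D in blast)+
  qed
qed auto

text \<open>The parameter \<open>s\<close> counts elements of the first block that were split off.\<close>

theorem sum_NC_on_eq_free_moment:
  fixes \<kappa> :: "nat \<Rightarrow> 'a::comm_ring_1"
  assumes "a \<le> b"
  shows "(\<Sum>P\<in>NC_on {a..<b}. \<Prod>B\<in>P. \<kappa> (card B + (if a \<in> B then s else 0))) =
    free_moment \<kappa> s (b - a)"
  using assms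
proof (induction "b - a" arbitrary: a b s rule: less_induct)
  case less
  define w where "w = (\<lambda>s (a::nat) P. \<Prod>B\<in>P. \<kappa> (card B + (if a \<in> B then s else 0)))"
  have IH: "sum (w s a') (NC_on {a'..<b'}) = free_moment \<kappa> s (b' - a')"
    if "b' - a' < b - a" "a' \<le> b'" for a' b' s
    unfolding w_def by (rule less) (use that in auto)
  show ?case
  proof (cases "a = b")
    case True
    have "NC_on {} = {{}}" by (auto simp: NC_on_def noncrossing_def partition_on_def)
    thus ?thesis using True by simp
  next
    case False
    hence ab: "a < b" using less.prems by auto
    have fin: "finite P" "\<And>B. B \<in> P \<Longrightarrow> finite B" if "P \<in> NC_on {c..<d}" for P c d
      using NC_onD(1)[OF that] by (metis finite_UnionD finite_atLeastLessThan)
        (use NC_onD(2)[OF that] finite_subset in blast)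
    have first: "a \<notin> B" if "P \<in> NC_on {Suc a..<d}" "B \<in> P" for P B d
      using NC_onD(2)[OF that] by auto
    have w0: "w s a P = w 0 a' P" if "P \<in> NC_on {Suc a..<d}" for P s d a'
      unfolding w_def by (intro prod.cong) (use first[OF that] in auto)
    let ?S = "{P \<in> NC_on {a..<b}. {a} \<in> P}"
    \<comment> \<open>The two alternatives of the recursion: \<open>a\<close> is alone in its block,
      or it has a successor \<open>p\<close> there.\<close>
    have decomp: "NC_on {a..<b} = ?S \<union> (\<Union>p\<in>{Suc a..<b}. NC_next a b p)"
    proof (intro equalityI subsetI)
      fix P assume P: "P \<in> NC_on {a..<b}"
      note D = NC_onD[OF P]
      have "a \<in> \<Union>P" using D(1) ab by auto
      then obtain A where A: "A \<in> P" "a \<in> A" by auto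
      show "P \<in> ?S \<union> (\<Union>p\<in>{Suc a..<b}. NC_next a b p)"
      proof (cases "A = {a}")
        case True thus ?thesis using A P by auto
      next
        case False
        define p where "p = Min (A - {a})"
        have fA: "finite (A - {a})" "A - {a} \<noteq> {}" using fin(2)[OF P A(1)] False A by auto
        have p: "p \<in> A - {a}" unfolding p_def by (rule Min_in[OF fA])
        have "p \<le> x" if "x \<in> A - {a}" for x unfolding p_def by (rule Min_le[OF fA(1) that])
        hence "A \<inter> {a<..<p} = {}" by (auto simp: not_le[symmetric])
        moreover have "p \<in> {a..<b}" "p \<noteq> a" using p D(2)[OF A(1)] by auto
        hence "p \<in> {Suc a..<b}" by auto
        ultimately show ?thesis using P A p by (auto simp: NC_next_def)
      qed
    qed (auto simp: NC_next_def)
    have "sum (w s a) (NC_on {a..<b}) =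
        sum (w s a) ?S + sum (w s a) (\<Union>p\<in>{Suc a..<b}. NC_next a b p)"
    proof (subst decomp, rule sum.union_disjoint)
      show "finite ?S" using finite_NC_on by simp
      show "finite (\<Union>p\<in>{Suc a..<b}. NC_next a b p)"
        by (auto simp: NC_next_def finite_NC_on)
      show "?S \<inter> (\<Union>p\<in>{Suc a..<b}. NC_next a b p) = {}"
      proof safe
        fix p P assume p: "p \<in> {Suc a..<b}" and P: "P \<in> NC_next a b p" "{a} \<in> P" "P \<in> NC_on {a..<b}"
        then obtain B where "B \<in> P" "a \<in> B" "p \<in> B" by (auto simp: NC_next_def)
        thus "P \<in> {}" using NC_onD(4)[OF P(3,2), of B a] p by auto
      qed
    qed
    also have "sum (w s a) (\<Union>p\<in>{Suc a..<b}. NC_next a b p) =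
        (\<Sum>p\<in>{Suc a..<b}. sum (w s a) (NC_next a b p))"
    proof (rule sum.UNION_disjoint)
      show "\<forall>p\<in>{Suc a..<b}. finite (NC_next a b p)"
        by (auto simp: NC_next_def finite_NC_on)
      show "\<forall>p\<in>{Suc a..<b}. \<forall>q\<in>{Suc a..<b}. p \<noteq> q \<longrightarrow> NC_next a b p \<inter> NC_next a b q = {}"
      proof (intro ballI impI equals0I)
        fix p q P assume pq: "p \<in> {Suc a..<b}" "q \<in> {Suc a..<b}" "p \<noteq> q"
          and P: "P \<in> NC_next a b p \<inter> NC_next a b q"
        then obtain B C where "B \<in> P" "a \<in> B" "p \<in> B" "B \<inter> {a<..<p} = {}"
          "C \<in> P" "a \<in> C" "q \<in> C" "C \<inter> {a<..<q} = {}" "P \<in> NC_on {a..<b}"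
          by (auto simp: NC_next_def)
        moreover from this have "B = C" using NC_onD(4) by blast
        ultimately have "p \<notin> {a<..<q}" "q \<notin> {a<..<p}" by auto
        thus False using pq by auto
      qed
    qed simp
    also have "sum (w s a) ?S = (\<Sum>P\<in>NC_on {Suc a..<b}. w s a (insert {a} P))"
      using sum.reindex_bij_betw[OF bij_betw_insert_singleton[OF ab], of "w s a"] by simp
    also have "\<dots> = (\<Sum>P\<in>NC_on {Suc a..<b}. \<kappa> (Suc s) * w 0 (Suc a) P)"
    proof (rule sum.cong[OF refl])
      fix P assume P: "P \<in> NC_on {Suc a..<b}"
      have "{a} \<notin> P" using first[OF P] by blast
      hence "w s a (insert {a} P) = \<kappa> (Suc s) * w s a P"
        using fin(1)[OF P] by (simp add: w_def)
      thus "w s a (insert {a} P) = \<kappa> (Suc s) * w 0 (Suc a) P" using w0[OF P] by metis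
    qed
    also have "\<dots> = \<kappa> (Suc s) * free_moment \<kappa> 0 (b - Suc a)"
      using IH[of b "Suc a" 0] ab by (simp add: sum_distrib_left[symmetric])
    also have "(\<Sum>p\<in>{Suc a..<b}. sum (w s a) (NC_next a b p)) =
       (\<Sum>p\<in>{Suc a..<b}. free_moment \<kappa> 0 (p - Suc a) * free_moment \<kappa> (Suc s) (b - p))"
    proof (rule sum.cong[OF refl])
      fix p assume "p \<in> {Suc a..<b}"
      hence p: "a < p" "p < b" by auto
      have "sum (w s a) (NC_next a b p) =
          (\<Sum>(P, P')\<in>NC_on {Suc a..<p} \<times> NC_on {p..<b}. w s a (glue a p (P, P')))"
        using sum.reindex_bij_betw[OF bij_betw_glue[OF p], of "w s a"] by (simp add: case_prod_unfold)
      also have "\<dots> = (\<Sum>(P, P')\<in>NC_on {Suc a..<p} \<times> NC_on {p..<b}. w 0 (Suc a) P * w (Suc s) p P')"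
      proof (rule sum.cong[OF refl], clarify)
        fix P P' assume P: "P \<in> NC_on {Suc a..<p}" and P': "P' \<in> NC_on {p..<b}"
        note D = NC_onD[OF P] and D' = NC_onD[OF P']
        let ?g = "\<lambda>B. if p \<in> B then insert a B else B"
        have a: "a \<notin> B" if "B \<in> P'" for B using D'(2)[OF that] p by auto
        have "P \<inter> ?g ` P' = {}"
        proof (rule equals0I)
          fix C assume "C \<in> P \<inter> ?g ` P'"
          hence C: "C \<in> P" "C \<in> ?g ` P'" by blast+
          obtain B where B: "C = ?g B" "B \<in> P'" using C(2) by blast
          obtain x where x: "x \<in> B" using D'(3)[OF B(2)] by blast
          have "x \<in> C" using x B(1) by simp
          thus False using D(2)[OF C(1)] D'(2)[OF B(2)] x by fastforce
        qed
        hence "w s a (glue a p (P, P')) = w s a P * w s a (?g ` P')"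
          using fin(1)[OF P] fin(1)[OF P'] unfolding glue_def w_def by (simp add: prod.union_disjoint)
        also have "w s a (?g ` P') = (\<Prod>B\<in>P'. \<kappa> (card (?g B) + (if a \<in> ?g B then s else 0)))"
          unfolding w_def
        proof (subst prod.reindex)
          show "inj_on ?g P'"
            by (rule inj_on_inverseI[where g = "\<lambda>B. B - {a}"]) (use a in auto)
        qed simp
        \<comment> \<open>The surplus passes from \<open>a\<close> to \<open>p\<close>: the block of
          \<open>p\<close> keeps the old surplus and counts the removed \<open>a\<close> as one
          element more.\<close>
        also have "\<dots> = w (Suc s) p P'"
          unfolding w_def by (intro prod.cong refl) (use a fin(2)[OF P'] in auto)
        finally show "w s a (glue a p (P, P')) = w 0 (Suc a) P * w (Suc s) p P'"
          using w0[OF P] by metis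
      qed
      also have "\<dots> = sum (w 0 (Suc a)) (NC_on {Suc a..<p}) * sum (w (Suc s) p) (NC_on {p..<b})"
        by (simp add: sum_product sum.cartesian_product)
      also have "\<dots> = free_moment \<kappa> 0 (p - Suc a) * free_moment \<kappa> (Suc s) (b - p)"
        using p by (simp add: IH)
      finally show "sum (w s a) (NC_next a b p) = \<dots>" .
    qed
    also have "\<dots> = (\<Sum>p<b - Suc a. free_moment \<kappa> 0 p * free_moment \<kappa> (Suc s) (b - Suc a - p))"
      by (rule sum.reindex_bij_witness[of _ "\<lambda>p. p + Suc a" "\<lambda>p. p - Suc a"]) auto
    also have "\<kappa> (Suc s) * free_moment \<kappa> 0 (b - Suc a) + \<dots> = free_moment \<kappa> s (Suc (b - Suc a))"
      by simp
    also have "Suc (b - Suc a) = b - a" using ab by simp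
    finally show ?thesis unfolding w_def .
  qed
qed

corollary sum_NC_eq_free_moment:
  "(\<Sum>P\<in>NC n. \<Prod>B\<in>P. \<kappa> (card B)) = free_moment (\<kappa> :: nat \<Rightarrow> 'a::comm_ring_1) 0 n"
  using sum_NC_on_eq_free_moment[of 0 n \<kappa> 0] by (simp add: NC_on_def NC_def lessThan_atLeast0)

text \<open>The moment-cumulant relation is triangular. Proper blocks are smaller, so induction
  fixes all terms except that of the one-block partition, and the given moment then forces this
  one.\<close>

theorem free_cumulant_replicate:
  assumes mom: "\<And>n. \<tau> (Y ^ n) = free_moment \<kappa> 0 n" and "n > 0"
  shows "free_cumulant \<tau> (replicate n Y) = \<kappa> n"
  using \<open>n > 0\<close>
proof (induction n rule: less_induct)
  case (less n)
  have nths: "nths (replicate n Y) B = replicate (card B) Y" if "B \<subseteq> {..<n}" for B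
  proof -
    have "{i. i < n \<and> i \<in> B} = B" using that by auto
    hence "length (nths (replicate n Y) B) = card B" by (simp add: length_nths)
    moreover have "set (nths (replicate n Y) B) \<subseteq> {Y}" using set_nths_subset[of "replicate n Y" B] by auto
    ultimately show ?thesis by (metis replicate_eqI singletonD subsetD)
  qed
  let ?T = "{{..<n}}"
  have T: "?T \<in> NC n" using less.prems by (auto simp: NC_def noncrossing_def partition_on_def)
  have "free_cumulant \<tau> (replicate n Y) =
      \<tau> (Y ^ n) - (\<Sum>P\<in>NC n - {?T}. \<Prod>B\<in>P. free_cumulant \<tau> (nths (replicate n Y) B))"
    by (subst free_cumulant.simps) (simp add: prod_list_replicate)
  also have "(\<Sum>P\<in>NC n - {?T}. \<Prod>B\<in>P. free_cumulant \<tau> (nths (replicate n Y) B)) =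
      (\<Sum>P\<in>NC n - {?T}. \<Prod>B\<in>P. \<kappa> (card B))"
  proof (intro sum.cong prod.cong refl)
    fix P B assume PB: "P \<in> NC n - {?T}" "B \<in> P"
    hence B: "B \<subseteq> {..<n}" "B \<noteq> {}" by (auto simp: NC_def partition_on_def)
    have "finite B" using B(1) by (rule finite_subset) simp
    hence "card B > 0" using B(2) by (simp add: card_gt_0_iff)
    moreover have "card B < n"
      using length_nths_block[OF PB, of "replicate n Y"] nths[OF B(1)] by simp
    ultimately show "free_cumulant \<tau> (nths (replicate n Y) B) = \<kappa> (card B)"
      using less.IH nths[OF B(1)] by simp
  qed
  also have "\<tau> (Y ^ n) - \<dots> = \<kappa> n"
    using sum.remove[OF finite_NC T, of "\<lambda>P. \<Prod>B\<in>P. \<kappa> (card B)"] mom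
    by (simp add: sum_NC_eq_free_moment)
  finally show ?case .
qed

section \<open>Traces of the sign kernel\<close>

text \<open>The index is off by one: \<open>kernel_power I E s\<close> is the matrix power
  E^(s+1).\<close>

fun kernel_power :: "nat set \<Rightarrow> (nat \<Rightarrow> nat \<Rightarrow> complex) \<Rightarrow> nat \<Rightarrow> nat \<Rightarrow> nat \<Rightarrow> complex" where
  "kernel_power I E 0 x y = E x y"
| "kernel_power I E (Suc s) x y = (\<Sum>k\<in>I. kernel_power I E s x k * E k y)"

text \<open>This is Tr(E^s) for positive \<open>s\<close>. At 0 truncated subtraction yields Tr(E),
  a value that \<open>free_moment\<close> ignores.\<close>

definition kernel_trace :: "nat set \<Rightarrow> (nat \<Rightarrow> nat \<Rightarrow> complex) \<Rightarrow> nat \<Rightarrow> complex" where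
  "kernel_trace I E s = (\<Sum>x\<in>I. kernel_power I E (s - 1) x x)"

definition sign_kernel :: "nat \<Rightarrow> nat \<Rightarrow> nat \<Rightarrow> complex" where
  "sign_kernel n x y = (if x < y then \<i> / of_nat n else if y < x then - \<i> / of_nat n else 0)"

lemma norm_sign_kernel_le: "norm (sign_kernel n x y) \<le> 1 / of_nat n"
  by (simp add: sign_kernel_def norm_divide)

text \<open>In a product of two matrices with entries at most 1/n, the n summands of size 1/n^2
  again add up to at most 1/n. So the bound holds for all powers at once.\<close>

lemma norm_kernel_trace_sign_kernel_le: "norm (kernel_trace {1..n} (sign_kernel n) s) \<le> 1"
proof (cases "n = 0")
  case False
  have "norm (kernel_power {1..n} (sign_kernel n) s x y) \<le> 1 / of_nat n" for s x y
  proof (induction s arbitrary: y)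
    case (Suc s)
    have "norm (kernel_power {1..n} (sign_kernel n) (Suc s) x y) \<le>
        (\<Sum>k\<in>{1..n}. 1 / of_nat n * (1 / of_nat n))"
      unfolding kernel_power.simps
      by (rule sum_norm_le) (unfold norm_mult, intro mult_mono Suc norm_sign_kernel_le, auto)
    also have "\<dots> = 1 / of_nat n" using False by simp
    finally show ?case .
  qed (simp add: norm_sign_kernel_le)
  hence "norm (kernel_trace {1..n} (sign_kernel n) s) \<le> (\<Sum>x\<in>{1..n}. 1 / of_nat n)"
    unfolding kernel_trace_def by (intro sum_norm_le) auto
  also have "\<dots> = 1" using False by simp
  finally show ?thesis .
qed (simp add: kernel_trace_def)

text \<open>Up to the factor \<open>D = u ^ n + v ^ n\<close>, the following is the resolvent
  \<open>E (1 - z E)\<^sup>-\<^sup>1\<close> of the kernel \<open>E = c sgn (y - x)\<close>, with \<open>u = 1 + c z\<close>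
  and \<open>v = 1 - c z\<close>. It comes from the fact that the kernel is an antiperiodic Toeplitz matrix.\<close>

definition sign_resolvent :: "'a::comm_ring_1 \<Rightarrow> 'a \<Rightarrow> 'a \<Rightarrow> nat \<Rightarrow> nat \<Rightarrow> nat \<Rightarrow> 'a" where
  "sign_resolvent c u v n x y =
     (if x < y then 2 * c * v ^ (n - 1 - (y - x)) * u ^ (y - x - 1)
      else if y < x then - 2 * c * v ^ (x - y - 1) * u ^ (n - 1 - (x - y))
      else c * (v ^ (n - 1) - u ^ (n - 1)))"

text \<open>Since 2 w = u - v, each off-diagonal summand is a difference of consecutive values of
  \<open>S\<close> (left of the diagonal) or \<open>T\<close> (right of it), and the sum telescopes.
  Crossing the diagonal costs u^n + v^n.\<close>

lemma sign_resolvent_prefix_sum: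
  fixes c w :: "'a::comm_ring_1" and n :: nat
  defines "u \<equiv> 1 + w" and "v \<equiv> 1 - w"
  defines "S \<equiv> \<lambda>x k. v ^ (x - k) * u ^ (n - 1 - (x - k))"
    and "T \<equiv> \<lambda>x k. v ^ (n - 1 - (k - x)) * u ^ (k - x)"
  assumes x: "1 \<le> x" "x \<le> n" and m: "m \<le> n"
  shows "(\<Sum>k=1..m. w * sign_resolvent c u v n x k) =
    (if m < x then c * (S x 1 - S x (Suc m)) else c * (S x 1 + T x m - (u ^ n + v ^ n)))"
  using m
proof (induction m)
  case 0
  thus ?case using x by simp
next
  case (Suc m)
  have IH: "(\<Sum>k=1..m. w * sign_resolvent c u v n x k) =
    (if m < x then c * (S x 1 - S x (Suc m)) else c * (S x 1 + T x m - (u ^ n + v ^ n)))"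
    using Suc by simp
  have w2: "w * 2 = u - v" by (simp add: u_def v_def)
  have Suc_sum: "(\<Sum>k=1..Suc m. w * sign_resolvent c u v n x k) =
      (\<Sum>k=1..m. w * sign_resolvent c u v n x k) + w * sign_resolvent c u v n x (Suc m)" by simp
  consider "Suc m < x" | "Suc m = x" | "x < Suc m" by linarith
  thus ?case
  proof cases
    case 1
    then obtain e where e: "x = Suc m + Suc e" using less_imp_add_positive[of "Suc m" x] gr0_conv_Suc by auto
    obtain f where f: "n = x + f" using x(2) le_Suc_ex by blast
    have "w * sign_resolvent c u v n x (Suc m) = - (w * 2) * c * v ^ e * u ^ (f + m)"
      using e f by (simp add: sign_resolvent_def algebra_simps)
    also have "\<dots> = c * (S x (Suc m) - S x (Suc (Suc m)))"
      unfolding w2 S_def using e f by (simp add: algebra_simps)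
    finally show ?thesis unfolding Suc_sum IH using 1 by (simp add: algebra_simps)
  next
    case 2
    obtain f where f: "n = Suc m + f" using x(2) 2 le_Suc_ex by blast
    have "w * sign_resolvent c u v n x (Suc m) = w * (c * (v ^ (m + f) - u ^ (m + f)))"
      using 2[symmetric] f by (simp add: sign_resolvent_def)
    also have "\<dots> = c * (S x x + T x x - (u ^ n + v ^ n))"
      using f by (simp add: S_def T_def u_def v_def algebra_simps)
    finally show ?thesis unfolding Suc_sum IH using 2 by (simp add: algebra_simps)
  next
    case 3
    then obtain e where e: "m = x + e" using less_iff_Suc_add by auto
    obtain f where f: "n = Suc m + f" using Suc.prems le_Suc_ex by blast
    obtain x' where x': "x = Suc x'" using x(1) by (cases x) auto
    have "w * sign_resolvent c u v n x (Suc m) = (w * 2) * c * v ^ (x' + f) * u ^ e"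
      using e f x' by (simp add: sign_resolvent_def algebra_simps)
    also have "\<dots> = c * (T x (Suc m) - T x m)"
      unfolding w2 T_def using e f x' by (simp add: algebra_simps)
    finally show ?thesis unfolding Suc_sum IH using 3 by (simp add: algebra_simps)
  qed
qed

text \<open>Row \<open>x\<close> of the identity R = D E + z R E. Summation against a sign needs
  only prefix sums G of the row: it gives G(y - 1) + G(y) - G(n).\<close>

lemma sign_resolvent_equation:
  fixes c w :: "'a::comm_ring_1" and n x y :: nat
  defines "u \<equiv> 1 + w" and "v \<equiv> 1 - w"
  defines "sg \<equiv> \<lambda>x y. if x < y then 1 else if y < x then -1 else (0::'a)"
  assumes x: "1 \<le> x" "x \<le> n" and y: "1 \<le> y" "y \<le> n"
  shows "sign_resolvent c u v n x y =
    (u ^ n + v ^ n) * (c * sg x y) + (\<Sum>k=1..n. w * sign_resolvent c u v n x k * sg k y)"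
proof -
  define g where "g = (\<lambda>k. w * sign_resolvent c u v n x k)"
  define S where "S = (\<lambda>k. v ^ (x - k) * u ^ (n - 1 - (x - k)))"
  define T where "T = (\<lambda>k. v ^ (n - 1 - (k - x)) * u ^ (k - x))"
  have H: "sum g {1..m} = (if m < x then c * (S 1 - S (Suc m)) else c * (S 1 + T m - (u ^ n + v ^ n)))"
    if "m \<le> n" for m
    unfolding g_def S_def T_def u_def v_def by (rule sign_resolvent_prefix_sum[OF x that])
  obtain y' where y': "y = Suc y'" using y(1) by (cases y) auto
  have split: "{1..n} = {1..y'} \<union> {y} \<union> {Suc y..n}" "{1..n} = {1..y} \<union> {Suc y..n}"
    using y y' by auto
  have "(\<Sum>k=1..n. g k * sg k y) =
      (\<Sum>k=1..y'. g k * sg k y) + (\<Sum>k\<in>{y}. g k * sg k y) + (\<Sum>k=Suc y..n. g k * sg k y)"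
    unfolding split(1) using y' by (subst sum.union_disjoint; (subst sum.union_disjoint)?) auto
  also have "(\<Sum>k=1..y'. g k * sg k y) = sum g {1..y'}"
    using y' by (intro sum.cong) (auto simp: sg_def)
  also have "(\<Sum>k=Suc y..n. g k * sg k y) = - sum g {Suc y..n}"
    unfolding sum_negf[symmetric] by (intro sum.cong) (auto simp: sg_def)
  also have "sum g {Suc y..n} = sum g {1..n} - sum g {1..y}"
    unfolding split(2) by (subst sum.union_disjoint) auto
  also have "(\<Sum>k\<in>{y}. g k * sg k y) = 0" by (simp add: sg_def)
  finally have sum: "(\<Sum>k=1..n. g k * sg k y) = sum g {1..y'} + sum g {1..y} - sum g {1..n}" by simp
  have "y' \<le> n" using y y' by simp
  note Hs = H[OF this] H[OF y(2)] H[OF order.refl]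
  \<comment> \<open>Here antiperiodicity enters: the telescoped values at both ends of the row
    agree, so the full row sum is c (2 S(1) - D).\<close>
  have TS: "T n = S 1" using x by (auto simp: T_def S_def)
  have "(\<Sum>k=1..n. g k * sg k y) = sign_resolvent c u v n x y - (u ^ n + v ^ n) * (c * sg x y)"
  proof -
    consider "y < x" | "y = x" | "x < y" by linarith
    thus ?thesis
    proof cases
      case 1
      then obtain e where e: "x = y + Suc e" using less_iff_Suc_add by auto
      obtain f where f: "n = x + f" using x(2) le_Suc_ex by blast
      have "sign_resolvent c u v n x y = - c * (S y + S (Suc y))"
        using e f y' by (simp add: sign_resolvent_def S_def u_def v_def algebra_simps)
      thus ?thesis unfolding sum Hs using 1 y' x y TS by (simp add: sg_def algebra_simps)
    next
      case 2
      have "sign_resolvent c u v n x y = c * (T x - S x)"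
        using 2 by (simp add: sign_resolvent_def S_def T_def)
      thus ?thesis unfolding sum Hs using 2 y' x y TS by (simp add: sg_def algebra_simps)
    next
      case 3
      then obtain e where e: "y' = x + e" using y' less_Suc_eq_le le_Suc_ex by blast
      obtain f where f: "n = y + f" using y(2) le_Suc_ex by blast
      obtain x' where x': "x = Suc x'" using x(1) by (cases x) auto
      have "sign_resolvent c u v n x y = c * (T y + T y')"
        using e f y' x' by (simp add: sign_resolvent_def T_def u_def v_def algebra_simps)
      thus ?thesis unfolding sum Hs using 3 y' x y TS by (simp add: sg_def algebra_simps)
    qed
  qed
  thus ?thesis by (simp add: g_def)
qed

text \<open>The denominator has constant term 2, so the resolvent exists as a matrix of formal power
  series and its fixed-point equation produces the kernel powers coefficient by coefficient. Its
  diagonal is constant, hence the trace is n times one entry, and n c = i.\<close>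

lemma sign_kernel_generating_function:
  fixes n :: nat
  defines "w \<equiv> fps_const (\<i> / of_nat n) * fps_X"
  assumes n: "n > 0"
  shows "Abs_fps (\<lambda>s. kernel_trace {1..n} (sign_kernel n) (Suc s)) * ((1 + w) ^ n + (1 - w) ^ n) =
    fps_const \<i> * ((1 - w) ^ (n - 1) - (1 + w) ^ (n - 1))"
proof -
  define D where "D = (1 + w) ^ n + (1 - w) ^ n"
  define c where "c = fps_const (\<i> / of_nat n)"
  define R where "R = (\<lambda>x y. sign_resolvent c (1 + w) (1 - w) n x y / D)"
  have "fps_nth D 0 = 2" by (simp add: D_def w_def fps_power_zeroth)
  hence D: "D \<noteq> 0" and Dunit: "fps_nth D 0 \<noteq> 0" by auto
  have RD: "R x y * D = sign_resolvent c (1 + w) (1 - w) n x y" for x y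
    using Dunit by (simp add: R_def fps_divide_unit mult.assoc inverse_mult_eq_1)
  define sg where "sg = (\<lambda>(x::nat) y. if x < y then 1 else if y < x then -1 else (0::complex fps))"
  have E: "fps_const (sign_kernel n x y) = c * sg x y" for x y
    by (simp add: sign_kernel_def c_def sg_def)
  have "R x y = fps_const (sign_kernel n x y) + fps_X * (\<Sum>k=1..n. R x k * fps_const (sign_kernel n k y))"
    if "x \<in> {1..n}" "y \<in> {1..n}" for x y
  proof -
    have "R x y * D = D * (c * sg x y) + (\<Sum>k=1..n. w * (R x k * D) * sg k y)"
      unfolding RD using sign_resolvent_equation[of x n y c w] that
      by (simp add: D_def sg_def)
    also have "\<dots> = (fps_const (sign_kernel n x y) + fps_X * (\<Sum>k=1..n. R x k * fps_const (sign_kernel n k y))) * D"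
      unfolding E by (simp add: w_def c_def sum_distrib_left sum_distrib_right algebra_simps)
    finally show ?thesis using D by simp
  qed
  note R_eq = this
  have "fps_nth (R x y) s = kernel_power {1..n} (sign_kernel n) s x y"
    if "x \<in> {1..n}" "y \<in> {1..n}" for x y s
    using that
  proof (induction s arbitrary: y)
    case 0
    show ?case by (subst R_eq[OF 0]) simp
  next
    case (Suc s)
    show ?case using Suc.prems(1)
      by (subst R_eq[OF Suc.prems])
        (auto simp: fps_sum_nth Suc.IH[simplified] intro!: sum.cong arg_cong2[where f = "(*)"])
  qed
  hence "Abs_fps (\<lambda>s. kernel_trace {1..n} (sign_kernel n) (Suc s)) = (\<Sum>x=1..n. R x x)"
    by (intro fps_ext) (simp add: kernel_trace_def fps_sum_nth)
  hence "Abs_fps (\<lambda>s. kernel_trace {1..n} (sign_kernel n) (Suc s)) * D =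
      (\<Sum>x=1..n. c * ((1 - w) ^ (n - 1) - (1 + w) ^ (n - 1)))"
    by (simp add: sum_distrib_right RD) (simp add: sign_resolvent_def)
  also have "\<dots> = of_nat n * c * ((1 - w) ^ (n - 1) - (1 + w) ^ (n - 1))"
    by simp
  also have "of_nat n * c = fps_const \<i>"
    using n by (simp add: c_def fps_of_nat[symmetric])
  finally show ?thesis unfolding D_def .
qed

section \<open>Coefficientwise limit of the generating function\<close>

lemma fps_nth_one_plus_power:
  "fps_nth ((1 + fps_const c * fps_X) ^ m) k = of_nat (m choose k) * (c :: 'a::comm_ring_1) ^ k"
proof -
  have "(1 + fps_const c * fps_X) ^ m = (\<Sum>j\<le>m. fps_const (of_nat (m choose j) * c ^ j) * fps_X ^ j)"
    by (subst add.commute, subst binomial_ring)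
      (simp add: power_mult_distrib fps_const_power fps_of_nat[symmetric] mult.assoc flip: fps_const_mult)
  thus ?thesis by (simp add: fps_sum_nth if_distrib[of "(*) _"] binomial_eq_0 cong: if_cong)
qed

text \<open>The shift \<open>j\<close> allows for both exponents \<open>n\<close> and
  \<open>n - 1\<close> that occur in the generating function.\<close>

lemma tendsto_binomial_over_power:
  "(\<lambda>n. of_nat ((n - j) choose k) / of_nat n ^ k :: complex) \<longlonglongrightarrow> 1 / fact k"
proof (rule Lim_transform_eventually)
  have "(\<lambda>n. (of_nat n - of_nat j - of_nat i) / of_nat n :: complex) \<longlonglongrightarrow> 1" for i
  proof (rule Lim_transform_eventually)
    show "(\<lambda>n. 1 - (of_nat j + of_nat i) * (1 / of_nat n) :: complex) \<longlonglongrightarrow> 1"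
      by (rule tendsto_eq_intros lim_1_over_n refl | simp)+
    show "\<forall>\<^sub>F n in sequentially. 1 - (of_nat j + of_nat i) * (1 / of_nat n) =
        (of_nat n - of_nat j - of_nat i) / (of_nat n :: complex)"
      using eventually_gt_at_top[of 0] by eventually_elim (simp add: field_simps)
  qed
  hence "(\<lambda>n. (\<Prod>i<k. (of_nat n - of_nat j - of_nat i) / of_nat n) / fact k :: complex)
      \<longlonglongrightarrow> (\<Prod>i<k. 1) / fact k"
    by (intro tendsto_intros) auto
  thus "(\<lambda>n. (\<Prod>i<k. (of_nat n - of_nat j - of_nat i) / of_nat n) / fact k :: complex)
      \<longlonglongrightarrow> 1 / fact k" by simp
  show "\<forall>\<^sub>F n in sequentially. (\<Prod>i<k. (of_nat n - of_nat j - of_nat i) / of_nat n) / fact k =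
      (of_nat ((n - j) choose k) / of_nat n ^ k :: complex)"
    using eventually_ge_at_top[of j]
    by eventually_elim
      (simp add: binomial_gbinomial gbinomial_prod_rev of_nat_diff prod_dividef atLeast0LessThan)
qed

lemma tendsto_one_plus_power_fps_exp:
  "(\<lambda>n. fps_nth ((1 + fps_const (a / of_nat n) * fps_X) ^ (n - j)) k) \<longlonglongrightarrow> fps_nth (fps_exp (a :: complex)) k"
proof -
  have "(\<lambda>n. a ^ k * (of_nat ((n - j) choose k) / of_nat n ^ k)) \<longlonglongrightarrow> a ^ k * (1 / fact k)"
    by (intro tendsto_intros tendsto_binomial_over_power)
  thus ?thesis unfolding fps_nth_one_plus_power by (simp add: power_divide fps_exp_nth mult.commute)
qed

text \<open>A coefficient of a quotient is a rational expression in finitely many coefficients of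
  numerator and denominator, and only the constant term of the denominator is divided by. No
  analytic convergence is involved.\<close>

lemma tendsto_fps_nth_quotient:
  fixes H :: "nat \<Rightarrow> 'a::real_normed_field fps"
  assumes G: "\<And>k. (\<lambda>n. fps_nth (G n) k) \<longlonglongrightarrow> fps_nth G' k"
    and F: "\<And>k. (\<lambda>n. fps_nth (F n) k) \<longlonglongrightarrow> fps_nth F' k"
    and eq: "\<forall>\<^sub>F n in sequentially. H n * G n = F n" and eq': "H' * G' = F'" and nz: "fps_nth G' 0 \<noteq> 0"
  shows "(\<lambda>n. fps_nth (H n) k) \<longlonglongrightarrow> fps_nth H' k"
proof (induction k rule: less_induct)
  case (less k)
  have nth: "fps_nth h k * fps_nth g 0 = fps_nth (h * g) k - (\<Sum>j<k. fps_nth h j * fps_nth g (k - j))"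
    for h g :: "'a fps"
  proof -
    have "{0..k} = insert k {..<k}" by auto
    thus ?thesis by (simp add: fps_mult_nth)
  qed
  have "\<forall>\<^sub>F n in sequentially. fps_nth (G n) 0 \<noteq> 0"
    using G[of 0] nz by (rule tendsto_imp_eventually_ne)
  with eq have ev: "\<forall>\<^sub>F n in sequentially.
      (fps_nth (F n) k - (\<Sum>j<k. fps_nth (H n) j * fps_nth (G n) (k - j))) / fps_nth (G n) 0 = fps_nth (H n) k"
    by eventually_elim (metis nth nonzero_mult_div_cancel_right)
  have "(\<lambda>n. (fps_nth (F n) k - (\<Sum>j<k. fps_nth (H n) j * fps_nth (G n) (k - j))) / fps_nth (G n) 0)
      \<longlonglongrightarrow> (fps_nth F' k - (\<Sum>j<k. fps_nth H' j * fps_nth G' (k - j))) / fps_nth G' 0"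
    by (intro tendsto_intros F G less nz) auto
  also have "(fps_nth F' k - (\<Sum>j<k. fps_nth H' j * fps_nth G' (k - j))) / fps_nth G' 0 = fps_nth H' k"
    using nth[of H' G'] eq' nz by (metis nonzero_mult_div_cancel_right)
  finally show ?case using ev by (rule Lim_transform_eventually)
qed

text \<open>The powers of 1 + i z / n and 1 - i z / n tend to exp(i z) and exp(- i z), and Euler's
  formulas turn the quotient into sin / cos.\<close>

theorem tendsto_kernel_trace_sign_kernel:
  assumes "s > 0"
  shows "(\<lambda>n. kernel_trace {1..n} (sign_kernel n) s) \<longlonglongrightarrow> fps_nth (fps_tan 1) (s - 1)"
proof -
  define U where "U = (\<lambda>n. 1 + fps_const (\<i> / of_nat n) * fps_X)"
  define V where "V = (\<lambda>n. 1 - fps_const (\<i> / of_nat n) * fps_X)"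
  have V: "V n = 1 + fps_const (- \<i> / of_nat n) * fps_X" for n
    by (simp add: V_def fps_const_neg[symmetric] del: fps_const_neg)
  have U_lim: "(\<lambda>n. fps_nth (U n ^ (n - j)) k) \<longlonglongrightarrow> fps_nth (fps_exp \<i>) k" for j k
    unfolding U_def by (rule tendsto_one_plus_power_fps_exp)
  have V_lim: "(\<lambda>n. fps_nth (V n ^ (n - j)) k) \<longlonglongrightarrow> fps_nth (fps_exp (- \<i>)) k" for j k
    unfolding V by (rule tendsto_one_plus_power_fps_exp)
  have "(\<lambda>n. fps_nth (Abs_fps (\<lambda>s. kernel_trace {1..n} (sign_kernel n) (Suc s))) k)
      \<longlonglongrightarrow> fps_nth (fps_tan 1) k" for k
  proof (rule tendsto_fps_nth_quotient)
    show "(\<lambda>n. fps_nth (U n ^ n + V n ^ n) k) \<longlonglongrightarrow> fps_nth (fps_exp \<i> + fps_exp (- \<i>)) k" for k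
      using tendsto_add[OF U_lim[of 0 k] V_lim[of 0 k]] by simp
    show "(\<lambda>n. fps_nth (fps_const \<i> * (V n ^ (n - 1) - U n ^ (n - 1))) k)
        \<longlonglongrightarrow> fps_nth (fps_const \<i> * (fps_exp (- \<i>) - fps_exp \<i>)) k" for k
      using tendsto_mult[OF tendsto_const tendsto_diff[OF V_lim[of 1 k] U_lim[of 1 k]], of \<i>] by simp
    show "\<forall>\<^sub>F n in sequentially. Abs_fps (\<lambda>s. kernel_trace {1..n} (sign_kernel n) (Suc s)) * (U n ^ n + V n ^ n) =
        fps_const \<i> * (V n ^ (n - 1) - U n ^ (n - 1))"
      using eventually_gt_at_top[of 0]
      by eventually_elim (unfold U_def V_def, rule sign_kernel_generating_function)
    have 2: "fps_exp \<i> + fps_exp (- \<i>) = 2 * fps_cos 1"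
      by (simp add: fps_cos_fps_exp_ii fps_divide_unit fps_const_inverse fps_numeral_fps_const)
    have "fps_const \<i> * (fps_exp (- \<i>) - fps_exp \<i>) = 2 * fps_sin 1"
    proof -
      have "fps_exp \<i> - fps_exp (- \<i>) = fps_const (2 * \<i>) * fps_sin 1"
        by (simp add: fps_sin_fps_exp_ii fps_divide_unit fps_const_inverse mult.left_commute)
      hence "fps_const \<i> * (fps_exp (- \<i>) - fps_exp \<i>) = - (fps_const \<i> * (fps_const (2 * \<i>) * fps_sin 1))"
        by (metis minus_diff_eq mult_minus_right)
      also have "\<dots> = - (fps_const \<i> * fps_const (2 * \<i>)) * fps_sin 1"
        by (simp only: minus_mult_left mult.assoc)
      also have "- (fps_const \<i> * fps_const (2 * \<i>)) = (2 :: complex fps)"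
        by (simp add: fps_numeral_fps_const complex_eq_iff)
      finally show ?thesis .
    qed
    moreover have "fps_tan 1 * fps_cos 1 = fps_sin (1::complex)"
      by (simp add: fps_tan_def fps_divide_unit inverse_mult_eq_1 mult.assoc)
    ultimately show "fps_tan 1 * (fps_exp \<i> + fps_exp (- \<i>)) = fps_const \<i> * (fps_exp (- \<i>) - fps_exp \<i>)"
      unfolding 2 by (metis mult.left_commute)
    show "fps_nth (fps_exp \<i> + fps_exp (- \<i>)) 0 \<noteq> 0" by simp
  qed
  from this[of "s - 1"] assms show ?thesis by simp
qed

section \<open>Quadratic forms in free semicircular variables\<close>

text \<open>\<open>fock st w\<close> is the vacuum coefficient of \<open>s\<^sub>i\<^sub>m \<cdots> s\<^sub>i\<^sub>1\<close> applied to the basis vector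
  \<open>st\<close> of the full Fock space, where \<open>w = [i\<^sub>1, \<dots>, i\<^sub>m]\<close> and \<open>s\<^sub>i\<close> is creation plus annihilation.
  So \<open>fock []\<close> gives the moments of a free semicircular family.\<close>

fun fock :: "'i list \<Rightarrow> 'i list \<Rightarrow> complex" where
  "fock st [] = (if st = [] then 1 else 0)"
| "fock st (i # w) = fock (i # st) w + (case st of [] \<Rightarrow> 0 | j # st' \<Rightarrow> if i = j then fock st' w else 0)"

lemma fock_Nil_Cons: "fock [] (x # w) = fock [x] w"
  by simp

lemma norm_fock_le: "norm (fock st w) \<le> 2 ^ length w"
proof (induction w arbitrary: st)
  case (Cons i w)
  have "norm (fock st (i # w)) \<le> norm (fock (i # st) w)
      + norm (case st of [] \<Rightarrow> 0 | j # st' \<Rightarrow> if i = j then fock st' w else 0)"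
    unfolding fock.simps by (rule norm_triangle_ineq)
  also have "\<dots> \<le> 2 ^ length w + 2 ^ length w"
    by (intro add_mono Cons) (auto split: list.split intro: Cons)
  finally show ?case by simp
qed auto

text \<open>A letter leaves the stack only when the word repeats it, and the vacuum coefficient
  requires an empty stack at the end.\<close>

lemma fock_eq_0_if_unmatched: "k \<in> set st \<Longrightarrow> k \<notin> set w \<Longrightarrow> fock st w = 0"
  by (induction st w rule: fock.induct) (auto split: list.split)

lemma fock_eq_0_if_odd: "odd (length st + length w) \<Longrightarrow> fock st w = 0"
  by (induction st w rule: fock.induct) (auto split: list.split)

lemma fock_eq_0_if_singleton:
  "\<lbrakk>k \<notin> set st; k \<notin> set u; k \<notin> set v\<rbrakk> \<Longrightarrow> fock st (u @ k # v) = 0"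
proof (induction u arbitrary: st)
  case Nil
  thus ?case by (auto simp: fock_eq_0_if_unmatched[of k] split: list.split)
next
  case (Cons i u)
  thus ?case by (auto split: list.split)
qed

text \<open>The first \<open>k\<close> can only be created. If the second one were created as well,
  both would stay on the stack forever, so it must annihilate the first.\<close>

lemma fock_cancel_pair:
  "\<lbrakk>k \<notin> set st; k \<notin> set u; k \<notin> set v\<rbrakk> \<Longrightarrow> fock st (u @ k # k # v) = fock st (u @ v)"
proof (induction u arbitrary: st)
  case Nil
  thus ?case by (auto simp: fock_eq_0_if_unmatched[of k] split: list.split)
next
  case (Cons i u)
  thus ?case by (auto split: list.split)
qed

text \<open>Each letter differs from the top of the stack when it arrives, so only creation is
  possible and the stack never becomes empty.\<close>

lemma fock_eq_0_if_distinct_adj: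
  "\<lbrakk>distinct_adj w; st \<noteq> [] \<or> w \<noteq> []; st = [] \<or> w = [] \<or> hd st \<noteq> hd w\<rbrakk> \<Longrightarrow> fock st w = 0"
  by (induction st w rule: fock.induct) (auto simp: distinct_adj_Cons split: list.split)

text \<open>Sort by the position \<open>l\<close> that annihilates \<open>y\<close>. Before it
  everything above \<open>y\<close> must be used up; after it only \<open>st2\<close> is left. This
  is the nesting of noncrossing pairings in terms of a stack.\<close>

lemma fock_append_stack:
  "fock (st1 @ y # st2) w =
    (\<Sum>l<length w. if w ! l = y then fock st1 (take l w) * fock st2 (drop (Suc l) w) else 0)"
proof (induction w arbitrary: st1)
  case (Cons i w)
  let ?f = "\<lambda>st1 l. if w ! l = y then fock st1 (take l w) * fock st2 (drop (Suc l) w) else 0"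
  have "(\<Sum>l<length (i # w). if (i # w) ! l = y
        then fock st1 (take l (i # w)) * fock st2 (drop (Suc l) (i # w)) else 0) =
      (if i = y then fock st1 [] * fock st2 w else 0) +
      (\<Sum>l<length w. if w ! l = y then fock st1 (i # take l w) * fock st2 (drop (Suc l) w) else 0)"
    by (simp add: lessThan_Suc_eq_insert_0 sum.reindex cong: if_cong)
  also have "(\<Sum>l<length w. if w ! l = y then fock st1 (i # take l w) * fock st2 (drop (Suc l) w) else 0)
      = (\<Sum>l<length w. ?f (i # st1) l) +
        (case st1 of [] \<Rightarrow> 0 | j # st' \<Rightarrow> if i = j then \<Sum>l<length w. ?f st' l else 0)"
  proof (cases st1)
    case (Cons j st')
    show ?thesis
      by (cases "i = j") (auto simp: Cons sum.distrib[symmetric] algebra_simps intro!: sum.cong)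
  qed (simp cong: if_cong)
  also have "(\<Sum>l<length w. ?f (i # st1) l) = fock (i # st1 @ y # st2) w"
    using Cons.IH[of "i # st1"] by simp
  also have "(case st1 of [] \<Rightarrow> 0 | j # st' \<Rightarrow> if i = j then \<Sum>l<length w. ?f st' l else 0) =
     (case st1 of [] \<Rightarrow> 0 | j # st' \<Rightarrow> if i = j then fock (st' @ y # st2) w else 0)"
    by (cases st1) (simp_all add: Cons.IH)
  finally show ?case by (cases st1) auto
qed simp

section \<open>Moments of quadratic forms as sums over words\<close>

definition words :: "'i set \<Rightarrow> nat \<Rightarrow> 'i list set" where
  "words I m = {w. set w \<subseteq> I \<and> length w = m}"

lemma finite_words: "finite I \<Longrightarrow> finite (words I m)"
  unfolding words_def by (rule finite_lists_length_eq)

lemma card_words: "finite I \<Longrightarrow> card (words I m) = card I ^ m"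
  unfolding words_def by (rule card_lists_length_eq)

lemma words_0 [simp]: "words I 0 = {[]}"
  by (auto simp: words_def)

lemma sum_words_Suc: "sum f (words I (Suc m)) = (\<Sum>x\<in>I. \<Sum>w\<in>words I m. f (x # w))"
proof -
  have "words I (Suc m) = (\<lambda>(x, w). x # w) ` (I \<times> words I m)"
    by (auto simp: words_def length_Suc_conv)
  moreover have "inj_on (\<lambda>(x, w). x # w) (I \<times> words I m)" by (auto simp: inj_on_def)
  ultimately show ?thesis by (simp add: sum.reindex sum.cartesian_product case_prod_unfold)
qed

lemma sum_words_add: "sum f (words I (a + b)) = (\<Sum>u\<in>words I a. \<Sum>v\<in>words I b. f (u @ v))"
  by (induction a arbitrary: f) (simp_all add: sum_words_Suc)

text \<open>A word of even length is read as a sequence of consecutive pairs, one for each factor of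
  the power. The default 1 also covers a single leftover letter.\<close>

fun kernel_weight :: "('i \<Rightarrow> 'i \<Rightarrow> complex) \<Rightarrow> 'i list \<Rightarrow> complex" where
  "kernel_weight E (x # y # w) = E x y * kernel_weight E w"
| "kernel_weight E w = 1"

lemma kernel_weight_append:
  "even (length u) \<Longrightarrow> kernel_weight E (u @ v) = kernel_weight E u * kernel_weight E v"
  by (induction E u rule: kernel_weight.induct) auto

lemma norm_kernel_weight_le:
  assumes "\<And>x y. norm (E x y) \<le> c" "length w = 2 * m"
  shows "norm (kernel_weight E w) \<le> c ^ m"
  using assms(2)
proof (induction m arbitrary: w)
  case (Suc m)
  then obtain x y w' where w: "w = x # y # w'" by (auto simp: length_Suc_conv)
  hence "norm (kernel_weight E w') \<le> c ^ m" using Suc by auto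
  moreover have "0 \<le> c" using assms(1)[of x y] norm_ge_zero order.trans by blast
  ultimately show ?case
    using assms(1)[of x y] by (auto simp: w norm_mult intro!: mult_mono)
qed auto

definition fock_moment :: "'i set \<Rightarrow> ('i \<Rightarrow> 'i \<Rightarrow> complex) \<Rightarrow> nat \<Rightarrow> complex" where
  "fock_moment I E m = (\<Sum>w\<in>words I (2 * m). kernel_weight E w * fock [] w)"

text \<open>The first of \<open>m + 1\<close> kernels is replaced by \<open>A\<close>, because
  contracting the second letter turns this kernel into the product of \<open>A\<close> and
  \<open>E\<close>; the recursion closes only in this generality.\<close>

definition fock_moment_with :: "'i set \<Rightarrow> ('i \<Rightarrow> 'i \<Rightarrow> complex) \<Rightarrow> ('i \<Rightarrow> 'i \<Rightarrow> complex) \<Rightarrow> nat \<Rightarrow> complex" where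
  "fock_moment_with I E A m =
     (\<Sum>x\<in>I. \<Sum>y\<in>I. \<Sum>w\<in>words I (2 * m). A x y * kernel_weight E w * fock [] (x # y # w))"

lemma fock_moment_Suc: "fock_moment I E (Suc m) = fock_moment_with I E E m"
proof -
  have "2 * Suc m = Suc (Suc (2 * m))" by simp
  thus ?thesis unfolding fock_moment_def fock_moment_with_def by (simp only: sum_words_Suc kernel_weight.simps)
qed

text \<open>The letter \<open>y\<close> of \<open>x # y # w\<close> is paired with \<open>x\<close> or, for reasons of parity,
  with the first letter of one of the pairs that make up \<open>w\<close>.\<close>

lemma fock_moment_with_rec:
  assumes I: "finite I"
  shows "fock_moment_with I E A m = (\<Sum>x\<in>I. A x x) * fock_moment I E m +
    (\<Sum>p<m. fock_moment I E p * fock_moment_with I E (\<lambda>x y. \<Sum>k\<in>I. A x k * E k y) (m - Suc p))"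
proof -
  have "fock [] (x # y # w) = (if x = y then fock [] w else 0) + fock [y, x] w" for x y :: 'a and w
    by simp
  hence "fock_moment_with I E A m =
      (\<Sum>x\<in>I. \<Sum>y\<in>I. \<Sum>w\<in>words I (2 * m). if x = y then A x y * kernel_weight E w * fock [] w else 0) +
      (\<Sum>x\<in>I. \<Sum>y\<in>I. \<Sum>w\<in>words I (2 * m). A x y * kernel_weight E w * fock [y, x] w)"
    unfolding fock_moment_with_def sum.distrib[symmetric]
    by (intro sum.cong) (simp_all add: algebra_simps del: fock.simps)
  also have "(\<Sum>x\<in>I. \<Sum>y\<in>I. \<Sum>w\<in>words I (2 * m). if x = y then A x y * kernel_weight E w * fock [] w else 0) =
      (\<Sum>x\<in>I. \<Sum>y\<in>I. if x = y then \<Sum>w\<in>words I (2 * m). A x y * kernel_weight E w * fock [] w else 0)"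
    by (intro sum.cong refl) simp
  also have "\<dots> = (\<Sum>x\<in>I. \<Sum>w\<in>words I (2 * m). A x x * kernel_weight E w * fock [] w)"
    using I by (simp add: sum.delta)
  also have "\<dots> = (\<Sum>x\<in>I. A x x) * fock_moment I E m"
    by (simp add: fock_moment_def sum_product mult.assoc)
  also have "(\<Sum>x\<in>I. \<Sum>y\<in>I. \<Sum>w\<in>words I (2 * m). A x y * kernel_weight E w * fock [y, x] w) =
     (\<Sum>p<m. fock_moment I E p * fock_moment_with I E (\<lambda>x y. \<Sum>k\<in>I. A x k * E k y) (m - Suc p))"
  proof -
    let ?t = "\<lambda>y x w l. if w ! l = y then fock [] (take l w) * fock [x] (drop (Suc l) w) else 0"
    have pair: "fock [y, x] w = (\<Sum>p<m. ?t y x w (2 * p))" if "w \<in> words I (2 * m)" for x y w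
    proof -
      have len: "length w = 2 * m" using that by (simp add: words_def)
      have "fock [y, x] w = (\<Sum>l<2 * m. ?t y x w l)"
        using fock_append_stack[of "[]" y "[x]" w] len by simp
      also have "\<dots> = (\<Sum>l\<in>(\<lambda>p. 2 * p) ` {..<m}. ?t y x w l)"
      proof (rule sum.mono_neutral_right)
        show "\<forall>l\<in>{..<2 * m} - (\<lambda>p. 2 * p) ` {..<m}. ?t y x w l = 0"
        proof
          fix l assume l: "l \<in> {..<2 * m} - (\<lambda>p. 2 * p) ` {..<m}"
          have "odd l" 
          proof
            assume "even l"
            then obtain p where "l = 2 * p" by blast
            thus False using l by auto
          qed
          hence "fock [] (take l w) = 0" using l len by (intro fock_eq_0_if_odd) auto
          thus "?t y x w l = 0" by simp
        qed
      qed auto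
      also have "\<dots> = (\<Sum>p<m. ?t y x w (2 * p))"
        by (subst sum.reindex) (auto simp: inj_on_def)
      finally show ?thesis .
    qed
    have "(\<Sum>x\<in>I. \<Sum>y\<in>I. \<Sum>w\<in>words I (2 * m). A x y * kernel_weight E w * fock [y, x] w) =
        (\<Sum>x\<in>I. \<Sum>y\<in>I. \<Sum>w\<in>words I (2 * m). \<Sum>p<m. A x y * kernel_weight E w * ?t y x w (2 * p))"
      by (intro sum.cong refl) (simp only: pair sum_distrib_left)
    also have "\<dots> = (\<Sum>p<m. \<Sum>x\<in>I. \<Sum>y\<in>I. \<Sum>w\<in>words I (2 * m). A x y * kernel_weight E w * ?t y x w (2 * p))"
      by (simp only: sum.swap[where B = "{..<m}"])
    also have "\<dots> = (\<Sum>p<m. fock_moment I E p * fock_moment_with I E (\<lambda>x y. \<Sum>k\<in>I. A x k * E k y) (m - Suc p))"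
    proof (rule sum.cong[OF refl])
      fix p assume "p \<in> {..<m}"
      then obtain r where r: "m = Suc (p + r)" using less_iff_Suc_add by auto
      have m2: "2 * m = 2 * p + Suc (Suc (2 * r))" using r by simp
      \<comment> \<open>The word is cut into \<open>u\<close>, the partner of \<open>y\<close>, the
        other letter \<open>q\<close> of the partner's pair, and \<open>v\<close>. The part
        \<open>u\<close> factors out, and summing over \<open>y\<close> contracts
        \<open>A x y * E y q\<close> to one new kernel.\<close>
      have "(\<Sum>w\<in>words I (2 * m). A x y * kernel_weight E w * ?t y x w (2 * p)) =
          (\<Sum>u\<in>words I (2 * p). \<Sum>q\<in>I. \<Sum>v\<in>words I (2 * r).
            (kernel_weight E u * fock [] u) * (A x y * E y q * kernel_weight E v * fock [] (x # q # v)))"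
        if "y \<in> I" for y x
      proof -
        have "(\<Sum>w\<in>words I (2 * m). A x y * kernel_weight E w * ?t y x w (2 * p)) =
          (\<Sum>u\<in>words I (2 * p). \<Sum>y'\<in>I. \<Sum>q\<in>I. \<Sum>v\<in>words I (2 * r). if y' = y then
            (kernel_weight E u * fock [] u) * (A x y * E y q * kernel_weight E v * fock [] (x # q # v)) else 0)"
          unfolding m2 sum_words_add sum_words_Suc
          by (intro sum.cong refl) (auto simp: words_def nth_append kernel_weight_append fock_Nil_Cons simp del: fock.simps(2) intro!: arg_cong2[where f = "(*)"])
        also have "\<dots> = (\<Sum>u\<in>words I (2 * p). \<Sum>y'\<in>I. if y' = y then \<Sum>q\<in>I. \<Sum>v\<in>words I (2 * r).
            (kernel_weight E u * fock [] u) * (A x y * E y q * kernel_weight E v * fock [] (x # q # v)) else 0)"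
          by (intro sum.cong refl) simp
        finally show ?thesis using I that by (simp add: sum.delta del: fock.simps)
      qed
      note inner = this
      have "(\<Sum>x\<in>I. \<Sum>y\<in>I. \<Sum>w\<in>words I (2 * m). A x y * kernel_weight E w * ?t y x w (2 * p)) =
         (\<Sum>x\<in>I. \<Sum>y\<in>I. \<Sum>u\<in>words I (2 * p). \<Sum>q\<in>I. \<Sum>v\<in>words I (2 * r).
            (kernel_weight E u * fock [] u) * (A x y * E y q * kernel_weight E v * fock [] (x # q # v)))"
        by (rule sum.cong[OF refl], rule sum.cong[OF refl], rule inner)
      also have "\<dots> = (\<Sum>u\<in>words I (2 * p). \<Sum>x\<in>I. \<Sum>q\<in>I. \<Sum>v\<in>words I (2 * r). \<Sum>y\<in>I.
            (kernel_weight E u * fock [] u) * (A x y * E y q * kernel_weight E v * fock [] (x # q # v)))"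
        unfolding sum.swap[where B = "words I (2 * p)"]
        by (rule sum.cong[OF refl], rule sum.cong[OF refl], subst sum.swap, rule sum.cong[OF refl], rule sum.swap)
      also have "\<dots> = fock_moment I E p * fock_moment_with I E (\<lambda>x y. \<Sum>k\<in>I. A x k * E k y) r"
        unfolding fock_moment_def fock_moment_with_def
        by (subst sum_distrib_right) (simp only: sum_distrib_left sum_distrib_right)
      finally show "(\<Sum>x\<in>I. \<Sum>y\<in>I. \<Sum>w\<in>words I (2 * m). A x y * kernel_weight E w * ?t y x w (2 * p)) =
          fock_moment I E p * fock_moment_with I E (\<lambda>x y. \<Sum>k\<in>I. A x k * E k y) (m - Suc p)"
        using r by simp
    qed
    finally show ?thesis .
  qed
  finally show ?thesis .
qed

text \<open>The induction treats all first kernels E^(s+1) together. Their trace is the cumulant of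
  order s + 1, and multiplication by \<open>E\<close> raises the surplus \<open>s\<close> by one, as
  in \<open>free_moment\<close>.\<close>

theorem fock_moment_eq_free_moment:
  assumes I: "finite I"
  shows "fock_moment I E m = free_moment (kernel_trace I E) 0 m"
proof -
  have "fock_moment_with I E (kernel_power I E s) m = free_moment (kernel_trace I E) s (Suc m) \<and>
      fock_moment I E m = free_moment (kernel_trace I E) 0 m" for s
  proof (induction m arbitrary: s rule: less_induct)
    case (less m)
    have Suc: "(\<lambda>x y. \<Sum>k\<in>I. kernel_power I E s x k * E k y) = kernel_power I E (Suc s)" for s
      by (simp add: fun_eq_iff)
    have 0: "kernel_power I E 0 = E" by (simp add: fun_eq_iff)
    have eq: "fock_moment I E m = free_moment (kernel_trace I E) 0 m"
    proof (cases m)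
      case 0
      thus ?thesis by (simp add: fock_moment_def)
    next
      case (Suc k)
      thus ?thesis using less[of k 0] by (simp only: fock_moment_Suc 0 lessI)
    qed
    moreover have "fock_moment_with I E (kernel_power I E s) m = free_moment (kernel_trace I E) s (Suc m)" for s
    proof -
      have IH: "fock_moment_with I E (kernel_power I E (Suc s)) (m - Suc p) =
          free_moment (kernel_trace I E) (Suc s) (m - p)"
        "fock_moment I E p = free_moment (kernel_trace I E) 0 p" if "p < m" for p
        using less[of "m - Suc p"] less[of p] that by (auto simp: Suc_diff_Suc)
      have "fock_moment_with I E (kernel_power I E s) m = kernel_trace I E (Suc s) * fock_moment I E m +
          (\<Sum>p<m. fock_moment I E p * fock_moment_with I E (kernel_power I E (Suc s)) (m - Suc p))"
        by (subst fock_moment_with_rec[OF I]) (simp only: Suc kernel_trace_def diff_Suc_1)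
      also have "\<dots> = free_moment (kernel_trace I E) s (Suc m)"
        unfolding free_moment.simps eq
        by (intro arg_cong2[where f = "(+)"] sum.cong arg_cong2[where f = "(*)"] refl IH) auto
      finally show ?thesis .
    qed
    ultimately show ?case by blast
  qed
  thus ?thesis by blast
qed

section \<open>Quadratic forms in free copies\<close>

lemma scaleC_zero_left [simp]: "0 *\<^sub>C (x :: 'a::complex_vector) = 0"
  using scaleC_add_left[of 0 0 x] by simp

lemma scaleC_minus_left: "(- c) *\<^sub>C (x :: 'a::complex_vector) = - (c *\<^sub>C x)"
  using scaleC_add_left[of c "- c" x] by (simp add: eq_neg_iff_add_eq_0 add.commute)

lemma scaleC_diff_right: "c *\<^sub>C (x - y :: 'a::complex_vector) = c *\<^sub>C x - c *\<^sub>C y"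
  using scaleC_add_right[of c x "- y"] by (simp add: scaleC_minus_right)

lemma scaleC_sum_right: "c *\<^sub>C sum f S = (\<Sum>x\<in>S. c *\<^sub>C (f x :: 'a::complex_vector))"
  by (induction S rule: infinite_finite_induct) (simp_all add: scaleC_add_right)

lemma cop_scaleC_mult_left: "(c *\<^sub>C S) * T = c *\<^sub>C (S * T :: 'h::chilbert_space cop)"
  by transfer simp

lemma cop_scaleC_mult_right: "S * (c *\<^sub>C T) = c *\<^sub>C (S * T :: 'h::chilbert_space cop)"
  by transfer auto

subsection \<open>Polynomials in an operator\<close>

definition op_poly :: "complex poly \<Rightarrow> 'h::chilbert_space cop \<Rightarrow> 'h cop" where
  "op_poly p T = fold_coeffs (\<lambda>a S. a *\<^sub>C 1 + T * S) p 0"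

lemma op_poly_0 [simp]: "op_poly 0 T = 0"
  by (simp add: op_poly_def)

lemma op_poly_pCons: "op_poly (pCons a p) T = a *\<^sub>C 1 + T * op_poly p T"
  by (cases "p = 0 \<and> a = 0") (auto simp: op_poly_def)

lemma op_poly_add: "op_poly (p + q) T = op_poly p T + op_poly q T"
  by (induction p q rule: poly_induct2) (simp_all add: op_poly_pCons scaleC_add_left algebra_simps)

lemma op_poly_smult: "op_poly (smult c p) T = c *\<^sub>C op_poly p T"
  by (induction p) (simp_all add: op_poly_pCons scaleC_add_right scaleC_scaleC cop_scaleC_mult_right)

lemma op_poly_mult: "op_poly (p * q) T = op_poly p T * op_poly q T"
  by (induction p) (simp_all add: op_poly_pCons op_poly_add op_poly_smult cop_scaleC_mult_left algebra_simps)

lemma op_poly_in_generated_algebra: "op_poly p T \<in> generated_algebra T"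
proof (induction p)
  case 0
  have "0 *\<^sub>C 1 \<in> generated_algebra T" by (intro generated_algebra.intros)
  thus ?case by simp
next
  case (pCons a p)
  thus ?case unfolding op_poly_pCons by (intro generated_algebra.intros)
qed

text \<open>Expectation of a polynomial in a variable with moments \<open>m\<close>. It serves over
  the complex numbers for the given copies and over the reals for the limit law.\<close>

definition moment_functional :: "(nat \<Rightarrow> 'a::comm_ring_1) \<Rightarrow> 'a poly \<Rightarrow> 'a" where
  "moment_functional m p = (\<Sum>k\<le>degree p. coeff p k * m k)"

lemma moment_functional_eq: "degree p \<le> n \<Longrightarrow> moment_functional m p = (\<Sum>k\<le>n. coeff p k * m k)"
  unfolding moment_functional_def by (intro sum.mono_neutral_left) (auto simp: coeff_eq_0)

lemma moment_functional_add: "moment_functional m (p + q) = moment_functional m p + moment_functional m q"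
proof -
  let ?n = "max (degree p) (degree q)"
  have "degree (p + q) \<le> ?n" by (rule degree_add_le_max)
  thus ?thesis
    by (simp add: moment_functional_eq[of _ ?n] sum.distrib algebra_simps)
qed

lemma moment_functional_smult: "moment_functional m (smult c p) = c * moment_functional m p"
  using moment_functional_eq[OF degree_smult_le, of m c p]
  by (simp add: moment_functional_def sum_distrib_left mult.assoc)

lemma moment_functional_0 [simp]: "moment_functional m 0 = 0"
  by (simp add: moment_functional_def)

lemma moment_functional_const: "moment_functional m [:c:] = c * m 0"
  by (simp add: moment_functional_def)

lemma moment_functional_diff: "moment_functional m (p - q) = moment_functional m p - moment_functional m q"
proof -
  have "p - q = p + smult (- 1) q" by simp
  thus ?thesis by (simp only: moment_functional_add moment_functional_smult) simp
qed

lemma moment_functional_pCons: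
  "moment_functional m (pCons a p) = a * m 0 + moment_functional (\<lambda>k. m (Suc k)) p"
  using moment_functional_eq[OF degree_pCons_le, of m a p]
  by (simp add: moment_functional_def sum.atMost_Suc_shift del: sum.atMost_Suc)

context tracial_ncps
begin

lemma A_eq: "commutant (commutant A) = A"
  using von_neumann by (simp add: von_neumann_algebra_def)

text \<open>The bicommutant equation turns membership into commutation relations, which are visibly
  stable under the algebra operations.\<close>

lemma in_A_iff: "T \<in> A \<longleftrightarrow> (\<forall>S\<in>commutant A. S * T = T * S)"
  using A_eq unfolding commutant_def by blast

lemma one_in_A [simp]: "1 \<in> A"
  by (simp add: in_A_iff)

lemma mult_in_A [simp]: "S \<in> A \<Longrightarrow> T \<in> A \<Longrightarrow> S * T \<in> A"
  unfolding in_A_iff by (metis mult.assoc)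

lemma add_in_A [simp]: "S \<in> A \<Longrightarrow> T \<in> A \<Longrightarrow> S + T \<in> A"
  unfolding in_A_iff by (simp add: algebra_simps)

lemma scale_in_A [simp]: "T \<in> A \<Longrightarrow> c *\<^sub>C T \<in> A"
  unfolding in_A_iff by (simp add: cop_scaleC_mult_left cop_scaleC_mult_right)

lemma zero_in_A [simp]: "0 \<in> A"
  by (simp add: in_A_iff)

lemma power_in_A [simp]: "T \<in> A \<Longrightarrow> T ^ n \<in> A"
  by (induction n) auto

lemma op_poly_in_A [simp]: "T \<in> A \<Longrightarrow> op_poly p T \<in> A"
  by (induction p) (auto simp: op_poly_pCons)

lemma prod_list_in_A: "(\<And>T. T \<in> set Ts \<Longrightarrow> T \<in> A) \<Longrightarrow> prod_list Ts \<in> A"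
  by (induction Ts) auto

lemma sum_in_A: "(\<And>x. x \<in> S \<Longrightarrow> f x \<in> A) \<Longrightarrow> sum f S \<in> A"
  by (induction S rule: infinite_finite_induct) auto

lemma tau_0 [simp]: "\<tau> 0 = 0"
  using scale[OF one_in_A, of 0] by simp

lemma tau_sum: "(\<And>x. x \<in> S \<Longrightarrow> f x \<in> A) \<Longrightarrow> \<tau> (sum f S) = (\<Sum>x\<in>S. \<tau> (f x))"
  by (induction S rule: infinite_finite_induct) (auto simp: add sum_in_A)

lemma tau_op_poly:
  assumes "T \<in> A"
  shows "\<tau> (op_poly p T) = moment_functional (\<lambda>k. \<tau> (T ^ k)) p"
proof -
  have "\<tau> (T ^ j * op_poly p T) = moment_functional (\<lambda>k. \<tau> (T ^ (k + j))) p" for j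
  proof (induction p arbitrary: j)
    case (pCons a p)
    have "T ^ j * op_poly (pCons a p) T = a *\<^sub>C T ^ j + T ^ Suc j * op_poly p T"
      by (simp add: op_poly_pCons algebra_simps cop_scaleC_mult_right power_commutes[symmetric])
    thus ?case
      using assms pCons.IH[of "Suc j"] by (simp add: add scale moment_functional_pCons del: power_Suc)
  qed simp
  from this[of 0] show ?thesis by simp
qed

end

subsection \<open>Free copies\<close>

locale free_copies = tracial_ncps A \<tau> for A :: "'h::chilbert_space cop set" and \<tau> +
  fixes mom :: "nat \<Rightarrow> complex" and X :: "nat \<Rightarrow> 'h cop"
  assumes in_A [simp]: "i \<ge> 1 \<Longrightarrow> X i \<in> A"
    and moments: "i \<ge> 1 \<Longrightarrow> \<tau> (X i ^ k) = mom k"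
    and free: "free_variables \<tau> {1..} X"
begin

abbreviation \<phi> :: "complex poly \<Rightarrow> complex" where "\<phi> \<equiv> moment_functional mom"

text \<open>Letters carry polynomials instead of operators, so that the same word can be evaluated
  in other copies by renaming its indices alone.\<close>

definition word_value :: "(nat \<times> complex poly) list \<Rightarrow> 'h cop" where
  "word_value w = prod_list (map (\<lambda>(i, p). op_poly p (X i)) w)"

lemma m_0 [simp]: "mom 0 = 1"
  using moments[of 1 0] unit by simp

lemma tau_op_poly_X: "i \<ge> 1 \<Longrightarrow> \<tau> (op_poly p (X i)) = \<phi> p"
  by (simp add: tau_op_poly moments)

lemma phi_centre [simp]: "\<phi> (p - [:\<phi> p:]) = 0"
  by (simp add: moment_functional_diff moment_functional_const)

lemma word_value_append: "word_value (v @ w) = word_value v * word_value w"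
  by (simp add: word_value_def)

lemma word_value_Cons: "word_value ((i, p) # w) = op_poly p (X i) * word_value w"
  by (simp add: word_value_def)

lemma word_value_in_A: "fst ` set w \<subseteq> {1..} \<Longrightarrow> word_value w \<in> A"
  unfolding word_value_def by (rule prod_list_in_A) auto

lemma tau_alternating:
  assumes "w \<noteq> []" "distinct_adj (map fst w)" "\<forall>(i, p)\<in>set w. i \<ge> 1 \<and> \<phi> p = 0"
  shows "\<tau> (word_value w) = 0"
proof -
  let ?w = "map (\<lambda>(i, p). (i, op_poly p (X i))) w"
  have 1: "?w \<noteq> []" "distinct_adj (map fst ?w)"
    using assms(1,2) by (simp_all add: o_def case_prod_unfold)
  have 2: "\<forall>(i, a)\<in>set ?w. i \<in> {1..} \<and> a \<in> generated_algebra (X i) \<and> \<tau> a = 0"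
    using assms(3) by (auto simp: op_poly_in_generated_algebra tau_op_poly_X)
  have "\<tau> (prod_list (map snd ?w)) = 0"
    using free 1 2 unfolding free_variables_def free_subalgebras_def by blast
  thus ?thesis by (simp add: word_value_def o_def case_prod_unfold)
qed

lemma word_merge: "word_value (xs @ (i, p) # (i, q) # ys) = word_value (xs @ (i, p * q) # ys)"
  by (simp add: word_value_append word_value_Cons op_poly_mult mult.assoc)

lemma word_centre:
  assumes "fst ` set (xs @ (i, p) # ys) \<subseteq> {1..}"
  shows "\<tau> (word_value (xs @ (i, p) # ys)) =
    \<tau> (word_value (xs @ (i, p - [:c:]) # ys)) + c * \<tau> (word_value (xs @ ys))"
proof -
  have "op_poly p (X i) = op_poly (p - [:c:]) (X i) + c *\<^sub>C 1"
    using op_poly_add[of "p - [:c:]" "[:c:]" "X i"] by (simp add: op_poly_pCons)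
  hence "word_value (xs @ (i, p) # ys) = word_value (xs @ (i, p - [:c:]) # ys) + c *\<^sub>C word_value (xs @ ys)"
    by (simp add: word_value_append word_value_Cons algebra_simps cop_scaleC_mult_left cop_scaleC_mult_right)
  moreover have "word_value (xs @ (i, p - [:c:]) # ys) \<in> A" "word_value (xs @ ys) \<in> A"
    by (rule word_value_in_A, use assms in \<open>simp add: image_Un\<close>)+
  ultimately show ?thesis by (simp add: add scale)
qed

text \<open>The reduction by which freeness determines mixed moments: merge equal neighbours, split
  off means. In the measure a letter counts twice and an uncentred one once more, since merging
  removes a letter but may create an uncentred one.\<close>

lemma word_induct [case_names merge centre alternating]:
  assumes merge: "\<And>xs i p q ys. P (xs @ (i, p * q) # ys) \<Longrightarrow> P (xs @ (i, p) # (i, q) # ys)"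
    and centre: "\<And>xs i p ys. \<phi> p \<noteq> 0 \<Longrightarrow> P (xs @ (i, p - [:\<phi> p:]) # ys) \<Longrightarrow> P (xs @ ys) \<Longrightarrow> P (xs @ (i, p) # ys)"
    and alternating: "\<And>w. distinct_adj (map fst w) \<Longrightarrow> \<forall>(i, p)\<in>set w. \<phi> p = 0 \<Longrightarrow> P w"
  shows "P (w :: (nat \<times> complex poly) list)"
proof (induction "2 * length w + length (filter (\<lambda>(i, p). \<phi> p \<noteq> 0) w)" arbitrary: w rule: less_induct)
  case less
  show ?case
  proof (cases "distinct_adj (map fst w)")
    case False
    have "\<exists>xs x y ys. w = xs @ x # y # ys \<and> fst x = fst y"
      using False
    proof (induction w)
      case (Cons x w)
      show ?case
      proof (cases "distinct_adj (map fst w)")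
        case True
        then obtain y ys where "w = y # ys" "fst x = fst y"
          using Cons.prems by (cases w) (auto simp: distinct_adj_Cons)
        hence "x # w = [] @ x # y # ys \<and> fst x = fst y" by simp
        thus ?thesis by blast
      next
        case False
        then obtain xs a b ys where "w = xs @ a # b # ys" "fst a = fst b" using Cons.IH by blast
        hence "x # w = (x # xs) @ a # b # ys \<and> fst a = fst b" by simp
        thus ?thesis by blast
      qed
    qed simp
    then obtain xs i p q ys where w: "w = xs @ (i, p) # (i, q) # ys" by (metis prod.collapse)
    show ?thesis unfolding w by (rule merge, rule less) (simp add: w)
  next
    case True
    show ?thesis
    proof (cases "\<forall>(i, p)\<in>set w. \<phi> p = 0")
      case False
      then obtain i p where "(i, p) \<in> set w" and p: "\<phi> p \<noteq> 0" by auto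
      then obtain xs ys where w: "w = xs @ (i, p) # ys" by (meson split_list)
      show ?thesis unfolding w
        by (rule centre[OF p]; rule less) (simp_all add: w p)
    qed (use True alternating in blast)
  qed
qed

text \<open>A centred letter with a unique index is neither merged nor split off during the
  reduction. Every alternating word at the end still contains it, hence is nonempty and has
  expectation zero.\<close>

lemma tau_singleton:
  assumes "fst ` set w \<subseteq> {1..}" "filter (\<lambda>x. fst x = k) w = [(k, r)]" "\<phi> r = 0"
  shows "\<tau> (word_value w) = 0"
  using assms(1,2)
proof (induction w rule: word_induct)
  case (merge xs i p q ys)
  have "i \<noteq> k" using arg_cong[OF merge.prems(2), of length] by auto
  hence "\<tau> (word_value (xs @ (i, p * q) # ys)) = 0"
    using merge.prems by (intro merge.IH) (auto simp: image_Un)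
  thus ?case by (simp only: word_merge)
next
  case (centre xs i p ys)
  have "i \<noteq> k"
  proof
    assume "i = k"
    hence "(k, p) \<in> set [(k, r)]" unfolding centre.prems(2)[symmetric] by simp
    thus False using assms(3) centre.hyps by simp
  qed
  have "\<tau> (word_value (xs @ (i, p - [:\<phi> p:]) # ys)) = 0" "\<tau> (word_value (xs @ ys)) = 0"
    by (rule centre.IH; use centre.prems \<open>i \<noteq> k\<close> in \<open>simp add: image_Un\<close>)+
  thus ?case using word_centre[OF centre.prems(1), of "\<phi> p"] by simp
next
  case (alternating w)
  thus ?case by (intro tau_alternating) auto
qed

lemma fst_image_apfst [simp]: "fst ` apfst f ` S = f ` fst ` S"
  by (simp add: image_image)

text \<open>The reduction only compares indices, and all copies share the same moments. So a mixed
  moment depends on an index pattern only up to injective renaming.\<close>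

lemma tau_rename:
  assumes "fst ` set w \<subseteq> {1..}" "f ` fst ` set w \<subseteq> {1..}" "inj_on f (fst ` set w)"
  shows "\<tau> (word_value (map (apfst f) w)) = \<tau> (word_value w)"
  using assms
proof (induction w rule: word_induct)
  case (merge xs i p q ys)
  thus ?case by (simp add: word_merge)
next
  case (centre xs i p ys)
  have 1: "\<tau> (word_value (map (apfst f) (xs @ (i, p - [:\<phi> p:]) # ys))) = \<tau> (word_value (xs @ (i, p - [:\<phi> p:]) # ys))"
    using centre.prems by (intro centre.IH) (auto simp: image_Un)
  have 2: "\<tau> (word_value (map (apfst f) (xs @ ys))) = \<tau> (word_value (xs @ ys))"
    using centre.prems by (intro centre.IH) (auto simp: image_Un elim: inj_on_subset)
  have "\<tau> (word_value (map (apfst f) xs @ (f i, p) # map (apfst f) ys)) =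
      \<tau> (word_value (map (apfst f) xs @ (f i, p - [:\<phi> p:]) # map (apfst f) ys)) +
      \<phi> p * \<tau> (word_value (map (apfst f) xs @ map (apfst f) ys))"
    using centre.prems by (intro word_centre) (auto simp: image_Un)
  moreover have "\<tau> (word_value (xs @ (i, p) # ys)) =
      \<tau> (word_value (xs @ (i, p - [:\<phi> p:]) # ys)) + \<phi> p * \<tau> (word_value (xs @ ys))"
    using centre.prems by (intro word_centre) (auto simp: image_Un)
  ultimately show ?case using 1 2 by simp
next
  case (alternating w)
  show ?case
  proof (cases "w = []")
    case False
    have "map fst (map (apfst f) w) = map f (map fst w)" by simp
    hence "distinct_adj (map fst (map (apfst f) w))"
      using alternating by (metis distinct_adj_mapI list.set_map)
    hence "\<tau> (word_value (map (apfst f) w)) = 0"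
      using alternating False by (intro tau_alternating) fastforce+
    moreover have "\<tau> (word_value w) = 0"
      using alternating False by (intro tau_alternating) auto
    ultimately show ?thesis by simp
  qed simp
qed

end

subsection \<open>Centred letters\<close>

locale standardized_free_copies = free_copies A \<tau> mom X
  for A :: "'h::chilbert_space cop set" and \<tau> mom X +
  assumes variance: "mom 2 - (mom 1)\<^sup>2 = 1"
begin

definition \<xi> :: "complex poly" where "\<xi> = [:- mom 1, 1:]"
definition Z :: "nat \<Rightarrow> 'h cop" where "Z i = op_poly \<xi> (X i)"
definition letters :: "nat list \<Rightarrow> (nat \<times> complex poly) list" where "letters = map (\<lambda>i. (i, \<xi>))"
definition mixed_moment :: "nat list \<Rightarrow> complex" where "mixed_moment w = \<tau> (prod_list (map Z w))"

lemma Z_eq: "Z i = X i - mom 1 *\<^sub>C 1"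
  by (simp add: Z_def \<xi>_def op_poly_pCons scaleC_one scaleC_minus_left)

lemma phi_xi: "\<phi> \<xi> = 0" "\<phi> (\<xi> * \<xi>) = 1"
  using variance by (simp_all add: \<xi>_def moment_functional_def numeral_2_eq_2 power2_eq_square)

lemma mixed_moment_eq: "mixed_moment w = \<tau> (word_value (letters w))"
  by (simp add: mixed_moment_def word_value_def letters_def Z_def[abs_def] o_def)

lemma letters_append [simp]: "letters (v @ w) = letters v @ letters w"
  "letters (k # w) = (k, \<xi>) # letters w" "letters [] = []"
  by (simp_all add: letters_def)

lemma fst_letters [simp]: "map fst (letters w) = w" "fst ` set (letters w) = set w"
  by (simp_all add: letters_def o_def image_image)

lemma filter_letters: "k \<notin> set w \<Longrightarrow> filter (\<lambda>x. fst x = k) (letters w) = []"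
  by (auto simp: letters_def filter_empty_conv)

lemma mixed_moment_singleton:
  assumes "set w \<subseteq> {1..}" "count_list w k = 1"
  shows "mixed_moment w = 0"
proof -
  have "k \<in> set w" using assms(2) by (metis count_notin zero_neq_one)
  then obtain u v where w: "w = u @ k # v" by (meson split_list)
  hence k: "k \<notin> set u" "k \<notin> set v" using assms(2) by (auto simp: count_list_0_iff[symmetric])
  show ?thesis unfolding mixed_moment_eq
    by (rule tau_singleton[of _ k \<xi>]) (use assms(1) k in \<open>auto simp: w image_Un filter_letters phi_xi\<close>)
qed

lemma fock_singleton: "count_list w k = 1 \<Longrightarrow> fock [] w = 0"
proof -
  assume c: "count_list w k = 1"
  hence "k \<in> set w" by (metis count_notin zero_neq_one)
  then obtain u v where w: "w = u @ k # v" by (meson split_list)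
  hence k: "k \<notin> set u" "k \<notin> set v" using c by (auto simp: count_list_0_iff[symmetric])
  thus ?thesis unfolding w by (intro fock_eq_0_if_singleton) auto
qed

text \<open>Without equal neighbours both sides vanish. Otherwise the square of an adjacent pair is
  1 plus a centred polynomial in a variable that occurs nowhere else; the latter contributes zero,
  so the pair may be deleted, as in \<open>fock_cancel_pair\<close>. Unit variance enters
  here.\<close>

lemma mixed_moment_pairs:
  assumes "set w \<subseteq> {1..}" "\<And>k. k \<in> set w \<Longrightarrow> count_list w k = 2"
  shows "mixed_moment w = fock [] w"
  using assms
proof (induction "length w" arbitrary: w rule: less_induct)
  case less
  show ?case
  proof (cases "distinct_adj w")
    case True
    show ?thesis
    proof (cases "w = []")
      case False
      have "mixed_moment w = 0" unfolding mixed_moment_eq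
        using False True less.prems(1) by (intro tau_alternating) (auto simp: letters_def phi_xi o_def)
      thus ?thesis using False True fock_eq_0_if_distinct_adj[of w "[]"] by simp
    qed (simp add: mixed_moment_def unit)
  next
    case False
    have "\<exists>u k v. w = u @ k # k # v"
      using False
    proof (induction w)
      case (Cons x w)
      show ?case
      proof (cases "distinct_adj w")
        case True
        then obtain ys where "w = x # ys"
          using Cons.prems by (cases w) (auto simp: distinct_adj_Cons)
        hence "x # w = [] @ x # x # ys" by simp
        thus ?thesis by blast
      next
        case False
        then obtain u k v where "w = u @ k # k # v" using Cons.IH by blast
        hence "x # w = (x # u) @ k # k # v" by simp
        thus ?thesis by blast
      qed
    qed simp
    then obtain u k v where w: "w = u @ k # k # v" by blast
    have "count_list w k = 2" by (rule less.prems(2)) (simp add: w)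
    hence k: "k \<notin> set u" "k \<notin> set v" unfolding w by (simp_all add: count_list_0_iff[symmetric])
    have "mixed_moment w = \<tau> (word_value (letters u @ (k, \<xi> * \<xi>) # letters v))"
      by (simp add: mixed_moment_eq w word_merge)
    also have "\<dots> = \<tau> (word_value (letters u @ (k, \<xi> * \<xi> - [:1:]) # letters v)) + 1 * mixed_moment (u @ v)"
      unfolding mixed_moment_eq letters_append using less.prems(1) by (intro word_centre) (auto simp: w image_Un)
    also have "\<tau> (word_value (letters u @ (k, \<xi> * \<xi> - [:1:]) # letters v)) = 0"
      by (rule tau_singleton[of _ k "\<xi> * \<xi> - [:1:]"])
        (use less.prems(1) k in \<open>auto simp: w image_Un filter_letters phi_xi moment_functional_diff moment_functional_const\<close>)
    also have "mixed_moment (u @ v) = fock [] (u @ v)"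
    proof (rule less.hyps)
      fix j assume j: "j \<in> set (u @ v)"
      hence "j \<noteq> k" using k by auto
      thus "count_list (u @ v) j = 2" using less.prems(2)[of j] j by (auto simp: w)
    qed (use less.prems(1) in \<open>auto simp: w\<close>)
    also have "\<dots> = fock [] w" unfolding w using k by (simp add: fock_cancel_pair)
    finally show ?thesis by simp
  qed
qed

text \<open>The bound must not depend on the number of copies in use. A word of length
  \<open>L\<close> has at most \<open>L\<close> letters and can be renamed into the finite alphabet
  \<open>{1..L}\<close>.\<close>

lemma mixed_moment_bound:
  obtains C where "\<And>w. set w \<subseteq> {1..} \<Longrightarrow> length w = L \<Longrightarrow> norm (mixed_moment w) \<le> C"
proof
  fix w :: "nat list" assume w: "set w \<subseteq> {1..}" "length w = L"
  have "card (set w) \<le> card {1..L}" using w card_length[of w] by simp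
  then obtain f where f: "f ` set w \<subseteq> {1..L}" "inj_on f (set w)"
    using card_le_inj[of "set w" "{1..L}"] by auto
  have "mixed_moment (map f w) = mixed_moment w"
  proof -
    have "letters (map f w) = map (apfst f) (letters w)" by (simp add: letters_def)
    moreover have "\<tau> (word_value (map (apfst f) (letters w))) = \<tau> (word_value (letters w))"
      by (rule tau_rename) (use w f in auto)
    ultimately show ?thesis by (simp add: mixed_moment_eq)
  qed
  moreover have "map f w \<in> words {1..L} L" using w f by (simp add: words_def)
  ultimately show "norm (mixed_moment w) \<le> (\<Sum>v\<in>words {1..L} L. norm (mixed_moment v))"
    using member_le_sum[of "map f w" "words {1..L} L" "\<lambda>v. norm (mixed_moment v)"]
    by (simp add: finite_words)
qed

end

text \<open>Such a word is given by a list of m - 1 letters together with, for each position, an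
  index into that list.\<close>

lemma card_words_few_letters:
  assumes m: "m > 0" and I: "finite I"
  shows "card {w \<in> words I (2 * m). card (set w) < m} \<le> m ^ (2 * m) * card I ^ (m - 1)"
proof -
  let ?S = "{w \<in> words I (2 * m). card (set w) < m}"
  let ?T = "words {..<m} (2 * m) \<times> words I (m - 1)"
  have "?S \<subseteq> (\<lambda>(g, ys). map (\<lambda>i. ys ! i) g) ` ?T"
  proof
    fix w assume w: "w \<in> ?S"
    hence len: "length w = 2 * m" and sub: "set w \<subseteq> I" by (auto simp: words_def)
    then obtain a where a: "a \<in> set w" using m by (cases w) auto
    obtain zs where zs: "set zs = set w" "distinct zs" using finite_distinct_list[of "set w"] by auto
    hence "length zs \<le> m - 1" using w distinct_card[OF zs(2)] by auto
    \<comment> \<open>Padding with a letter of the word gives the list the fixed length m -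
      1.\<close>
    define ys where "ys = zs @ replicate (m - 1 - length zs) a"
    have ys: "length ys = m - 1" "set ys = set w"
      using \<open>length zs \<le> m - 1\<close> a
      by (simp_all add: ys_def zs(1) set_replicate_conv_if insert_absorb)
    have "\<forall>x\<in>set w. \<exists>i<m - 1. ys ! i = x" using ys by (metis in_set_conv_nth)
    then obtain g where g: "\<And>x. x \<in> set w \<Longrightarrow> g x < m - 1 \<and> ys ! g x = x" by metis
    have "w = map (\<lambda>i. ys ! i) (map g w)" using g by (simp add: map_idI o_def)
    moreover have "(map g w, ys) \<in> ?T" using g ys sub len by (fastforce simp: words_def)
    ultimately show "w \<in> (\<lambda>(g, ys). map (\<lambda>i. ys ! i) g) ` ?T" by force
  qed
  hence "card ?S \<le> card ?T"
    using I by (intro surj_card_le) (auto intro: finite_words)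
  also have "\<dots> = m ^ (2 * m) * card I ^ (m - 1)"
    using I by (simp add: card_cartesian_product card_words)
  finally show ?thesis .
qed

section \<open>Comparison of the quadratic form with its semicircular counterpart\<close>

context standardized_free_copies
begin

definition quadratic_form :: "nat \<Rightarrow> (nat \<Rightarrow> nat \<Rightarrow> complex) \<Rightarrow> 'h cop" where
  "quadratic_form n E = (\<Sum>x=1..n. \<Sum>y=1..n. E x y *\<^sub>C (Z x * Z y))"

lemma Z_in_A [simp]: "i \<ge> 1 \<Longrightarrow> Z i \<in> A"
  by (simp add: Z_def)

lemma quadratic_form_power:
  "quadratic_form n E ^ m = (\<Sum>w\<in>words {1..n} (2 * m). kernel_weight E w *\<^sub>C prod_list (map Z w))"
proof (induction m)
  case (Suc m)
  let ?W = "words {1..n} (2 * m)"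
  have "quadratic_form n E ^ Suc m = quadratic_form n E * (\<Sum>w\<in>?W. kernel_weight E w *\<^sub>C prod_list (map Z w))"
    by (simp only: power_Suc Suc)
  also have "\<dots> = (\<Sum>x=1..n. \<Sum>y=1..n. \<Sum>w\<in>?W.
      (E x y * kernel_weight E w) *\<^sub>C (Z x * (Z y * prod_list (map Z w))))"
    unfolding quadratic_form_def sum_distrib_right unfolding sum_distrib_left cop_scaleC_mult_left
    by (simp only: cop_scaleC_mult_right scaleC_scaleC mult.assoc)
  also have "\<dots> = (\<Sum>w\<in>words {1..n} (Suc (Suc (2 * m))). kernel_weight E w *\<^sub>C prod_list (map Z w))"
    by (simp add: sum_words_Suc)
  finally show ?case by simp
qed (simp add: scaleC_one)

lemma tau_quadratic_form_power:
  "\<tau> (quadratic_form n E ^ m) = (\<Sum>w\<in>words {1..n} (2 * m). kernel_weight E w * mixed_moment w)"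
proof -
  have "prod_list (map Z w) \<in> A" if "w \<in> words {1..n} L" for w L
    using that by (intro prod_list_in_A) (auto simp: words_def)
  thus ?thesis
    unfolding quadratic_form_power by (subst tau_sum) (auto simp: scale mixed_moment_def intro!: sum.cong)
qed

text \<open>Words in which every letter occurs exactly twice have the semicircular moments, words with
  a letter that occurs only once contribute nothing, and the remaining words are too few to matter.\<close>

lemma quadratic_form_moment_approx:
  obtains C where "\<And>n E. (\<And>x y. norm (E x y) \<le> 1 / of_nat n) \<Longrightarrow> n > 0 \<Longrightarrow>
    norm (\<tau> (quadratic_form n E ^ m) - fock_moment {1..n} E m) \<le> C / of_nat n"
proof (cases "m = 0")
  case True
  show ?thesis
    by (rule that[of 0]) (simp add: True unit fock_moment_def)
next
  case False
  obtain C where C: "\<And>w. set w \<subseteq> {1..} \<Longrightarrow> length w = 2 * m \<Longrightarrow> norm (mixed_moment w) \<le> C"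
    using mixed_moment_bound by blast
  \<comment> \<open>Where the moments differ, every letter occurs at least twice and some letter
    more often, so 2 m exceeds twice the number of letters.\<close>
  have few: "card (set w) < m" if w: "w \<in> words {1..n} (2 * m)" "mixed_moment w \<noteq> fock [] w" for w n
  proof -
    have sub: "set w \<subseteq> {1..}" and len: "length w = 2 * m" using w(1) by (auto simp: words_def)
    have ge2: "count_list w k \<ge> 2" if "k \<in> set w" for k
    proof -
      have "count_list w k \<noteq> 0" using that by (simp add: count_list_0_iff)
      moreover have "count_list w k \<noteq> 1"
        using mixed_moment_singleton[OF sub, of k] fock_singleton[of w k] w(2) by auto
      ultimately show ?thesis by linarith
    qed
    moreover obtain k where "k \<in> set w" "count_list w k \<noteq> 2"
      using mixed_moment_pairs[OF sub] w(2) by blast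
    ultimately have "(\<Sum>k\<in>set w. 2) < (\<Sum>k\<in>set w. count_list w k)"
      by (intro sum_strict_mono_ex1) (auto simp: le_neq_implies_less Bex_def)
    also have "\<dots> = 2 * m" using sum_count_set[of w "set w"] len by simp
    finally show ?thesis by simp
  qed
  show ?thesis
  proof (rule that[of "m ^ (2 * m) * (C + 4 ^ m)"])
    fix n :: nat and E :: "nat \<Rightarrow> nat \<Rightarrow> complex"
    assume E: "\<And>x y. norm (E x y) \<le> 1 / of_nat n" and n: "n > 0"
    let ?S = "{w \<in> words {1..n} (2 * m). card (set w) < m}"
    \<comment> \<open>A constant word is a witness that the bound \<open>C\<close> is not
      negative.\<close>
    have "C + 4 ^ m \<ge> 0" using C[of "replicate (2 * m) 1"] order_trans[OF norm_ge_zero] by force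
    have "\<tau> (quadratic_form n E ^ m) - fock_moment {1..n} E m =
        (\<Sum>w\<in>words {1..n} (2 * m). kernel_weight E w * (mixed_moment w - fock [] w))"
      by (simp add: tau_quadratic_form_power fock_moment_def sum_subtractf right_diff_distrib)
    also have "\<dots> = (\<Sum>w\<in>?S. kernel_weight E w * (mixed_moment w - fock [] w))"
      using few by (intro sum.mono_neutral_right finite_words) auto
    also have "norm \<dots> \<le> (\<Sum>w\<in>?S. (1 / of_nat n) ^ m * (C + 4 ^ m))"
    proof (rule sum_norm_le)
      fix w assume w: "w \<in> ?S"
      have "norm (kernel_weight E w) \<le> (1 / of_nat n) ^ m"
        using w E by (intro norm_kernel_weight_le) (auto simp: words_def)
      moreover have "norm (mixed_moment w - fock [] w) \<le> C + 4 ^ m"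
      proof -
        have "norm (mixed_moment w) \<le> C" using w by (intro C) (auto simp: words_def)
        moreover have "norm (fock [] w) \<le> 4 ^ m"
          using norm_fock_le[of "[]" w] w by (simp add: words_def power_mult)
        ultimately show ?thesis by norm
      qed
      ultimately show "norm (kernel_weight E w * (mixed_moment w - fock [] w)) \<le> (1 / of_nat n) ^ m * (C + 4 ^ m)"
        unfolding norm_mult by (intro mult_mono) auto
    qed
    also have "\<dots> = of_nat (card ?S) * ((1 / of_nat n) ^ m * (C + 4 ^ m))" by simp
    \<comment> \<open>Of order n^(m - 1) words remain, each with a weight of order n^(- m); this
      leaves the factor 1/n.\<close>
    also have "\<dots> \<le> of_nat (m ^ (2 * m) * n ^ (m - 1)) * ((1 / of_nat n) ^ m * (C + 4 ^ m))"
      using card_words_few_letters[of m "{1..n}"] False \<open>C + 4 ^ m \<ge> 0\<close>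
      by (intro mult_right_mono of_nat_mono) auto
    also have "\<dots> = m ^ (2 * m) * (C + 4 ^ m) / of_nat n"
    proof -
      obtain k where "m = Suc k" using False by (cases m) auto
      thus ?thesis using n by (simp add: field_simps)
    qed
    finally show "norm (\<tau> (quadratic_form n E ^ m) - fock_moment {1..n} E m) \<le> m ^ (2 * m) * (C + 4 ^ m) / of_nat n" .
  qed
qed

text \<open>For each \<open>n\<close> the semicircular moments are exactly the free moments with the
  traces as cumulants, so the limit can be taken in every cumulant separately.\<close>

theorem tendsto_quadratic_form_sign_kernel:
  "(\<lambda>n. \<tau> (quadratic_form n (sign_kernel n) ^ m)) \<longlonglongrightarrow> free_moment (\<lambda>s. fps_nth (fps_tan 1) (s - 1)) 0 m"
proof -
  obtain C where C: "\<And>n E. (\<And>x y. norm (E x y) \<le> 1 / of_nat n) \<Longrightarrow> n > 0 \<Longrightarrow>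
    norm (\<tau> (quadratic_form n E ^ m) - fock_moment {1..n} E m) \<le> C / of_nat n"
    using quadratic_form_moment_approx[of m] by blast
  have "(\<lambda>n. \<tau> (quadratic_form n (sign_kernel n) ^ m) - fock_moment {1..n} (sign_kernel n) m) \<longlonglongrightarrow> 0"
  proof (rule Lim_null_comparison)
    show "\<forall>\<^sub>F n in sequentially. norm (\<tau> (quadratic_form n (sign_kernel n) ^ m) -
        fock_moment {1..n} (sign_kernel n) m) \<le> C * (1 / of_nat n)"
      using eventually_gt_at_top[of 0]
      by eventually_elim (use C norm_sign_kernel_le in fastforce)
    show "(\<lambda>n. C * (1 / of_nat n)) \<longlonglongrightarrow> 0"
      using tendsto_mult[OF tendsto_const lim_1_over_n, of C] by simp
  qed
  moreover have "(\<lambda>n. fock_moment {1..n} (sign_kernel n) m) \<longlonglongrightarrow> free_moment (\<lambda>s. fps_nth (fps_tan 1) (s - 1)) 0 m"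
    unfolding fock_moment_eq_free_moment[OF finite_atLeastAtMost]
  proof (rule tendsto_free_moment)
    fix s
    \<comment> \<open>This includes \<open>s = 0\<close>, where truncated subtraction reads both
      sides as at \<open>s = 1\<close>.\<close>
    have "kernel_trace I E (Suc (s - 1)) = kernel_trace I E s" for I E
      by (simp add: kernel_trace_def)
    thus "(\<lambda>n. kernel_trace {1..n} (sign_kernel n) s) \<longlonglongrightarrow> fps_nth (fps_tan 1) (s - 1)"
      using tendsto_kernel_trace_sign_kernel[of "Suc (s - 1)"] by simp
  qed
  ultimately show ?thesis using tendsto_add by fastforce
qed

text \<open>Scalars cancel in a commutator, so the mean disappears. The two products of a commutator
  supply the entries above and below the diagonal with opposite signs.\<close>

lemma sum_commutators_eq_quadratic_form:
  "(1 / of_nat n) *\<^sub>C (\<Sum>(k, j)\<in>{(k, j). 1 \<le> k \<and> k < j \<and> j \<le> n}. \<i> *\<^sub>C (X k * X j - X j * X k))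
    = quadratic_form n (sign_kernel n)"
proof -
  let ?P = "{(k, j). 1 \<le> k \<and> k < j \<and> j \<le> n}"
  let ?f = "\<lambda>(x, y). sign_kernel n x y *\<^sub>C (Z x * Z y)"
  have fin: "finite ?P" by (rule finite_subset[of _ "{1..n} \<times> {1..n}"]) auto
  have commutator: "X k * X j - X j * X k = Z k * Z j - Z j * Z k" for k j
    by (simp add: Z_eq algebra_simps cop_scaleC_mult_left cop_scaleC_mult_right scaleC_diff_right)
  have "quadratic_form n (sign_kernel n) = sum ?f ({1..n} \<times> {1..n})"
    by (simp add: quadratic_form_def sum.cartesian_product)
  also have "\<dots> = sum ?f (?P \<union> prod.swap ` ?P)"
    by (rule sum.mono_neutral_right) (auto simp: sign_kernel_def image_iff split: if_splits)
  also have "\<dots> = sum ?f ?P + sum ?f (prod.swap ` ?P)"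
    using fin by (intro sum.union_disjoint) auto
  also have "sum ?f (prod.swap ` ?P) = (\<Sum>(k, j)\<in>?P. sign_kernel n j k *\<^sub>C (Z j * Z k))"
    by (subst sum.reindex) (auto simp: inj_on_def case_prod_unfold)
  also have "sum ?f ?P + \<dots> = (\<Sum>(k, j)\<in>?P. (1 / of_nat n) *\<^sub>C (\<i> *\<^sub>C (Z k * Z j - Z j * Z k)))"
    unfolding sum.distrib[symmetric]
    by (intro sum.cong) (auto simp: sign_kernel_def scaleC_diff_right scaleC_scaleC scaleC_minus_left)
  finally show ?thesis by (simp add: commutator scaleC_sum_right case_prod_unfold)
qed

end

section \<open>Von Neumann algebras generated by one selfadjoint operator\<close>

lemma cop_apply_simps [simp]:
  "cop_apply (S + T) x = cop_apply S x + cop_apply T x"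
  "cop_apply (S - T) x = cop_apply S x - cop_apply T x"
  "cop_apply (c *\<^sub>C T) x = c *\<^sub>C cop_apply T x"
  "cop_apply (S * T) x = cop_apply S (cop_apply T x)"
  "cop_apply 0 x = 0" "cop_apply 1 x = x"
proof -
  show "cop_apply (S - T) x = cop_apply S x - cop_apply T x"
    by (simp only: minus_cop_def plus_cop.rep_eq uminus_cop.rep_eq) simp
qed (simp_all add: plus_cop.rep_eq scaleC_cop.rep_eq times_cop.rep_eq zero_cop.rep_eq one_cop.rep_eq)

lemma bounded_linear_cop_apply: "bounded_linear (cop_apply T)"
  using cop_apply[of T] by simp

lemma cop_apply_add [simp]: "cop_apply T (x + y) = cop_apply T x + cop_apply T y"
  and cop_apply_diff [simp]: "cop_apply T (x - y) = cop_apply T x - cop_apply T y"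
  and cop_apply_0 [simp]: "cop_apply T 0 = 0"
  and cop_apply_scaleC [simp]: "cop_apply T (c *\<^sub>C x) = c *\<^sub>C cop_apply T x"
  using bounded_linear_cop_apply[of T] cop_apply[of T]
  by (simp_all add: linear_simps)

lemma cop_apply_sum: "cop_apply T (sum f S) = (\<Sum>x\<in>S. cop_apply T (f x))"
  by (induction S rule: infinite_finite_induct) auto

lemma tendsto_cop_apply: "(f \<longlongrightarrow> x) F \<Longrightarrow> ((\<lambda>n. cop_apply T (f n)) \<longlongrightarrow> cop_apply T x) F"
  by (rule bounded_linear.tendsto[OF bounded_linear_cop_apply])

lemma cop_eqI: "(\<And>x. cop_apply S x = cop_apply T x) \<Longrightarrow> S = T"
  by (metis cop_apply_inject ext)

lemma cop_norm_bound: obtains K where "K > 0" "\<And>x. norm (cop_apply T x) \<le> K * norm x"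
  using bounded_linear.pos_bounded[OF bounded_linear_cop_apply[of T]] by (auto simp: mult.commute)

lemma cinner_add_left: "cinner (x + y) z = cinner x z + cinner y z"
  by (metis cinner_add_right cinner_commute complex_cnj_add)

lemma cinner_scaleC_left: "cinner (c *\<^sub>C x) y = cnj c * cinner x y"
  by (metis cinner_scaleC_right cinner_commute complex_cnj_mult)

lemma cinner_zero [simp]: "cinner x 0 = 0" "cinner 0 x = 0"
  using cinner_add_right[of x 0 0] cinner_add_left[of 0 0 x] by simp_all

lemma cinner_diff_right: "cinner x (y - z) = cinner x y - cinner x z"
  using cinner_add_right[of x "y - z" z] by simp

lemma cinner_diff_left: "cinner (x - y) z = cinner x z - cinner y z"
  using cinner_add_left[of "x - y" y z] by simp

lemma cinner_sum_left: "cinner (sum f S) y = (\<Sum>x\<in>S. cinner (f x) y)"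
  by (induction S rule: infinite_finite_induct) (auto simp: cinner_add_left)

text \<open>Common source of the Cauchy-Schwarz inequalities for positive operators and for moment
  functionals. Both forms may be degenerate, so \<open>c = 0\<close> has to be covered.\<close>

lemma quadratic_nonneg_discriminant:
  fixes a b c :: real
  assumes nonneg: "\<And>t. 0 \<le> a + 2 * t * b + t\<^sup>2 * c"
  shows "b\<^sup>2 \<le> a * c"
proof (cases "c > 0")
  case True
  have "0 \<le> c * (a + 2 * (- b / c) * b + (- b / c)\<^sup>2 * c)"
    using True nonneg[of "- b / c"] by (intro mult_nonneg_nonneg) auto
  also have "\<dots> = a * c - b\<^sup>2" using True by (simp add: field_simps power2_eq_square)
  finally show ?thesis by simp
next
  case False
  have "b = 0"
  proof (rule ccontr)
    assume b: "b \<noteq> 0"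
    \<comment> \<open>Chosen so that the linear term outweighs \<open>a\<close> while the quadratic
      term is not positive.\<close>
    define t where "t = - (\<bar>a\<bar> + 1) / (2 * b)"
    have "t\<^sup>2 * c \<le> 0" using False by (simp add: mult_nonneg_nonpos)
    moreover have "2 * t * b = - (\<bar>a\<bar> + 1)" using b by (simp add: t_def)
    ultimately show False using nonneg[of t] by linarith
  qed
  moreover have "c = 0 \<or> a \<le> 0"
  proof (rule ccontr)
    assume "\<not> (c = 0 \<or> a \<le> 0)"
    hence c: "c < 0" and a: "a > 0" using False by auto
    have "0 \<le> a + (sqrt (2 * a / - c))\<^sup>2 * c" using nonneg[of "sqrt (2 * a / - c)"] \<open>b = 0\<close> by simp
    also have "(sqrt (2 * a / - c))\<^sup>2 = 2 * a / - c" using a c by (intro real_sqrt_pow2) (simp add: divide_nonneg_neg)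
    finally show False using a c by (simp add: field_simps)
  qed
  ultimately show ?thesis using nonneg[of 0] False by (auto simp: mult_nonpos_nonpos)
qed

section \<open>Positive operators and the Cauchy-Schwarz inequality\<close>

lemma positive_cop_iff: "positive_cop P \<longleftrightarrow> (\<forall>x. Im (cinner x (cop_apply P x)) = 0 \<and> 0 \<le> Re (cinner x (cop_apply P x)))"
  by (auto simp: positive_cop_def complex_nonneg_Reals_iff)

text \<open>Positivity only concerns the quadratic form. Its realness at x + y and at x + i y gives
  symmetry by polarization.\<close>

lemma positive_cop_hermitian:
  assumes P: "positive_cop P"
  shows "cinner y (cop_apply P x) = cnj (cinner x (cop_apply P y))"
proof -
  have im: "Im (cinner x (cop_apply P x)) = 0" for x using P by (simp add: positive_cop_iff)
  have "Im (cinner x (cop_apply P y) + cinner y (cop_apply P x)) = 0"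
    using im[of "x + y"] im[of x] im[of y] by (simp add: cinner_add_left cinner_add_right)
  moreover have "Re (cinner x (cop_apply P y) - cinner y (cop_apply P x)) = 0"
    using im[of "x + \<i> *\<^sub>C y"] im[of x] im[of y]
    by (simp add: cinner_add_left cinner_add_right cinner_scaleC_left cinner_scaleC_right)
  ultimately show ?thesis by (simp add: complex_eq_iff)
qed

lemma positive_cop_Cauchy_Schwarz:
  assumes P: "positive_cop P"
  shows "(cmod (cinner x (cop_apply P y)))\<^sup>2 \<le> Re (cinner x (cop_apply P x)) * Re (cinner y (cop_apply P y))"
proof -
  define b where "b = cinner x (cop_apply P y)"
  have b': "cinner y (cop_apply P x) = cnj b" unfolding b_def by (rule positive_cop_hermitian[OF P])
  \<comment> \<open>A phase that rotates \<open>b\<close> to its modulus, so that real multiples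
    \<open>t\<close> suffice.\<close>
  define d where "d = (if b = 0 then 1 else cnj b / of_real (cmod b))"
  have d: "cmod d = 1" "d * b = of_real (cmod b)"
  proof -
    have sq: "cnj b * b = of_real (cmod b) * of_real (cmod b)"
      by (metis complex_norm_square mult.commute of_real_mult power2_eq_square)
    show "cmod d = 1" by (simp add: d_def norm_divide)
    show "d * b = of_real (cmod b)"
    proof (cases "b = 0")
      case False
      hence "d * b = (cnj b * b) / of_real (cmod b)" by (simp only: d_def if_False times_divide_eq_left)
      thus ?thesis using False unfolding sq by simp
    qed simp
  qed
  have "(cmod b)\<^sup>2 \<le> Re (cinner x (cop_apply P x)) * Re (cinner y (cop_apply P y))"
  proof (rule quadratic_nonneg_discriminant)
    have nonneg: "0 \<le> Re (cinner z (cop_apply P z))" for z using P by (simp add: positive_cop_iff)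
    fix t :: real
    let ?c = "of_real t * d"
    have "0 \<le> Re (cinner (x + ?c *\<^sub>C y) (cop_apply P (x + ?c *\<^sub>C y)))"
      by (rule nonneg)
    also have "cinner (x + ?c *\<^sub>C y) (cop_apply P (x + ?c *\<^sub>C y)) =
        cinner x (cop_apply P x) + (?c * b + cnj (?c * b)) + (?c * cnj ?c) * cinner y (cop_apply P y)"
      by (simp add: cinner_add_left cinner_add_right cinner_scaleC_left cinner_scaleC_right b' b_def[symmetric] algebra_simps)
    also have "?c * b = of_real (t * cmod b)" using d(2) by (simp add: mult.assoc)
    also have "?c * cnj ?c = (of_real t)\<^sup>2 * (d * cnj d)" by (simp add: power2_eq_square)
    also have "\<dots> = of_real (t\<^sup>2)" using complex_norm_square[of d] d(1) by simp
    finally show "0 \<le> Re (cinner x (cop_apply P x)) + 2 * t * cmod b + t\<^sup>2 * Re (cinner y (cop_apply P y))"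
      by simp
  qed
  thus ?thesis by (simp add: b_def)
qed

lemma positive_cop_1: "positive_cop 1"
  by (simp add: positive_cop_iff cinner_norm)

lemma cinner_Cauchy_Schwarz: "cmod (cinner x y) \<le> norm x * norm (y :: 'h::chilbert_space)"
proof -
  have "(cmod (cinner x y))\<^sup>2 \<le> (norm x * norm y)\<^sup>2"
    using positive_cop_Cauchy_Schwarz[OF positive_cop_1, of x y] by (simp add: cinner_norm power_mult_distrib)
  thus ?thesis by (simp add: power2_le_iff_abs_le)
qed

lemma tendsto_cinner_right: "(f \<longlongrightarrow> y) F \<Longrightarrow> ((\<lambda>n. cinner x (f n)) \<longlongrightarrow> cinner x y) F"
proof -
  assume f: "(f \<longlongrightarrow> y) F"
  have "((\<lambda>n. cinner x (f n) - cinner x y) \<longlongrightarrow> 0) F"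
  proof (rule Lim_null_comparison)
    show "\<forall>\<^sub>F n in F. norm (cinner x (f n) - cinner x y) \<le> norm x * norm (f n - y)"
      by (intro always_eventually allI) (metis cinner_diff_right cinner_Cauchy_Schwarz)
    have "((\<lambda>n. norm (f n - y)) \<longlongrightarrow> 0) F"
      using f by (simp add: tendsto_norm_zero LIM_zero)
    thus "((\<lambda>n. norm x * norm (f n - y)) \<longlongrightarrow> 0) F"
      by (auto intro: tendsto_mult_right_zero)
  qed
  thus ?thesis by (simp add: LIM_zero_iff)
qed

lemma tendsto_cinner_left: "(f \<longlongrightarrow> x) F \<Longrightarrow> ((\<lambda>n. cinner (f n) y) \<longlongrightarrow> cinner x y) F"
  by (subst (1 2) cinner_commute) (intro tendsto_cnj tendsto_cinner_right)

lemma cinner_eqI: "(\<And>z. cinner z x = cinner z y) \<Longrightarrow> x = (y :: 'h::chilbert_space)"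
proof -
  assume "\<And>z. cinner z x = cinner z y"
  hence "cinner (x - y) (x - y) = 0" by (simp add: cinner_diff_right)
  thus ?thesis by (simp add: cinner_norm)
qed

subsection \<open>Order and strong limits\<close>

lemma loewner_le_iff:
  "S \<preceq>\<^sub>L T \<longleftrightarrow> (\<forall>x. Im (cinner x (cop_apply S x)) = Im (cinner x (cop_apply T x)) \<and>
     Re (cinner x (cop_apply S x)) \<le> Re (cinner x (cop_apply T x)))"
  by (auto simp: loewner_le_def positive_cop_iff cinner_diff_right)

lemma loewner_le_trans: "S \<preceq>\<^sub>L T \<Longrightarrow> T \<preceq>\<^sub>L U \<Longrightarrow> S \<preceq>\<^sub>L U"
  unfolding loewner_le_iff by (metis order.trans)

text \<open>Cauchy-Schwarz for the form of \<open>P\<close> at the vectors \<open>P x\<close> and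
  \<open>x\<close>. It upgrades convergence of quadratic forms to convergence in norm at each
  vector.\<close>

lemma positive_cop_le_norm:
  assumes P: "positive_cop P" and le: "P \<preceq>\<^sub>L T" and K: "\<And>x. norm (cop_apply T x) \<le> K * norm x"
  shows "(norm (cop_apply P x))\<^sup>2 \<le> K * Re (cinner x (cop_apply P x))"
proof -
  let ?y = "cop_apply P x"
  have "Re (cinner ?y (cop_apply P ?y)) \<le> Re (cinner ?y (cop_apply T ?y))"
    using le by (simp add: loewner_le_iff)
  also have "\<dots> \<le> cmod (cinner ?y (cop_apply T ?y))" by (rule complex_Re_le_cmod)
  also have "\<dots> \<le> norm ?y * (K * norm ?y)"
    using cinner_Cauchy_Schwarz K by (rule order.trans[OF _ mult_left_mono]) auto
  finally have le: "Re (cinner ?y (cop_apply P ?y)) \<le> K * (norm ?y)\<^sup>2" by (simp add: power2_eq_square algebra_simps)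
  have pos: "0 \<le> Re (cinner x (cop_apply P x))" using P by (simp add: positive_cop_iff)
  have "(cmod (cinner ?y (cop_apply P x)))\<^sup>2 \<le> Re (cinner ?y (cop_apply P ?y)) * Re (cinner x (cop_apply P x))"
    by (rule positive_cop_Cauchy_Schwarz[OF P])
  also have "\<dots> \<le> K * (norm ?y)\<^sup>2 * Re (cinner x (cop_apply P x))"
    by (rule mult_right_mono[OF le pos])
  also have "cmod (cinner ?y (cop_apply P x)) = (norm ?y)\<^sup>2" by (simp add: cinner_norm norm_power)
  finally have "(norm ?y)\<^sup>2 * (norm ?y)\<^sup>2 \<le> (norm ?y)\<^sup>2 * (K * Re (cinner x (cop_apply P x)))"
    by (simp add: power2_eq_square algebra_simps)
  hence *: "(norm ?y)\<^sup>2 \<le> K * Re (cinner x (cop_apply P x))" if "0 < (norm ?y)\<^sup>2"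
    using that by (rule mult_left_le_imp_le)
  show ?thesis
  proof (cases "?y = 0")
    case False
    thus ?thesis by (intro *) simp
  qed simp
qed

lemma commutantI: "(\<And>S. S \<in> C \<Longrightarrow> S * T = T * S) \<Longrightarrow> T \<in> commutant C"
  by (simp add: commutant_def)

lemma commutantD: "T \<in> commutant C \<Longrightarrow> S \<in> C \<Longrightarrow> S * T = T * S"
  by (simp add: commutant_def)

text \<open>Quadratic forms converge by monotonicity. The differences \<open>U j - U i\<close> lie
  between 0 and \<open>T\<close>, so \<open>positive_cop_le_norm\<close> makes the vectors Cauchy;
  commutation relations survive strong limits.\<close>

lemma increasing_strong_limit:
  fixes U :: "nat \<Rightarrow> 'h::chilbert_space cop"
  assumes U: "\<And>n. U n \<in> commutant C" and pos: "\<And>n. positive_cop (U n)"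
    and inc: "\<And>n. U n \<preceq>\<^sub>L U (Suc n)" and le: "\<And>n. U n \<preceq>\<^sub>L T"
  shows "\<exists>V\<in>commutant C. (\<forall>x. (\<lambda>n. cop_apply (U n) x) \<longlonglongrightarrow> cop_apply V x) \<and>
    (\<forall>n. U n \<preceq>\<^sub>L V) \<and> (\<forall>W. (\<forall>n. U n \<preceq>\<^sub>L W) \<longrightarrow> V \<preceq>\<^sub>L W)"
proof -
  obtain K where K: "K > 0" "\<And>x. norm (cop_apply T x) \<le> K * norm x"
    using cop_norm_bound[of T] by blast
  define q where "q = (\<lambda>x n. Re (cinner x (cop_apply (U n) x)))"
  have mono: "U i \<preceq>\<^sub>L U j" if "i \<le> j" for i j
    using that by (induction j rule: dec_induct) (auto intro: loewner_le_trans inc simp: loewner_le_iff[of "U i" "U i"])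
  have q_mono: "q x i \<le> q x j" if "i \<le> j" for x i j
    using mono[OF that] by (simp add: q_def loewner_le_iff)
  have q_le: "q x n \<le> Re (cinner x (cop_apply T x))" for x n
    using le[of n] by (simp add: q_def loewner_le_iff)
  have diff: "(norm (cop_apply (U j) x - cop_apply (U i) x))\<^sup>2 \<le> K * (q x j - q x i)" if "i \<le> j" for i j x
  proof -
    have "positive_cop (U j - U i)" using mono[OF that] by (simp add: loewner_le_def)
    moreover have "U j - U i \<preceq>\<^sub>L T"
      using le[of j] pos[of i] by (auto simp: loewner_le_iff positive_cop_iff cinner_diff_right)
        (smt (verit))
    ultimately show ?thesis
      using positive_cop_le_norm[of "U j - U i" T K x] K by (simp add: q_def cinner_diff_right)
  qed
  have "convergent (\<lambda>n. cop_apply (U n) x)" for x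
  proof -
    have "convergent (q x)"
    proof (rule Bseq_mono_convergent)
      show "Bseq (q x)"
      proof (rule BseqI'[where K = "\<bar>q x 0\<bar> + \<bar>Re (cinner x (cop_apply T x))\<bar>"])
        fix n show "norm (q x n) \<le> \<bar>q x 0\<bar> + \<bar>Re (cinner x (cop_apply T x))\<bar>"
          using q_mono[of 0 n x] q_le[of x n] unfolding real_norm_def by linarith
      qed
    qed (use q_mono in auto)
    hence cauchy: "Cauchy (q x)" by (simp add: Cauchy_convergent_iff)
    have "Cauchy (\<lambda>n. cop_apply (U n) x)"
    proof (rule CauchyI')
      fix e :: real assume e: "e > 0"
      have "e\<^sup>2 / K > 0" using e K by simp
      then obtain M where M: "\<And>i j. i \<ge> M \<Longrightarrow> j \<ge> M \<Longrightarrow> norm (q x i - q x j) < e\<^sup>2 / K"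
        using CauchyD[OF cauchy] by blast
      show "\<exists>M. \<forall>i\<ge>M. \<forall>j>i. dist (cop_apply (U i) x) (cop_apply (U j) x) < e"
        unfolding dist_norm
      proof (intro exI[of _ M] allI impI)
        fix i j assume ij: "i \<ge> M" "j > i"
        have "(norm (cop_apply (U i) x - cop_apply (U j) x))\<^sup>2 \<le> K * (q x j - q x i)"
          using diff[of i j x] ij by (simp add: norm_minus_commute)
        also have "\<dots> < K * (e\<^sup>2 / K)" using M[of j i] ij K by (intro mult_strict_left_mono) auto
        finally show "norm (cop_apply (U i) x - cop_apply (U j) x) < e"
          using e K by (simp add: power2_less_imp_less)
      qed
    qed
    thus ?thesis by (rule Cauchy_convergent)
  qed
  hence lim: "(\<lambda>n. cop_apply (U n) x) \<longlonglongrightarrow> lim (\<lambda>n. cop_apply (U n) x)" for x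
    by (simp add: convergent_LIMSEQ_iff)
  define f where "f = (\<lambda>x. lim (\<lambda>n. cop_apply (U n) x))"
  have f: "(\<lambda>n. cop_apply (U n) x) \<longlonglongrightarrow> f x" for x unfolding f_def by (rule lim)
  have f_scaleC: "f (c *\<^sub>C x) = c *\<^sub>C f x" for c x
    using LIMSEQ_unique[OF f[of "c *\<^sub>C x"]] bounded_linear.tendsto[OF bounded_linear_scaleC f[of x], of c] by simp
  have "bounded_linear f"
  proof (rule bounded_linear_intro[where K = K])
    show "f (x + y) = f x + f y" for x y
      using LIMSEQ_unique[OF f[of "x + y"]] tendsto_add[OF f[of x] f[of y]] by simp
    show "f (r *\<^sub>R x) = r *\<^sub>R f x" for r x by (simp add: scaleR_scaleC f_scaleC)
    show "norm (f x) \<le> norm x * K" for x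
    proof (rule LIMSEQ_le_const2[OF tendsto_norm[OF f[of x]]], intro exI allI impI)
      fix n
      have "(norm (cop_apply (U n) x))\<^sup>2 \<le> K * q x n"
        using positive_cop_le_norm[OF pos le K(2)] by (simp add: q_def)
      also have "\<dots> \<le> K * (norm x * (K * norm x))"
      proof (rule mult_left_mono)
        have "q x n \<le> cmod (cinner x (cop_apply T x))"
          using q_le complex_Re_le_cmod order.trans by blast
        also have "\<dots> \<le> norm x * (K * norm x)"
          using cinner_Cauchy_Schwarz K(2) by (rule order.trans[OF _ mult_left_mono]) auto
        finally show "q x n \<le> norm x * (K * norm x)" .
      qed (use K in auto)
      also have "\<dots> = (norm x * K)\<^sup>2" by (simp add: power2_eq_square)
      finally show "norm (cop_apply (U n) x) \<le> norm x * K"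
        using K by (auto intro: power2_le_imp_le)
    qed
  qed
  hence V: "cop_apply (Abs_cop f) = f" using f_scaleC by (simp add: Abs_cop_inverse)
  let ?V = "Abs_cop f"
  have conv: "(\<lambda>n. cop_apply (U n) x) \<longlonglongrightarrow> cop_apply ?V x" for x using f V by simp
  have comm: "?V \<in> commutant C"
  proof (rule commutantI, rule cop_eqI)
    fix S x assume "S \<in> C"
    hence "cop_apply S (cop_apply (U n) x) = cop_apply (U n) (cop_apply S x)" for n
      using commutantD[OF U] by (metis cop_apply_simps(4))
    hence "(\<lambda>n. cop_apply (U n) (cop_apply S x)) \<longlonglongrightarrow> cop_apply S (cop_apply ?V x)"
      using tendsto_cop_apply[OF conv[of x], of S] by simp
    thus "cop_apply (S * ?V) x = cop_apply (?V * S) x"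
      using LIMSEQ_unique[OF conv[of "cop_apply S x"]] by simp
  qed
  have convq: "(\<lambda>n. cinner x (cop_apply (U n) x)) \<longlonglongrightarrow> cinner x (cop_apply ?V x)" for x
    by (intro tendsto_cinner_right conv)
  have le_lim: "U n \<preceq>\<^sub>L ?V" for n
    unfolding loewner_le_iff
  proof (intro allI conjI)
    fix x
    have "Im (cinner x (cop_apply (U m) x)) = 0" for m using pos by (simp add: positive_cop_iff)
    thus "Im (cinner x (cop_apply (U n) x)) = Im (cinner x (cop_apply ?V x))"
      using LIMSEQ_unique[OF tendsto_Im[OF convq[of x]]] by simp
    show "Re (cinner x (cop_apply (U n) x)) \<le> Re (cinner x (cop_apply ?V x))"
      using q_mono[of n _ x]
      by (intro LIMSEQ_le_const[OF tendsto_Re[OF convq[of x]]]) (auto simp: q_def)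
  qed
  have lub: "?V \<preceq>\<^sub>L W" if W: "\<And>n. U n \<preceq>\<^sub>L W" for W
    unfolding loewner_le_iff
  proof (intro allI conjI)
    fix x
    show "Im (cinner x (cop_apply ?V x)) = Im (cinner x (cop_apply W x))"
      using le_lim[of 0] W[of 0] by (metis loewner_le_iff)
    show "Re (cinner x (cop_apply ?V x)) \<le> Re (cinner x (cop_apply W x))"
      using W by (intro LIMSEQ_le_const2[OF tendsto_Re[OF convq[of x]]]) (auto simp: loewner_le_iff)
  qed
  show ?thesis using comm conv le_lim lub by blast
qed

text \<open>By faithfulness, an increasing
  sequence on which the state converges to its supremum already has the least upper bound of the
  whole directed set as its limit.\<close>

lemma vector_state_normal:
  fixes F :: "'h::chilbert_space cop set" and \<Omega> :: 'h
  defines "\<sigma> \<equiv> \<lambda>T. cinner \<Omega> (cop_apply T \<Omega>)"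
  assumes faithful: "\<And>T. T \<in> commutant C \<Longrightarrow> positive_cop T \<Longrightarrow> \<sigma> T = 0 \<Longrightarrow> T = 0"
    and F: "F \<subseteq> {S \<in> commutant C. positive_cop S}" "F \<noteq> {}"
    and dir: "\<forall>S\<in>F. \<forall>S'\<in>F. \<exists>U\<in>F. S \<preceq>\<^sub>L U \<and> S' \<preceq>\<^sub>L U"
    and T: "T \<in> commutant C" "\<forall>S\<in>F. S \<preceq>\<^sub>L T"
    and lub: "\<forall>U\<in>commutant C. (\<forall>S\<in>F. S \<preceq>\<^sub>L U) \<longrightarrow> T \<preceq>\<^sub>L U"
  shows "Re (\<sigma> T) = (SUP S\<in>F. Re (\<sigma> S))"
proof -
  define s where "s = (SUP S\<in>F. Re (\<sigma> S))"
  have \<sigma>_mono: "Re (\<sigma> S) \<le> Re (\<sigma> S')" if "S \<preceq>\<^sub>L S'" for S S'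
    using that by (simp add: \<sigma>_def loewner_le_iff)
  have bdd: "bdd_above ((\<lambda>S. Re (\<sigma> S)) ` F)"
    using T(2) \<sigma>_mono by (auto intro!: bdd_aboveI2)
  have le_s: "Re (\<sigma> S) \<le> s" if "S \<in> F" for S
    unfolding s_def by (rule cSUP_upper[OF that bdd])
  have "\<exists>S\<in>F. s - 1 / Suc n < Re (\<sigma> S)" for n
    using less_cSUP_iff[OF F(2) bdd, of "s - 1 / Suc n"] by (simp add: s_def)
  then obtain S where S: "\<And>n. S n \<in> F" "\<And>n. s - 1 / Suc n < Re (\<sigma> (S n))" by metis
  \<comment> \<open>Directedness and dependent choice put an increasing sequence in \<open>F\<close>
    above any given sequence in \<open>F\<close>.\<close>
  have seq: "\<exists>U. \<forall>n. U n \<in> F \<and> R n \<preceq>\<^sub>L U n \<and> U n \<preceq>\<^sub>L U (Suc n)" if R: "\<And>n. R n \<in> F" for R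
  proof -
    have "\<exists>U. \<forall>n. (U n \<in> F \<and> R n \<preceq>\<^sub>L U n) \<and> U n \<preceq>\<^sub>L U (Suc n)"
    proof (rule dependent_nat_choice)
      show "\<exists>x. x \<in> F \<and> R 0 \<preceq>\<^sub>L x" using R dir by blast
      show "\<exists>y. (y \<in> F \<and> R (Suc n) \<preceq>\<^sub>L y) \<and> x \<preceq>\<^sub>L y" if "x \<in> F \<and> R n \<preceq>\<^sub>L x" for x n
        using R[of "Suc n"] dir that by blast
    qed
    thus ?thesis by blast
  qed
  obtain U where U: "\<And>n. U n \<in> F" "\<And>n. S n \<preceq>\<^sub>L U n" "\<And>n. U n \<preceq>\<^sub>L U (Suc n)"
    using seq[of S] S(1) by blast
  have UF: "U n \<in> commutant C" "positive_cop (U n)" "U n \<preceq>\<^sub>L T" for n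
    using U(1)[of n] F(1) T(2) by blast+
  obtain V where V: "V \<in> commutant C" "\<And>x. (\<lambda>n. cop_apply (U n) x) \<longlonglongrightarrow> cop_apply V x"
    "\<And>n. U n \<preceq>\<^sub>L V" "\<And>W. (\<And>n. U n \<preceq>\<^sub>L W) \<Longrightarrow> V \<preceq>\<^sub>L W"
    using increasing_strong_limit[of U C T, OF UF(1,2) U(3) UF(3)] by blast
  have \<sigma>V: "s \<le> Re (\<sigma> V)"
  proof (rule LIMSEQ_le_const2)
    show "(\<lambda>n. s - 1 / real (Suc n)) \<longlonglongrightarrow> s"
      using tendsto_diff[OF tendsto_const LIMSEQ_inverse_real_of_nat, of s] by (simp add: inverse_eq_divide)
    show "\<exists>N. \<forall>n\<ge>N. s - 1 / real (Suc n) \<le> Re (\<sigma> V)"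
      using S(2) \<sigma>_mono[OF U(2)] \<sigma>_mono[OF V(3)] by (meson less_imp_le order.trans)
  qed
  \<comment> \<open>A second increasing sequence is taken above both \<open>U\<close> and
    \<open>S'\<close>. Its limit dominates \<open>V\<close>, but its expectation is also at most
    \<open>s\<close>; faithfulness forces the two limits to coincide.\<close>
  have "S' \<preceq>\<^sub>L V" if S': "S' \<in> F" for S'
  proof -
    have "\<forall>n. \<exists>R. R \<in> F \<and> U n \<preceq>\<^sub>L R \<and> S' \<preceq>\<^sub>L R"
      using dir U(1) S' by blast
    hence "\<exists>R. \<forall>n. R n \<in> F \<and> U n \<preceq>\<^sub>L R n \<and> S' \<preceq>\<^sub>L R n" by (rule choice)
    then obtain R where R: "\<And>n. R n \<in> F" "\<And>n. U n \<preceq>\<^sub>L R n" "\<And>n. S' \<preceq>\<^sub>L R n" by blast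
    obtain U' where U': "\<And>n. U' n \<in> F" "\<And>n. R n \<preceq>\<^sub>L U' n" "\<And>n. U' n \<preceq>\<^sub>L U' (Suc n)"
      using seq[of R] R(1) by blast
    have U'F: "U' n \<in> commutant C" "positive_cop (U' n)" "U' n \<preceq>\<^sub>L T" for n
      using U'(1)[of n] F(1) T(2) by blast+
    obtain V' where V': "V' \<in> commutant C" "\<And>x. (\<lambda>n. cop_apply (U' n) x) \<longlonglongrightarrow> cop_apply V' x"
      "\<And>n. U' n \<preceq>\<^sub>L V'" "\<And>W. (\<And>n. U' n \<preceq>\<^sub>L W) \<Longrightarrow> V' \<preceq>\<^sub>L W"
      using increasing_strong_limit[of U' C T, OF U'F(1,2) U'(3) U'F(3)] by blast
    have "V \<preceq>\<^sub>L V'" using R(2) U'(2) V'(3) by (intro V(4)) (blast intro: loewner_le_trans)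
    hence pos: "positive_cop (V' - V)" by (simp add: loewner_le_def)
    have "Re (\<sigma> V') \<le> s"
    proof (rule LIMSEQ_le_const2)
      show "(\<lambda>n. Re (\<sigma> (U' n))) \<longlonglongrightarrow> Re (\<sigma> V')"
        unfolding \<sigma>_def by (intro tendsto_Re tendsto_cinner_right V')
    qed (use le_s U' in auto)
    hence "\<sigma> (V' - V) = 0"
      using \<sigma>V pos by (simp add: \<sigma>_def positive_cop_iff cinner_diff_right complex_eq_iff order.antisym)
    moreover have "V' - V \<in> commutant C"
      using V(1) V'(1) by (simp add: commutant_def algebra_simps)
    ultimately have "V' - V = 0" using faithful pos by blast
    hence "V' = V" by simp
    thus ?thesis using R(3)[of 0] U'(2)[of 0] V'(3)[of 0] loewner_le_trans by blast
  qed
  hence "T \<preceq>\<^sub>L V" using lub V(1) by blast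
  moreover have "V \<preceq>\<^sub>L T" using U(1) T(2) by (intro V(4)) auto
  moreover have "Re (\<sigma> V) \<le> s"
  proof (rule LIMSEQ_le_const2)
    show "(\<lambda>n. Re (\<sigma> (U n))) \<longlonglongrightarrow> Re (\<sigma> V)"
      unfolding \<sigma>_def by (intro tendsto_Re tendsto_cinner_right V)
  qed (use le_s U in auto)
  ultimately show ?thesis using \<sigma>V \<sigma>_mono unfolding s_def by (metis order.antisym)
qed

subsection \<open>Operators on the sequence space\<close>

lemma ell2_op_exists:
  assumes add: "\<And>x y n. F (x + y) n = F x n + F y n"
    and scaleC: "\<And>c x n. F (c *\<^sub>C x) n = c * F x n"
    and bound: "\<And>x N. L2_set (\<lambda>n. cmod (F x n)) {..<N} \<le> C * norm x"
  obtains T :: "ell2 cop" where "\<And>x n. ell2_nth (cop_apply T x) n = F x n"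
proof -
  have "summable (\<lambda>n. (cmod (F x n))\<^sup>2)" for x
  proof (rule summableI_nonneg_bounded[where x = "(C * norm x)\<^sup>2"])
    show "(\<Sum>n<N. (cmod (F x n))\<^sup>2) \<le> (C * norm x)\<^sup>2" for N
      using bound[of x N] unfolding L2_set_def by (rule sqrt_le_D)
  qed simp
  hence nth: "ell2_nth (Abs_ell2 (F x)) n = F x n" for x n
    by (simp add: Abs_ell2_inverse)
  define f where "f = (\<lambda>x. Abs_ell2 (F x))"
  have f_scaleC: "f (c *\<^sub>C x) = c *\<^sub>C f x" for c x
    by (rule ell2_eqI) (simp add: f_def nth scaleC)
  have "bounded_linear f"
  proof (rule bounded_linear_intro[where K = C])
    show "f (x + y) = f x + f y" for x y by (rule ell2_eqI) (simp add: f_def nth add)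
    show "f (r *\<^sub>R x) = r *\<^sub>R f x" for r x by (simp add: scaleR_scaleC f_scaleC)
    show "norm (f x) \<le> norm x * C" for x
      unfolding norm_ell2_def[of "f x"]
      by (rule norm_ell2_leI) (use bound in \<open>simp add: f_def nth mult.commute\<close>)
  qed
  hence "cop_apply (Abs_cop f) = f" using f_scaleC by (simp add: Abs_cop_inverse)
  thus ?thesis using that[of "Abs_cop f"] by (simp add: f_def nth)
qed

definition basis_ell2 :: "nat \<Rightarrow> ell2" where
  "basis_ell2 k = Abs_ell2 (\<lambda>n. if n = k then 1 else 0)"

lemma ell2_nth_basis [simp]: "ell2_nth (basis_ell2 k) n = (if n = k then 1 else 0)"
proof -
  have "summable (\<lambda>n. (cmod (if n = k then 1 else 0))\<^sup>2)"
    by (rule summable_finite[of "{k}"]) auto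
  thus ?thesis by (simp add: basis_ell2_def Abs_ell2_inverse)
qed

lemma cinner_basis_left: "cinner (basis_ell2 k) x = ell2_nth x k"
proof -
  have "(\<Sum>n. cnj (ell2_nth (basis_ell2 k) n) * ell2_nth x n) =
      (\<Sum>n\<in>{k}. cnj (ell2_nth (basis_ell2 k) n) * ell2_nth x n)"
    by (rule suminf_finite) auto
  thus ?thesis by (simp add: cinner_ell2_def)
qed

lemma ell2_nth_sum: "ell2_nth (sum f S) n = (\<Sum>x\<in>S. ell2_nth (f x) n)"
  by (induction S rule: infinite_finite_induct) auto

lemma ell2_partial_sums: "(\<lambda>N. \<Sum>n<N. ell2_nth x n *\<^sub>C basis_ell2 n) \<longlonglongrightarrow> x"
proof -
  define P where "P = (\<lambda>N. \<Sum>n<N. ell2_nth x n *\<^sub>C basis_ell2 n)"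
  let ?f = "\<lambda>n. (cmod (ell2_nth x n))\<^sup>2"
  have P: "ell2_nth (P N) n = (if n < N then ell2_nth x n else 0)" for N n
    by (simp add: P_def ell2_nth_sum if_distrib[of "\<lambda>z. _ * z"] cong: if_cong)
  have "norm (P N - x) = sqrt ((\<Sum>n. ?f n) - (\<Sum>n<N. ?f n))" for N
  proof -
    have "(\<Sum>n. (cmod (ell2_nth (P N - x) n))\<^sup>2) = (\<Sum>n. ?f n - (if n < N then ?f n else 0))"
      by (intro suminf_cong) (simp add: P)
    also have "\<dots> = (\<Sum>n. ?f n) - (\<Sum>n. if n < N then ?f n else 0)"
      by (intro suminf_diff[symmetric] summable_ell2_nth summable_finite[of "{..<N}"]) auto
    also have "(\<Sum>n. if n < N then ?f n else 0) = (\<Sum>n<N. ?f n)"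
      by (subst suminf_finite[of "{..<N}"]) auto
    finally show ?thesis by (simp add: norm_ell2_def)
  qed
  moreover have "(\<lambda>N. sqrt ((\<Sum>n. ?f n) - (\<Sum>n<N. ?f n))) \<longlonglongrightarrow> sqrt ((\<Sum>n. ?f n) - (\<Sum>n. ?f n))"
    by (intro tendsto_intros summable_LIMSEQ summable_ell2_nth)
  ultimately have "(\<lambda>N. norm (P N - x)) \<longlonglongrightarrow> 0" by simp
  hence "P \<longlonglongrightarrow> x" by (simp add: tendsto_norm_zero_iff LIM_zero_iff)
  thus ?thesis by (simp add: P_def)
qed

lemma cop_eq_0I_ell2:
  assumes "\<And>n. cop_apply T (basis_ell2 n) = 0"
  shows "T = (0 :: ell2 cop)"
proof (rule cop_eqI)
  fix x
  have "(\<lambda>N. cop_apply T (\<Sum>n<N. ell2_nth x n *\<^sub>C basis_ell2 n)) \<longlonglongrightarrow> cop_apply T x"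
    by (intro tendsto_cop_apply ell2_partial_sums)
  hence "(\<lambda>N. 0) \<longlonglongrightarrow> cop_apply T x" by (simp add: cop_apply_sum assms)
  thus "cop_apply T x = cop_apply 0 x" by (simp add: LIMSEQ_const_iff)
qed

lemma is_adjointI_basis:
  assumes "\<And>y n. ell2_nth (cop_apply S y) n = cinner (cop_apply T (basis_ell2 n)) y"
  shows "is_adjoint T (S :: ell2 cop)"
  unfolding is_adjoint_def
proof (intro allI)
  fix x y
  have "cinner (cop_apply T (\<Sum>n<N. ell2_nth x n *\<^sub>C basis_ell2 n)) y = cinner (\<Sum>n<N. ell2_nth x n *\<^sub>C basis_ell2 n) (cop_apply S y)" for N
    by (simp add: cop_apply_sum cinner_sum_left cinner_scaleC_left cinner_basis_left assms)
  moreover have "(\<lambda>N. cinner (cop_apply T (\<Sum>n<N. ell2_nth x n *\<^sub>C basis_ell2 n)) y) \<longlonglongrightarrow> cinner (cop_apply T x) y"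
    by (intro tendsto_cinner_left tendsto_cop_apply ell2_partial_sums)
  moreover have "(\<lambda>N. cinner (\<Sum>n<N. ell2_nth x n *\<^sub>C basis_ell2 n) (cop_apply S y)) \<longlonglongrightarrow> cinner x (cop_apply S y)"
    by (intro tendsto_cinner_left ell2_partial_sums)
  ultimately show "cinner (cop_apply T x) y = cinner x (cop_apply S y)"
    using LIMSEQ_unique by simp
qed

lemma is_adjoint_commute: "is_adjoint S T \<longleftrightarrow> is_adjoint T S"
  unfolding is_adjoint_def by (metis cinner_commute)

text \<open>The coordinates of the adjoint at \<open>y\<close> are prescribed. They are square
  summable because testing \<open>T\<close> on their own truncation \<open>v\<close> yields the
  squared norm of \<open>v\<close>, which is at most K times the norms of \<open>v\<close> and
  \<open>y\<close>.\<close>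

lemma adjoint_exists_ell2: obtains S :: "ell2 cop" where "is_adjoint S T"
proof -
  obtain K where K: "K > 0" "\<And>x. norm (cop_apply T x) \<le> K * norm x"
    using cop_norm_bound[of T] by blast
  let ?F = "\<lambda>y n. cinner (cop_apply T (basis_ell2 n)) y"
  have bound: "L2_set (\<lambda>n. cmod (?F y n)) {..<N} \<le> K * norm y" for y N
  proof -
    define v where "v = (\<Sum>n<N. ?F y n *\<^sub>C basis_ell2 n)"
    define l where "l = L2_set (\<lambda>n. cmod (?F y n)) {..<N}"
    have l2: "l\<^sup>2 = (\<Sum>n<N. (cmod (?F y n))\<^sup>2)" by (simp add: l_def L2_set_def sum_nonneg)
    have sum: "(\<Sum>n<N. cnj (?F y n) * ?F y n) = complex_of_real (l\<^sup>2)"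
      unfolding l2 of_real_sum
      by (intro sum.cong refl) (metis complex_norm_square mult.commute of_real_power)
    have "cinner v v = complex_of_real (l\<^sup>2)"
      unfolding sum[symmetric]
      by (simp add: v_def cinner_sum_left cinner_scaleC_left cinner_basis_left ell2_nth_sum
          if_distrib[of "\<lambda>z. _ * z"] cong: if_cong)
    hence "(norm v)\<^sup>2 = l\<^sup>2" by (metis cinner_norm of_real_eq_iff)
    hence v: "norm v = l" by (simp add: l_def)
    have "cinner (cop_apply T v) y = complex_of_real (l\<^sup>2)"
      unfolding sum[symmetric] by (simp add: v_def cop_apply_sum cinner_sum_left cinner_scaleC_left)
    hence "l\<^sup>2 = cmod (cinner (cop_apply T v) y)" by (simp add: norm_power)
    also have "\<dots> \<le> norm (cop_apply T v) * norm y" by (rule cinner_Cauchy_Schwarz)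
    also have "\<dots> \<le> K * l * norm y" using K(2)[of v] v by (intro mult_right_mono) auto
    finally have "l * l \<le> l * (K * norm y)" by (simp add: power2_eq_square algebra_simps)
    moreover have "0 \<le> l" by (simp add: l_def)
    ultimately show ?thesis using K(1) unfolding l_def[symmetric] by (cases "l = 0") auto
  qed
  obtain S where S: "\<And>y n. ell2_nth (cop_apply S y) n = ?F y n"
    by (rule ell2_op_exists[of ?F K]) (auto simp: cinner_add_right cinner_scaleC_right bound)
  show ?thesis using that is_adjointI_basis[of S T] S is_adjoint_commute by blast
qed

lemma is_adjoint_mult:
  "is_adjoint S T \<Longrightarrow> is_adjoint S' T' \<Longrightarrow> is_adjoint (S * S') (T' * T)"
  by (simp add: is_adjoint_def)

lemma is_adjoint_unique: "is_adjoint S T \<Longrightarrow> is_adjoint S T' \<Longrightarrow> T = T'"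
  unfolding is_adjoint_def by (intro cop_eqI cinner_eqI) metis

lemma commutant_antimono: "A \<subseteq> B \<Longrightarrow> commutant B \<subseteq> commutant A"
  by (auto simp: commutant_def)

lemma subset_bicommutant: "A \<subseteq> commutant (commutant A)"
  by (auto simp: commutant_def)

lemma triple_commutant: "commutant (commutant (commutant A)) = commutant A"
  by (intro equalityI commutant_antimono subset_bicommutant)

text \<open>The bicommutant of one operator is contained in its commutant, hence is commutative, and
  every vector state on it is tracial. For positive \<open>T\<close>, Cauchy-Schwarz turns a
  vanishing expectation into \<open>T\<close> annihilating \<open>\<Omega>\<close>, so a separating
  vector gives a faithful state.\<close>

theorem tracial_ncps_bicommutant:
  fixes Y :: "ell2 cop" and \<Omega> :: ell2
  assumes Y: "selfadjoint Y" and \<Omega>: "norm \<Omega> = 1"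
    and separating: "\<And>T. T \<in> commutant (commutant {Y}) \<Longrightarrow> cop_apply T \<Omega> = 0 \<Longrightarrow> T = 0"
  shows "tracial_ncps (commutant (commutant {Y})) (\<lambda>T. cinner \<Omega> (cop_apply T \<Omega>))"
proof -
  let ?B = "commutant (commutant {Y})"
  have adj: "T' \<in> commutant {Y}" if T: "T \<in> commutant {Y}" and T': "is_adjoint T' T" for T T'
  proof (rule commutantI)
    fix S assume "S \<in> {Y}"
    hence S: "S = Y" by simp
    have "Y * T = T * Y" using T by (simp add: commutant_def)
    moreover have "is_adjoint (T' * Y) (Y * T)" "is_adjoint (Y * T') (T * Y)"
      using T' Y by (simp_all add: is_adjoint_mult selfadjoint_def)
    ultimately have "T' * Y = Y * T'" by (metis is_adjoint_commute is_adjoint_unique)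
    thus "S * T' = T' * S" by (simp add: S)
  qed
  have adj2: "T' \<in> ?B" if T: "T \<in> ?B" and T': "is_adjoint T' T" for T T'
  proof (rule commutantI)
    fix S assume S: "S \<in> commutant {Y}"
    obtain S' where S': "is_adjoint S' S" by (rule adjoint_exists_ell2)
    have "S' \<in> commutant {Y}" by (rule adj[OF S S'])
    hence "S' * T = T * S'" using T by (simp add: commutant_def)
    moreover have "is_adjoint (T' * S) (S' * T)" "is_adjoint (S * T') (T * S')"
      using T' S' by (simp_all add: is_adjoint_mult is_adjoint_commute)
    ultimately show "S * T' = T' * S" by (metis is_adjoint_commute is_adjoint_unique)
  qed
  have vN: "von_neumann_algebra ?B"
    unfolding von_neumann_algebra_def
  proof (intro conjI ballI)
    fix T assume T: "T \<in> ?B"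
    obtain S where S: "is_adjoint S T" by (rule adjoint_exists_ell2)
    show "\<exists>S\<in>?B. is_adjoint S T" using adj2[OF T S] S by blast
  qed (simp add: triple_commutant)
  have Y_comm: "?B \<subseteq> commutant {Y}" by (rule commutant_antimono) (simp add: commutant_def)
  have faithful: "T = 0" if T: "T \<in> ?B" "positive_cop T" "cinner \<Omega> (cop_apply T \<Omega>) = 0" for T
  proof (rule separating[OF T(1)], rule cinner_eqI)
    fix z
    have "(cmod (cinner z (cop_apply T \<Omega>)))\<^sup>2 \<le> 0"
      using positive_cop_Cauchy_Schwarz[OF T(2), of z \<Omega>] T(3) by simp
    thus "cinner z (cop_apply T \<Omega>) = cinner z 0" by simp
  qed
  show ?thesis
  proof
    show "von_neumann_algebra ?B" by (rule vN)
    show "cinner \<Omega> (cop_apply 1 \<Omega>) = 1" using \<Omega> by (simp add: cinner_norm)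
    show "cinner \<Omega> (cop_apply T \<Omega>) \<in> \<real>\<^sub>\<ge>\<^sub>0" if "positive_cop T" for T
      using that by (simp add: positive_cop_def)
    show "cinner \<Omega> (cop_apply (S * T) \<Omega>) = cinner \<Omega> (cop_apply (T * S) \<Omega>)"
      if "S \<in> ?B" "T \<in> ?B" for S T
    proof -
      have "S * T = T * S" using that Y_comm commutantD by blast
      thus ?thesis by simp
    qed
    show "Re (cinner \<Omega> (cop_apply T \<Omega>)) = (SUP S\<in>F. Re (cinner \<Omega> (cop_apply S \<Omega>)))"
      if "F \<subseteq> {S \<in> ?B. positive_cop S}" "F \<noteq> {}"
        "\<forall>S\<in>F. \<forall>S'\<in>F. \<exists>U\<in>F. S \<preceq>\<^sub>L U \<and> S' \<preceq>\<^sub>L U"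
        "T \<in> ?B" "\<forall>S\<in>F. S \<preceq>\<^sub>L T" "\<forall>U\<in>?B. (\<forall>S\<in>F. S \<preceq>\<^sub>L U) \<longrightarrow> T \<preceq>\<^sub>L U" for F T
      using faithful that by (rule vector_state_normal)
  qed (use faithful in \<open>simp_all add: cinner_add_right cinner_scaleC_right\<close>)
qed

section \<open>The moment problem on the sequence space\<close>

subsection \<open>Jacobi operators\<close>

text \<open>Each diagonal of a Jacobi matrix is a weighted reindexing of coordinates. Injectivity is
  asked only where the weight is nonzero, as \<open>n - 1\<close> sends both 0 and 1 to 0.\<close>

lemma L2_set_reindex_le_norm_ell2:
  fixes w :: "nat \<Rightarrow> real" and g :: "nat \<Rightarrow> nat"
  assumes inj: "inj_on g {n. w n \<noteq> 0}" and w: "\<And>n. \<bar>w n\<bar> \<le> C"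
  shows "L2_set (\<lambda>n. cmod (complex_of_real (w n) * ell2_nth x (g n))) {..<N} \<le> C * norm x"
proof -
  have C: "0 \<le> C" using w[of 0] by linarith
  let ?S = "{n \<in> {..<N}. w n \<noteq> 0}"
  have "(\<Sum>n<N. (cmod (complex_of_real (w n) * ell2_nth x (g n)))\<^sup>2) =
      (\<Sum>n\<in>?S. (cmod (complex_of_real (w n) * ell2_nth x (g n)))\<^sup>2)"
    by (rule sum.mono_neutral_right) auto
  also have "\<dots> \<le> (\<Sum>n\<in>?S. C\<^sup>2 * (cmod (ell2_nth x (g n)))\<^sup>2)"
  proof (intro sum_mono)
    fix n
    have "(w n)\<^sup>2 \<le> C\<^sup>2" using w[of n] C by (simp add: abs_le_square_iff[symmetric])
    thus "(cmod (complex_of_real (w n) * ell2_nth x (g n)))\<^sup>2 \<le> C\<^sup>2 * (cmod (ell2_nth x (g n)))\<^sup>2"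
      by (simp add: norm_mult power_mult_distrib mult_right_mono)
  qed
  also have "\<dots> = C\<^sup>2 * (\<Sum>k\<in>g ` ?S. (cmod (ell2_nth x k))\<^sup>2)"
    using inj_on_subset[OF inj, of ?S] by (subst sum.reindex) (auto simp: sum_distrib_left)
  also have "(\<Sum>k\<in>g ` ?S. (cmod (ell2_nth x k))\<^sup>2) \<le> (\<Sum>k. (cmod (ell2_nth x k))\<^sup>2)"
    by (intro sum_le_suminf summable_ell2_nth) auto
  also have "C\<^sup>2 * \<dots> = (C * norm x)\<^sup>2"
    by (simp add: norm_ell2_def power_mult_distrib suminf_nonneg summable_ell2_nth)
  finally have "(\<Sum>n<N. (cmod (complex_of_real (w n) * ell2_nth x (g n)))\<^sup>2) \<le> (C * norm x)\<^sup>2"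
    by (simp add: mult_left_mono)
  thus ?thesis unfolding L2_set_def using C by (intro real_le_lsqrt) (auto intro: sum_nonneg)
qed

lemma jacobi_operator_exists:
  fixes a c :: "nat \<Rightarrow> real"
  assumes a: "\<And>n. \<bar>a n\<bar> \<le> C" and c: "\<And>n. \<bar>c n\<bar> \<le> C" and c0: "c 0 = 0"
  obtains Y :: "ell2 cop" where "\<And>x n. ell2_nth (cop_apply Y x) n =
    of_real (a n) * ell2_nth x n + of_real (c (Suc n)) * ell2_nth x (Suc n) + of_real (c n) * ell2_nth x (n - 1)"
proof (rule ell2_op_exists[of "\<lambda>x n. complex_of_real (a n) * ell2_nth x n +
    of_real (c (Suc n)) * ell2_nth x (Suc n) + of_real (c n) * ell2_nth x (n - 1)" "3 * C"])
  fix x :: ell2 and N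
  let ?f1 = "\<lambda>n. cmod (complex_of_real (a n) * ell2_nth x n)"
  let ?f2 = "\<lambda>n. cmod (complex_of_real (c (Suc n)) * ell2_nth x (Suc n))"
  let ?f3 = "\<lambda>n. cmod (complex_of_real (c n) * ell2_nth x (n - 1))"
  have "L2_set (\<lambda>n. cmod (complex_of_real (a n) * ell2_nth x n +
      of_real (c (Suc n)) * ell2_nth x (Suc n) + of_real (c n) * ell2_nth x (n - 1))) {..<N}
    \<le> L2_set (\<lambda>n. ?f1 n + ?f2 n + ?f3 n) {..<N}"
    by (intro L2_set_mono) (auto intro: norm_triangle_mono norm_triangle_ineq)
  also have "\<dots> \<le> L2_set (\<lambda>n. ?f1 n + ?f2 n) {..<N} + L2_set ?f3 {..<N}"
    by (rule L2_set_triangle_ineq)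
  also have "\<dots> \<le> L2_set ?f1 {..<N} + L2_set ?f2 {..<N} + L2_set ?f3 {..<N}"
    by (intro add_right_mono L2_set_triangle_ineq)
  also have "\<dots> \<le> C * norm x + C * norm x + C * norm x"
  proof (intro add_mono)
    have "inj_on (\<lambda>n. n - 1) {n. c n \<noteq> 0}"
    proof (rule inj_onI)
      fix m n assume "m \<in> {n. c n \<noteq> 0}" "n \<in> {n. c n \<noteq> 0}" "m - 1 = n - 1"
      thus "m = n" using c0 by (cases m; cases n) auto
    qed
    thus "L2_set ?f3 {..<N} \<le> C * norm x" using c by (rule L2_set_reindex_le_norm_ell2)
    show "L2_set ?f1 {..<N} \<le> C * norm x"
      by (rule L2_set_reindex_le_norm_ell2) (use a in \<open>auto simp: inj_on_def\<close>)
    show "L2_set ?f2 {..<N} \<le> C * norm x"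
      by (rule L2_set_reindex_le_norm_ell2) (use c in \<open>auto simp: inj_on_def\<close>)
  qed
  finally show "L2_set (\<lambda>n. cmod (complex_of_real (a n) * ell2_nth x n +
      of_real (c (Suc n)) * ell2_nth x (Suc n) + of_real (c n) * ell2_nth x (n - 1))) {..<N} \<le> 3 * C * norm x"
    by simp
qed (auto simp: algebra_simps)

lemma shift_operator_exists:
  obtains V :: "ell2 cop" where "\<And>x n. ell2_nth (cop_apply V x) n = (if n < d then 0 else ell2_nth x (n - d))"
proof (rule ell2_op_exists[of "\<lambda>x n. if n < d then 0 else ell2_nth x (n - d)" 1])
  fix x :: ell2 and N
  have "L2_set (\<lambda>n. cmod (complex_of_real (if n < d then 0 else 1) * ell2_nth x (n - d))) {..<N} \<le> 1 * norm x"
    by (rule L2_set_reindex_le_norm_ell2) (auto simp: inj_on_def)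
  moreover have "complex_of_real (if n < d then 0 else 1) * ell2_nth x (n - d) =
      (if n < d then 0 else ell2_nth x (n - d))" for n by simp
  ultimately show "L2_set (\<lambda>n. cmod (if n < d then 0 else ell2_nth x (n - d))) {..<N} \<le> 1 * norm x"
    by (simp only:)
qed auto

locale jacobi =
  fixes a c :: "nat \<Rightarrow> real" and Y :: "ell2 cop"
  assumes c0: "c 0 = 0"
    and nth_Y: "ell2_nth (cop_apply Y x) n =
      of_real (a n) * ell2_nth x n + of_real (c (Suc n)) * ell2_nth x (Suc n) + of_real (c n) * ell2_nth x (n - 1)"
begin

lemma Y_basis: "cop_apply Y (basis_ell2 n) =
  of_real (a n) *\<^sub>C basis_ell2 n + of_real (c (Suc n)) *\<^sub>C basis_ell2 (Suc n) + of_real (c n) *\<^sub>C basis_ell2 (n - 1)"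
proof (rule ell2_eqI)
  fix k
  show "ell2_nth (cop_apply Y (basis_ell2 n)) k = ell2_nth (of_real (a n) *\<^sub>C basis_ell2 n +
      of_real (c (Suc n)) *\<^sub>C basis_ell2 (Suc n) + of_real (c n) *\<^sub>C basis_ell2 (n - 1)) k"
    using c0 by (cases n; cases k) (auto simp: nth_Y)
qed

lemma selfadjoint_Y: "selfadjoint Y"
  unfolding selfadjoint_def
  by (rule is_adjointI_basis) (simp add: Y_basis nth_Y cinner_add_left cinner_scaleC_left cinner_basis_left)

text \<open>Periodicity forces \<open>c d = c 0 = 0\<close>, so the matrix decouples at multiples of
  \<open>d\<close> and the shift carries each block to an identical copy.\<close>

lemma shift_commutes:
  assumes period: "\<And>n. a (n + d) = a n" "\<And>n. c (n + d) = c n" and d: "d > 0"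
  obtains V where "V \<in> commutant {Y}" "cop_apply V (basis_ell2 0) = basis_ell2 d"
proof -
  obtain V :: "ell2 cop" where V: "\<And>x n. ell2_nth (cop_apply V x) n = (if n < d then 0 else ell2_nth x (n - d))"
    using shift_operator_exists[of d] by blast
  have "Y * V = V * Y"
  proof (intro cop_eqI ell2_eqI)
    fix x n
    have cd: "c d = 0" using period(2)[of 0] c0 by simp
    show "ell2_nth (cop_apply (Y * V) x) n = ell2_nth (cop_apply (V * Y) x) n"
    proof (cases "n < d")
      case True
      thus ?thesis using cd by (cases "Suc n = d") (auto simp: V nth_Y)
    next
      case False
      then obtain k where n: "n = k + d" using le_Suc_ex[of d n] by (auto simp: add.commute)
      show ?thesis
        using period(1)[of k] period(2)[of k] period(2)[of "Suc k"] c0 d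
        by (cases k) (auto simp: n V nth_Y Suc_diff_le)
    qed
  qed
  hence "V \<in> commutant {Y}" by (simp add: commutant_def)
  moreover have "cop_apply V (basis_ell2 0) = basis_ell2 d"
    by (rule ell2_eqI) (auto simp: V)
  ultimately show ?thesis by (rule that)
qed

text \<open>Where an off-diagonal weight vanishes, the operator decouples. The basis vector \<open>0\<close> is still
  separating for the bicommutant if the blocks are copies of each other.\<close>

lemma separating:
  assumes blocks: "\<And>n. c n = 0 \<Longrightarrow> \<exists>V\<in>commutant {Y}. cop_apply V (basis_ell2 0) = basis_ell2 n"
    and T: "T \<in> commutant (commutant {Y})" and T0: "cop_apply T (basis_ell2 0) = 0"
  shows "T = 0"
proof (rule cop_eq_0I_ell2)
  have TY: "T * Y = Y * T"
    using commutantD[OF T, of Y] by (simp add: commutant_def)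
  fix n
  show "cop_apply T (basis_ell2 n) = 0"
  proof (induction n rule: less_induct)
    case (less n)
    show ?case
    proof (cases "c n = 0")
      case True
      then obtain V where V: "V \<in> commutant {Y}" "cop_apply V (basis_ell2 0) = basis_ell2 n"
        using blocks by blast
      have "cop_apply (T * V) (basis_ell2 0) = cop_apply (V * T) (basis_ell2 0)"
        using commutantD[OF T V(1)] by simp
      thus ?thesis using V T0 by simp
    next
      case False
      then obtain k where n: "n = Suc k" using c0 by (cases n) auto
      have "cop_apply (T * Y) (basis_ell2 k) = cop_apply (Y * T) (basis_ell2 k)" using TY by simp
      hence "complex_of_real (c n) *\<^sub>C cop_apply T (basis_ell2 n) = 0"
        using less[of k] less[of "k - 1"] by (simp add: Y_basis n)
      hence "(1 / complex_of_real (c n)) *\<^sub>C complex_of_real (c n) *\<^sub>C cop_apply T (basis_ell2 n) = 0" by simp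
      thus ?thesis using False by (simp add: scaleC_scaleC scaleC_one)
    qed
  qed
qed

end

subsection \<open>Orthogonal polynomials\<close>

locale moment_sequence =
  fixes m :: "nat \<Rightarrow> real"
  assumes m0: "m 0 = 1" and psd: "0 \<le> moment_functional m (p * p)"
begin

abbreviation L :: "real poly \<Rightarrow> real" where "L \<equiv> moment_functional m"

lemmas L_linear = moment_functional_add moment_functional_diff moment_functional_smult

lemma L_Cauchy_Schwarz: "(L (p * q))\<^sup>2 \<le> L (p * p) * L (q * q)"
proof (rule quadratic_nonneg_discriminant)
  fix t
  have "0 \<le> L ((p + smult t q) * (p + smult t q))" by (rule psd)
  also have "(p + smult t q) * (p + smult t q) = p * p + smult (2 * t) (p * q) + smult (t\<^sup>2) (q * q)"
    by (simp add: poly_eq_poly_eq_iff[symmetric] fun_eq_iff algebra_simps power2_eq_square)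
  finally show "0 \<le> L (p * p) + 2 * t * L (p * q) + t\<^sup>2 * L (q * q)" by (simp add: L_linear)
qed

lemma L_null: "L (p * p) = 0 \<Longrightarrow> L (q * p) = 0"
  using L_Cauchy_Schwarz[of q p] by simp

text \<open>The monic orthogonal polynomials, defined by their three-term recurrence. Beyond a null
  vector the quotients have zero denominators and the values carry no meaning.\<close>

fun orth :: "nat \<Rightarrow> real poly" where
  "orth 0 = 1"
| "orth (Suc n) = [:- (L ([:0, 1:] * orth n * orth n) / L (orth n * orth n)), 1:] * orth n
    - (if n = 0 then 0 else smult (L (orth n * orth n) / L (orth (n - 1) * orth (n - 1))) (orth (n - 1)))"

definition h :: "nat \<Rightarrow> real" where "h n = L (orth n * orth n)"
definition \<alpha> :: "nat \<Rightarrow> real" where "\<alpha> n = L ([:0, 1:] * orth n * orth n) / h n"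
definition \<beta> :: "nat \<Rightarrow> real" where "\<beta> n = (if n = 0 then 0 else h n / h (n - 1))"
text \<open>The norm \<open>h n\<close> itself may vanish: \<open>orth n\<close> is then still well
  defined and orthogonal to its predecessors, but it is a null vector.\<close>

definition nondegenerate :: "nat \<Rightarrow> bool" where "nondegenerate n \<longleftrightarrow> (\<forall>j<n. h j \<noteq> 0)"

lemma h_0: "h 0 = 1"
  using m0 by (simp add: h_def moment_functional_def)

lemma h_nonneg: "0 \<le> h n"
  unfolding h_def by (rule psd)

lemma orth_recurrence: "[:0, 1:] * orth n = orth (Suc n) + smult (\<alpha> n) (orth n) + smult (\<beta> n) (orth (n - 1))"
  by (simp add: \<alpha>_def \<beta>_def h_def)

text \<open>Multiplication by X is symmetric for \<open>L\<close>, so L(X p_k p_j) can be expanded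
  from the side of j. For j < k - 1 every term vanishes by induction; for j = k - 1 the surviving
  h_k is cancelled by the \<open>\<beta>\<close> term, and for j = k the choice of
  \<open>\<alpha>\<close> does it.\<close>

lemma orthogonal:
  assumes "nondegenerate n" "j < n"
  shows "L (orth n * orth j) = 0"
  using assms
proof (induction n arbitrary: j rule: less_induct)
  case (less n)
  then obtain k where n: "n = Suc k" by (cases n) auto
  have h: "h i \<noteq> 0" if "i \<le> k" for i using less.prems(1) that by (simp add: nondegenerate_def n)
  have IH: "L (orth i * orth j) = 0" if "i \<le> k" "j \<le> k" "i \<noteq> j" for i j
  proof (cases "j < i")
    case True
    thus ?thesis using less.IH[of i j] less.prems(1) that by (simp add: nondegenerate_def n)
  next
    case False
    hence "L (orth j * orth i) = 0" using less.IH[of j i] less.prems(1) that by (simp add: nondegenerate_def n)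
    thus ?thesis by (simp add: mult.commute)
  qed
  have eq: "orth n * orth j = [:0, 1:] * orth k * orth j - smult (\<alpha> k) (orth k * orth j) - smult (\<beta> k) (orth (k - 1) * orth j)"
    using arg_cong[OF orth_recurrence[of k], of "\<lambda>p. p * orth j"] unfolding n by (simp only: algebra_simps mult_smult_left) simp
  have L_eq: "L (orth n * orth j) =
      L ([:0, 1:] * orth k * orth j) - \<alpha> k * L (orth k * orth j) - \<beta> k * L (orth (k - 1) * orth j)"
    unfolding eq by (simp only: L_linear)
  consider "j = k" | "j < k" using less.prems(2) n by linarith
  thus ?case
  proof cases
    case 1
    have "\<beta> k * L (orth (k - 1) * orth k) = 0"
      using IH[of "k - 1" k] by (cases "k = 0") (auto simp: \<beta>_def)
    moreover have "L ([:0, 1:] * orth k * orth k) = \<alpha> k * h k" using h[of k] by (simp add: \<alpha>_def)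
    ultimately show ?thesis using L_eq unfolding 1 h_def by linarith
  next
    case 2
    have "[:0, 1:] * orth k * orth j = ([:0, 1:] * orth j) * orth k" by (simp only: mult.commute mult.left_commute)
    also have "L \<dots> = L (orth (Suc j) * orth k) + \<alpha> j * L (orth j * orth k) + \<beta> j * L (orth (j - 1) * orth k)"
      unfolding orth_recurrence by (simp add: L_linear distrib_right mult_smult_left)
    also have "\<dots> = L (orth (Suc j) * orth k)"
      using IH[of j k] IH[of "j - 1" k] 2 by simp
    finally have 3: "L ([:0, 1:] * orth k * orth j) = L (orth (Suc j) * orth k)" .
    have "L (orth (Suc j) * orth k) = \<beta> k * L (orth (k - 1) * orth j)"
    proof (cases "Suc j = k")
      case True
      thus ?thesis using h[of j] by (auto simp: \<beta>_def h_def)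
    next
      case False
      thus ?thesis using IH[of "Suc j" k] IH[of "k - 1" j] 2 by auto
    qed
    moreover have "\<alpha> k * L (orth k * orth j) = 0" using IH[of k j] 2 by simp
    ultimately show ?thesis using L_eq 3 by linarith
  qed
qed

end

locale bounded_moment_sequence = moment_sequence +
  fixes K C :: real
  assumes growth: "\<bar>m k\<bar> \<le> K * C ^ k" and C: "C > 0"
begin

text \<open>By Cauchy-Schwarz the numbers L(X^(2 j) q^2) are log-convex in j. If the first ratio
  exceeded C^2, all later ones would too, and the sequence would outgrow the bound of order C^(2 j)
  that the moments impose.\<close>

lemma L_shift_le: "L (([:0, 1:] * q) * ([:0, 1:] * q)) \<le> C\<^sup>2 * L (q * q)"
proof -
  define x :: "real poly" where "x = [:0, 1:]"
  define s where "s = (\<lambda>j. L (x ^ j * q * (x ^ j * q)))"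
  have s_nonneg: "0 \<le> s j" for j unfolding s_def by (rule psd)
  have logconvex: "(s (Suc j))\<^sup>2 \<le> s j * s (Suc (Suc j))" for j
  proof -
    have eq: "x ^ Suc j * q * (x ^ Suc j * q) = x ^ j * q * (x ^ Suc (Suc j) * q)" by (simp add: mult_ac)
    show ?thesis unfolding s_def eq by (rule L_Cauchy_Schwarz)
  qed
  have s_le: "\<exists>M. \<forall>j. s j \<le> M * (C\<^sup>2) ^ j"
  proof -
    have shift: "L (x ^ i * p) = (\<Sum>k\<le>degree p. coeff p k * m (k + i))" for i p
    proof -
      have "L (x ^ i * p) = moment_functional (\<lambda>k. m (k + i)) p"
      proof (induction i arbitrary: p)
        case (Suc i)
        have "x ^ Suc i * p = x ^ i * pCons 0 p" by (simp add: x_def)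
        thus ?case by (simp only: Suc moment_functional_pCons) simp
      qed simp
      thus ?thesis by (simp add: moment_functional_def)
    qed
    have "s j \<le> (\<Sum>k\<le>degree (q * q). \<bar>coeff (q * q) k\<bar> * (K * C ^ k)) * (C\<^sup>2) ^ j" for j
    proof -
      have "x ^ j * q * (x ^ j * q) = x ^ (2 * j) * (q * q)"
        by (simp only: power_add mult_2) (simp only: mult_ac)
      hence "s j = (\<Sum>k\<le>degree (q * q). coeff (q * q) k * m (k + 2 * j))"
        unfolding s_def by (simp only: shift)
      also have "\<dots> \<le> (\<Sum>k\<le>degree (q * q). \<bar>coeff (q * q) k\<bar> * (K * C ^ (k + 2 * j)))"
      proof (rule sum_mono)
        fix k
        have "coeff (q * q) k * m (k + 2 * j) \<le> \<bar>coeff (q * q) k\<bar> * \<bar>m (k + 2 * j)\<bar>"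
          by (simp flip: abs_mult)
        also have "\<dots> \<le> \<bar>coeff (q * q) k\<bar> * (K * C ^ (k + 2 * j))"
          by (intro mult_left_mono growth) auto
        finally show "coeff (q * q) k * m (k + 2 * j) \<le> \<bar>coeff (q * q) k\<bar> * (K * C ^ (k + 2 * j))" .
      qed
      also have "\<dots> = (\<Sum>k\<le>degree (q * q). \<bar>coeff (q * q) k\<bar> * (K * C ^ k)) * (C\<^sup>2) ^ j"
        by (simp add: sum_distrib_right power_add power_mult mult.assoc)
      finally show ?thesis .
    qed
    thus ?thesis by blast
  qed
  then obtain M where M: "\<And>j. s j \<le> M * (C\<^sup>2) ^ j" by blast
  have "s 1 \<le> C\<^sup>2 * s 0"
  proof (rule ccontr)
    assume "\<not> s 1 \<le> C\<^sup>2 * s 0"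
    hence gt: "C\<^sup>2 * s 0 < s 1" by simp
    have s0: "s 0 > 0"
    proof (rule ccontr)
      assume "\<not> s 0 > 0"
      hence "s 0 = 0" using s_nonneg[of 0] by simp
      thus False using logconvex[of 0] gt by simp
    qed
    define r where "r = s 1 / s 0"
    have r: "r > C\<^sup>2" "r > 0" using gt s0 C by (auto simp: r_def field_simps intro: le_less_trans[rotated])
    have step: "s j > 0 \<and> r * s j \<le> s (Suc j)" for j
    proof (induction j)
      case 0
      thus ?case using s0 by (simp add: r_def)
    next
      case (Suc j)
      hence pos: "s (Suc j) > 0" using r by (metis less_le_trans mult_pos_pos)
      have "s j * (r * s (Suc j)) \<le> s (Suc j) * s (Suc j)"
        using Suc pos by (simp add: mult_right_mono mult.commute mult.left_commute)
      also have "\<dots> \<le> s j * s (Suc (Suc j))" using logconvex[of j] by (simp add: power2_eq_square)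
      finally show ?case using Suc pos by simp
    qed
    have lower: "r ^ j * s 0 \<le> s j" for j
    proof (induction j)
      case (Suc j)
      have "r ^ Suc j * s 0 = r * (r ^ j * s 0)" by simp
      also have "\<dots> \<le> r * s j" using Suc r by (intro mult_left_mono) auto
      also have "\<dots> \<le> s (Suc j)" using step by blast
      finally show ?case .
    qed simp
    have "r / C\<^sup>2 > 1" using r C by (simp add: field_simps)
    then obtain j where j: "M / s 0 < (r / C\<^sup>2) ^ j" using real_arch_pow by blast
    have "r ^ j * s 0 \<le> M * (C\<^sup>2) ^ j" using lower M order.trans by blast
    hence "(r / C\<^sup>2) ^ j \<le> M / s 0" using s0 C by (simp add: power_divide field_simps)
    thus False using j by simp
  qed
  thus ?thesis by (simp add: s_def x_def)
qed

lemma recurrence_norm: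
  assumes "nondegenerate n"
  shows "L (([:0, 1:] * orth n) * ([:0, 1:] * orth n)) = L (orth (Suc n) * orth (Suc n)) + (\<alpha> n)\<^sup>2 * h n + (\<beta> n)\<^sup>2 * h (n - 1)
      + 2 * \<alpha> n * L (orth (Suc n) * orth n) + 2 * \<beta> n * L (orth (Suc n) * orth (n - 1))"
proof -
  have 0: "\<beta> n * L (orth n * orth (n - 1)) = 0"
    using orthogonal[OF assms, of "n - 1"] by (cases "n = 0") (auto simp: \<beta>_def)
  have "(p + smult a q + smult b r) * (p + smult a q + smult b r) =
      p * p + smult (a\<^sup>2) (q * q) + smult (b\<^sup>2) (r * r) + smult (2 * a) (p * q) + smult (2 * b) (p * r) + smult (2 * a * b) (q * r)"
    for p q r :: "real poly" and a b
    by (simp add: poly_eq_poly_eq_iff[symmetric] fun_eq_iff algebra_simps power2_eq_square)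
  thus ?thesis unfolding orth_recurrence using 0 by (simp add: L_linear h_def)
qed

text \<open>Pythagoras: X times \<open>orth n\<close> is a sum of three orthogonal terms of total
  squared norm at most C^2 h_n, and each term alone obeys this bound.\<close>

lemma coefficient_bounds:
  assumes "nondegenerate (Suc n)"
  shows "\<bar>\<alpha> n\<bar> \<le> C" "\<beta> (Suc n) \<le> C\<^sup>2"
proof -
  have nd: "nondegenerate n" using assms by (auto simp: nondegenerate_def)
  have hn: "h n > 0" using assms h_nonneg[of n] by (simp add: nondegenerate_def order.not_eq_order_implies_strict)
  have "L (orth (Suc n) * orth n) = 0" "L (orth (Suc n) * orth (n - 1)) = 0"
    by (intro orthogonal[OF assms]; simp)+
  hence "h (Suc n) + (\<alpha> n)\<^sup>2 * h n + (\<beta> n)\<^sup>2 * h (n - 1) = L (([:0, 1:] * orth n) * ([:0, 1:] * orth n))"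
    using recurrence_norm[OF nd] by (simp add: h_def)
  also have "\<dots> \<le> C\<^sup>2 * h n" unfolding h_def by (rule L_shift_le)
  finally have le: "h (Suc n) + (\<alpha> n)\<^sup>2 * h n + (\<beta> n)\<^sup>2 * h (n - 1) \<le> C\<^sup>2 * h n" .
  have nonneg: "0 \<le> (\<alpha> n)\<^sup>2 * h n" "0 \<le> (\<beta> n)\<^sup>2 * h (n - 1)" "0 \<le> h (Suc n)"
    by (intro mult_nonneg_nonneg h_nonneg zero_le_power2)+
  have "(\<alpha> n)\<^sup>2 * h n \<le> C\<^sup>2 * h n" using le nonneg by linarith
  hence "(\<alpha> n)\<^sup>2 \<le> C\<^sup>2" using hn by simp
  thus "\<bar>\<alpha> n\<bar> \<le> C" using C by (simp add: abs_le_square_iff[symmetric])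
  have "h (Suc n) \<le> C\<^sup>2 * h n" using le nonneg by linarith
  thus "\<beta> (Suc n) \<le> C\<^sup>2" using hn by (simp add: \<beta>_def field_simps)
qed

text \<open>\<open>Y\<close> acts on the vectors sqrt(h_n) e_n as multiplication by X acts on the
  monic polynomials. This scaling avoids dividing by the norm of a null vector.\<close>

lemma jacobi_moments:
  assumes "jacobi a c Y"
    and a: "\<And>n. nondegenerate (Suc n) \<Longrightarrow> a n = \<alpha> n"
    and c: "\<And>n. nondegenerate n \<Longrightarrow> c n = sqrt (\<beta> n)"
  shows "cinner (basis_ell2 0) (cop_apply (Y ^ k) (basis_ell2 0)) = of_real (m k)"
proof -
  interpret jacobi a c Y by fact
  let ?e = basis_ell2
  have "cinner (?e 0) (cop_apply (Y ^ k) (of_real (sqrt (h n)) *\<^sub>C ?e n)) = of_real (L ([:0, 1:] ^ k * orth n))"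
    if "nondegenerate n" for n
    using that
  proof (induction k arbitrary: n)
    case 0
    show ?case
    proof (cases "n = 0")
      case True
      thus ?thesis by (simp add: h_0 cinner_basis_left moment_functional_def m0)
    next
      case False
      thus ?thesis using orthogonal[OF 0, of 0] by (simp add: cinner_basis_left)
    qed
  next
    case (Suc k)
    let ?v = "\<lambda>n. complex_of_real (sqrt (h n)) *\<^sub>C ?e n"
    show ?case
    proof (cases "h n = 0")
      case True
      \<comment> \<open>At a null vector both sides vanish, so the induction never enters the next
        block of the matrix.\<close>
      have "L ([:0, 1:] ^ Suc k * orth n) = 0" by (rule L_null) (use True in \<open>simp add: h_def\<close>)
      thus ?thesis using True by simp
    next
      case False
      have nd: "nondegenerate (Suc n)" using Suc.prems False by (auto simp: nondegenerate_def less_Suc_eq)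
      have hn: "h n > 0" using False h_nonneg[of n] by linarith
      \<comment> \<open>The factors sqrt(h_n) turn the symmetric weights \<open>c\<close> into the
        coefficients 1 and \<open>\<beta>\<close> of the monic recurrence.\<close>
      have 1: "sqrt (h n) * c (Suc n) = sqrt (h (Suc n))"
        using c[OF nd] hn by (simp add: \<beta>_def real_sqrt_divide)
      have 2: "sqrt (h n) * c n = \<beta> n * sqrt (h (n - 1))"
      proof (cases "n = 0")
        case True
        thus ?thesis using c[OF Suc.prems] by (simp add: \<beta>_def)
      next
        case False
        hence "h (n - 1) \<noteq> 0" using Suc.prems by (simp add: nondegenerate_def)
        hence "h (n - 1) > 0" using h_nonneg[of "n - 1"] by linarith
        have "\<beta> n * sqrt (h (n - 1)) = (sqrt (h n))\<^sup>2 / (sqrt (h (n - 1)))\<^sup>2 * sqrt (h (n - 1))"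
          using False by (simp add: \<beta>_def h_nonneg)
        also have "\<dots> = sqrt (h n) * (sqrt (h n) / sqrt (h (n - 1)))"
        proof -
          have "s\<^sup>2 / t\<^sup>2 * t = s * (s / t)" if "t > 0" for s t :: real
            using that by (simp add: power2_eq_square)
          moreover have "sqrt (h (n - 1)) > 0" using \<open>h (n - 1) > 0\<close> by simp
          ultimately show ?thesis .
        qed
        also have "sqrt (h n) / sqrt (h (n - 1)) = c n"
          using c[OF Suc.prems] False by (simp add: \<beta>_def real_sqrt_divide)
        finally show ?thesis by simp
      qed
      have "cop_apply Y (?v n) = of_real (sqrt (h n) * a n) *\<^sub>C ?e n + of_real (sqrt (h n) * c (Suc n)) *\<^sub>C ?e (Suc n)
          + of_real (sqrt (h n) * c n) *\<^sub>C ?e (n - 1)"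
        by (simp add: Y_basis scaleC_add_right scaleC_scaleC)
      also have "\<dots> = of_real (\<alpha> n) *\<^sub>C ?v n + ?v (Suc n) + of_real (\<beta> n) *\<^sub>C ?v (n - 1)"
        unfolding 1 2 a[OF nd] by (simp add: scaleC_scaleC mult.commute)
      finally have "cop_apply (Y ^ Suc k) (?v n) =
          of_real (\<alpha> n) *\<^sub>C cop_apply (Y ^ k) (?v n) + cop_apply (Y ^ k) (?v (Suc n)) + of_real (\<beta> n) *\<^sub>C cop_apply (Y ^ k) (?v (n - 1))"
        unfolding power_Suc2 cop_apply_simps by (simp only: cop_apply_add cop_apply_scaleC)
      moreover have "nondegenerate (n - 1)" using Suc.prems by (auto simp: nondegenerate_def)
      ultimately have "cinner (?e 0) (cop_apply (Y ^ Suc k) (?v n)) =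
          of_real (\<alpha> n * L ([:0, 1:] ^ k * orth n) + L ([:0, 1:] ^ k * orth (Suc n)) + \<beta> n * L ([:0, 1:] ^ k * orth (n - 1)))"
        using Suc.IH[OF Suc.prems] Suc.IH[OF nd] Suc.IH[of "n - 1"]
        by (simp only: cinner_add_right cinner_scaleC_right of_real_add of_real_mult)
      also have "\<alpha> n * L ([:0, 1:] ^ k * orth n) + L ([:0, 1:] ^ k * orth (Suc n)) + \<beta> n * L ([:0, 1:] ^ k * orth (n - 1)) =
          L ([:0, 1:] ^ k * ([:0, 1:] * orth n))"
        unfolding orth_recurrence by (simp add: L_linear distrib_left mult_smult_right del: orth.simps)
      finally show ?thesis by (simp only: power_Suc2 mult.assoc)
    qed
  qed
  from this[of 0] have "cinner (?e 0) (cop_apply (Y ^ k) (?e 0)) = of_real (L ([:0, 1:] ^ k))"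
    by (simp add: h_0 scaleC_one nondegenerate_def)
  also have "L ([:0, 1:] ^ k) = m k"
  proof -
    have "[:0, 1:] ^ k = monom (1::real) k" by (simp add: monom_altdef)
    thus ?thesis by (simp add: moment_functional_def degree_monom_eq if_distrib[of "\<lambda>z. z * _"] cong: if_cong)
  qed
  finally show ?thesis .
qed

text \<open>If some orthogonal polynomial is a null vector, the Jacobi matrix is finite; it is then
  repeated periodically in order to obtain an operator on the sequence space.\<close>

theorem realization:
  "\<exists>(B :: ell2 cop set) \<sigma> Y. tracial_ncps B \<sigma> \<and> Y \<in> B \<and> selfadjoint Y \<and> (\<forall>k. \<sigma> (Y ^ k) = of_real (m k))"
proof -
  obtain a c Y where jac: "jacobi a c Y"
    and a: "\<And>n. nondegenerate (Suc n) \<Longrightarrow> a n = \<alpha> n" and c: "\<And>n. nondegenerate n \<Longrightarrow> c n = sqrt (\<beta> n)"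
    and blocks: "\<And>n. c n = 0 \<Longrightarrow> \<exists>V\<in>commutant {Y}. cop_apply V (basis_ell2 0) = basis_ell2 n"
  proof -
    have sqrt_le: "\<bar>sqrt (\<beta> n)\<bar> \<le> C" if "nondegenerate n" for n
    proof (cases n)
      case 0
      thus ?thesis using C by (simp add: \<beta>_def)
    next
      case (Suc k)
      have "0 \<le> \<beta> n" by (simp add: \<beta>_def h_nonneg)
      thus ?thesis using coefficient_bounds(2)[of k] that Suc C by (simp add: real_le_lsqrt)
    qed
    show ?thesis
    proof (cases "\<forall>n. h n \<noteq> 0")
      case True
      hence nd: "nondegenerate n" for n by (simp add: nondegenerate_def)
      obtain Y where Y: "jacobi \<alpha> (\<lambda>n. sqrt (\<beta> n)) Y"
      proof (rule jacobi_operator_exists[of \<alpha> C "\<lambda>n. sqrt (\<beta> n)"])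
        show "\<bar>\<alpha> n\<bar> \<le> C" "\<bar>sqrt (\<beta> n)\<bar> \<le> C" for n
          using coefficient_bounds(1)[OF nd] sqrt_le[OF nd] by auto
      qed (auto simp: \<beta>_def jacobi_def)
      show ?thesis
      proof (rule that[OF Y])
        fix n assume "sqrt (\<beta> n) = 0"
        hence "n = 0" using True by (cases "n = 0") (simp_all add: \<beta>_def)
        thus "\<exists>V\<in>commutant {Y}. cop_apply V (basis_ell2 0) = basis_ell2 n"
          by (intro bexI[of _ 1]) (auto simp: commutant_def)
      qed auto
    next
      case False
      \<comment> \<open>The size of the finite Jacobi matrix, which becomes the period.\<close>
      define d where "d = (LEAST n. h n = 0)"
      have d: "h d = 0" and least: "\<And>n. n < d \<Longrightarrow> h n \<noteq> 0"
        using False LeastI_ex[of "\<lambda>n. h n = 0"] not_less_Least by (auto simp: d_def)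
      have d0: "d > 0" using d h_0 by (cases d) auto
      have nd: "nondegenerate n \<longleftrightarrow> n \<le> d" for n
        using d least unfolding nondegenerate_def by (metis leI le_less_trans less_le_not_le order.strict_trans2)
      define a where "a = (\<lambda>n. \<alpha> (n mod d))"
      define c where "c = (\<lambda>n. sqrt (\<beta> (n mod d)))"
      have mod: "n mod d < d" for n using d0 by simp
      have c0: "c n = 0 \<longleftrightarrow> n mod d = 0" for n
        using least[of "n mod d"] least[of "n mod d - 1"] mod[of n] by (auto simp: c_def \<beta>_def)
      obtain Y where Y: "jacobi a c Y"
      proof (rule jacobi_operator_exists[of a C c])
        show "\<bar>a n\<bar> \<le> C" for n
          using coefficient_bounds(1)[of "n mod d"] nd mod[of n] by (simp add: a_def Suc_le_eq)
        show "\<bar>c n\<bar> \<le> C" for n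
          using sqrt_le[of "n mod d"] nd mod[of n] by (simp add: c_def)
      qed (auto simp: c0 jacobi_def)
      show ?thesis
      proof (rule that[OF Y])
        show "a n = \<alpha> n" if "nondegenerate (Suc n)" for n
          using that nd by (simp add: a_def Suc_le_eq)
        \<comment> \<open>At \<open>n = d\<close> the periodic value comes from
          \<open>\<beta> 0 = 0\<close>; it agrees with \<open>\<beta> d\<close>, which vanishes
          since \<open>h d = 0\<close>.\<close>
        show "c n = sqrt (\<beta> n)" if "nondegenerate n" for n
          using that nd[of n] d d0 by (cases "n = d") (auto simp: c_def \<beta>_def)
        fix n assume "c n = 0"
        hence dvd: "d dvd n" using c0 by auto
        show "\<exists>V\<in>commutant {Y}. cop_apply V (basis_ell2 0) = basis_ell2 n"
        proof (cases "n = 0")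
          case True
          thus ?thesis by (intro bexI[of _ 1]) (auto simp: commutant_def)
        next
          case False
          have "a (k + n) = a k" "c (k + n) = c k" for k
            using dvd by (auto simp: a_def c_def elim!: dvdE)
          then obtain V where "V \<in> commutant {Y}" "cop_apply V (basis_ell2 0) = basis_ell2 n"
            using jacobi.shift_commutes[OF Y, of n] False by auto
          thus ?thesis by blast
        qed
      qed
    qed
  qed
  interpret jacobi a c Y by fact
  have "complex_of_real ((norm (basis_ell2 0))\<^sup>2) = complex_of_real 1"
    unfolding cinner_norm[symmetric] by (simp add: cinner_basis_left)
  hence "(norm (basis_ell2 0))\<^sup>2 = 1" by (simp only: of_real_eq_iff)
  hence "norm (basis_ell2 0) = 1" by (simp add: power2_eq_1_iff) (use norm_ge_zero[of "basis_ell2 0"] in linarith)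
  hence "tracial_ncps (commutant (commutant {Y})) (\<lambda>T. cinner (basis_ell2 0) (cop_apply T (basis_ell2 0)))"
    by (rule tracial_ncps_bicommutant[OF selfadjoint_Y]) (rule separating[OF blocks])
  moreover have "Y \<in> commutant (commutant {Y})" using subset_bicommutant by blast
  moreover note selfadjoint_Y
  moreover have "cinner (basis_ell2 0) (cop_apply (Y ^ k) (basis_ell2 0)) = of_real (m k)" for k
    by (rule jacobi_moments[OF jac a c])
  ultimately show ?thesis by blast
qed

end

section \<open>The limit law\<close>

lemma is_adjoint_add: "is_adjoint S T \<Longrightarrow> is_adjoint S' T' \<Longrightarrow> is_adjoint (S + S') (T + T')"
  by (simp add: is_adjoint_def cinner_add_left cinner_add_right)

lemma is_adjoint_diff: "is_adjoint S T \<Longrightarrow> is_adjoint S' T' \<Longrightarrow> is_adjoint (S - S') (T - T')"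
  by (simp add: is_adjoint_def cinner_diff_left cinner_diff_right)

lemma is_adjoint_scaleC: "is_adjoint S T \<Longrightarrow> is_adjoint (c *\<^sub>C S) (cnj c *\<^sub>C T)"
  by (simp add: is_adjoint_def cinner_scaleC_left cinner_scaleC_right)

lemma selfadjoint_0: "selfadjoint 0" and selfadjoint_1: "selfadjoint 1"
  by (simp_all add: selfadjoint_def is_adjoint_def)

lemma selfadjoint_add: "selfadjoint S \<Longrightarrow> selfadjoint T \<Longrightarrow> selfadjoint (S + T)"
  unfolding selfadjoint_def by (rule is_adjoint_add)

lemma selfadjoint_sum: "(\<And>x. x \<in> S \<Longrightarrow> selfadjoint (f x)) \<Longrightarrow> selfadjoint (sum f S)"
  by (induction S rule: infinite_finite_induct) (auto intro: selfadjoint_add selfadjoint_0)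

lemma selfadjoint_scale_real: "selfadjoint T \<Longrightarrow> selfadjoint (complex_of_real r *\<^sub>C T)"
  unfolding selfadjoint_def using is_adjoint_scaleC[of T T "complex_of_real r"] by simp

lemma selfadjoint_mult: "selfadjoint S \<Longrightarrow> selfadjoint T \<Longrightarrow> S * T = T * S \<Longrightarrow> selfadjoint (S * T)"
  unfolding selfadjoint_def using is_adjoint_mult[of S S T T] by simp

lemma selfadjoint_power: "selfadjoint T \<Longrightarrow> selfadjoint (T ^ n)"
  by (induction n) (auto intro: selfadjoint_mult selfadjoint_1 simp: power_commutes)

lemma selfadjoint_commutator:
  assumes "selfadjoint S" "selfadjoint T"
  shows "selfadjoint (\<i> *\<^sub>C (S * T - T * S))"
proof -
  have "is_adjoint (\<i> *\<^sub>C (S * T - T * S)) (cnj \<i> *\<^sub>C (T * S - S * T))"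
    using assms unfolding selfadjoint_def by (intro is_adjoint_scaleC is_adjoint_diff is_adjoint_mult)
  moreover have "cnj \<i> *\<^sub>C (T * S - S * T) = \<i> *\<^sub>C (S * T - T * S)"
    by (simp add: scaleC_diff_right scaleC_minus_left)
  ultimately show ?thesis by (simp add: selfadjoint_def)
qed

lemma op_poly_commutes: "T * op_poly p T = op_poly p T * T"
proof -
  have "op_poly [:0, 1:] T = T" by (simp add: op_poly_pCons scaleC_one)
  thus ?thesis by (metis op_poly_mult mult.commute)
qed

lemma selfadjoint_op_poly:
  assumes "selfadjoint T"
  shows "selfadjoint (op_poly (map_poly complex_of_real p) T)"
proof (induction p)
  case (pCons a p)
  have "selfadjoint (complex_of_real a *\<^sub>C 1 + T * op_poly (map_poly complex_of_real p) T)"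
    using assms pCons.IH
    by (intro selfadjoint_add selfadjoint_scale_real selfadjoint_1 selfadjoint_mult op_poly_commutes)
  thus ?case using pCons.hyps by (simp add: map_poly_pCons op_poly_pCons)
qed (simp add: selfadjoint_0)

lemma positive_square: "selfadjoint T \<Longrightarrow> positive_cop (T * T)"
  unfolding positive_cop_def
proof
  fix x
  assume "selfadjoint T"
  hence "cinner x (cop_apply (T * T) x) = cinner (cop_apply T x) (cop_apply T x)"
    by (simp add: selfadjoint_def is_adjoint_def)
  thus "cinner x (cop_apply (T * T) x) \<in> \<real>\<^sub>\<ge>\<^sub>0" by (simp only: cinner_norm nonneg_Reals_of_real_iff zero_le_power2)
qed

context tracial_ncps
begin

lemma tau_square: "T \<in> A \<Longrightarrow> selfadjoint T \<Longrightarrow> Im (\<tau> (T * T)) = 0 \<and> 0 \<le> Re (\<tau> (T * T))"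
  using positive[of "T * T"] positive_square[of T] by (simp add: complex_nonneg_Reals_iff)

text \<open>Only squares are known to have real expectation. The square of 1 + T contains T linearly
  and reduces the claim to them.\<close>

lemma tau_selfadjoint_real:
  assumes T: "T \<in> A" "selfadjoint T"
  shows "Im (\<tau> T) = 0"
proof -
  have "Im (\<tau> ((1 + T) * (1 + T))) = 0"
    using T by (intro conjunct1[OF tau_square] selfadjoint_add selfadjoint_1) auto
  moreover have "\<tau> ((1 + T) * (1 + T)) = 1 + (\<tau> T + \<tau> T) + \<tau> (T * T)"
    using T by (simp add: algebra_simps add unit)
  ultimately show ?thesis using tau_square[OF T] by simp
qed

text \<open>For real p the value at p^2 is a limit of expectations of squares of selfadjoint
  operators, so reality and semidefiniteness pass to the limit; strict positivity need not.\<close>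

lemma tendsto_moments_psd:
  assumes Q: "\<And>n. Q n \<in> A" "\<And>n. selfadjoint (Q n)" and lim: "\<And>k. (\<lambda>n. \<tau> (Q n ^ k)) \<longlonglongrightarrow> M k"
  shows "M k = complex_of_real (Re (M k))" "0 \<le> moment_functional (\<lambda>k. Re (M k)) (p * p)"
proof -
  have im: "Im (M k) = 0" for k
  proof -
    have "(\<lambda>n. Im (\<tau> (Q n ^ k))) \<longlonglongrightarrow> Im (M k)" by (intro tendsto_Im lim)
    moreover have "Im (\<tau> (Q n ^ k)) = 0" for n
      using Q by (intro tau_selfadjoint_real selfadjoint_power) auto
    ultimately show ?thesis by (simp add: LIMSEQ_const_iff)
  qed
  thus "M k = complex_of_real (Re (M k))" by (simp add: complex_eq_iff)
  let ?p = "map_poly complex_of_real p"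
  have deg: "degree (?p * ?p) = degree (p * p)" and coeff: "coeff (?p * ?p) k = complex_of_real (coeff (p * p) k)" for k
  proof -
    have "?p * ?p = map_poly complex_of_real (p * p)"
      by (rule poly_eqI) (simp add: coeff_mult coeff_map_poly)
    thus "degree (?p * ?p) = degree (p * p)" "coeff (?p * ?p) k = complex_of_real (coeff (p * p) k)"
      by (simp_all add: degree_map_poly coeff_map_poly)
  qed
  have "(\<lambda>n. Re (moment_functional (\<lambda>k. \<tau> (Q n ^ k)) (?p * ?p))) \<longlonglongrightarrow> Re (moment_functional M (?p * ?p))"
    unfolding moment_functional_def by (intro tendsto_intros lim)
  moreover have "0 \<le> Re (moment_functional (\<lambda>k. \<tau> (Q n ^ k)) (?p * ?p))" for n
    using tau_square[of "op_poly ?p (Q n)"] Q selfadjoint_op_poly[of "Q n" p]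
    by (simp add: tau_op_poly[symmetric] op_poly_mult)
  ultimately have "0 \<le> Re (moment_functional M (?p * ?p))" by (intro LIMSEQ_le_const) auto
  also have "Re (moment_functional M (?p * ?p)) = moment_functional (\<lambda>k. Re (M k)) (p * p)"
    by (simp add: moment_functional_def deg coeff)
  finally show "0 \<le> moment_functional (\<lambda>k. Re (M k)) (p * p)" .
qed

end

text \<open>The coefficients are limits of traces of modulus at most 1, so no expansion of tan has
  to be estimated.\<close>

lemma norm_fps_nth_tan_le: "norm (fps_nth (fps_tan 1 :: complex fps) k) \<le> 1"
  using tendsto_norm[OF tendsto_kernel_trace_sign_kernel[of "Suc k"]] norm_kernel_trace_sign_kernel_le
  by (intro LIMSEQ_le_const2) auto

theorem proposition4p4:
  fixes A :: "'h::chilbert_space cop set" and \<tau> :: "'h cop \<Rightarrow> complex"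
    and X\<^sub>0 :: "'h cop" and X :: "nat \<Rightarrow> 'h cop" and Q :: "nat \<Rightarrow> 'h cop"
  assumes "tracial_ncps A \<tau>"
    and "X\<^sub>0 \<in> A" and "selfadjoint X\<^sub>0" and "variance \<tau> X\<^sub>0 = 1"
    and "\<And>i. i \<ge> 1 \<Longrightarrow> X i \<in> A" and "\<And>i. i \<ge> 1 \<Longrightarrow> selfadjoint (X i)"
    and "\<And>i. i \<ge> 1 \<Longrightarrow> same_distribution \<tau> (X i) \<tau> X\<^sub>0"
    and "free_variables \<tau> {1..} X"
    and Q: "\<And>n. Q n = (1 / of_nat n) *\<^sub>C
              (\<Sum>(k, j)\<in>{(k, j). 1 \<le> k \<and> k < j \<and> j \<le> n}. \<i> *\<^sub>C (X k * X j - X j * X k))"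
  shows "\<exists>(B :: ell2 cop set) \<sigma> Y.
           tracial_ncps B \<sigma> \<and> Y \<in> B \<and> selfadjoint Y \<and>
           converges_in_distribution \<tau> Q \<sigma> Y \<and>
           tan has_fps_expansion R_transform \<sigma> Y"
proof -
  interpret tracial_ncps A \<tau> by fact
  interpret standardized_free_copies A \<tau> "\<lambda>k. \<tau> (X\<^sub>0 ^ k)" X
    by unfold_locales (use assms in \<open>auto simp: same_distribution_def variance_def\<close>)
  \<comment> \<open>The shift by one is that of the R-transform, whose coefficient at z^n is the
    cumulant of order n + 1.\<close>
  define \<kappa> :: "nat \<Rightarrow> complex" where "\<kappa> = (\<lambda>s. fps_nth (fps_tan 1) (s - 1))"
  define M where "M = free_moment \<kappa> 0"
  have lim: "(\<lambda>n. \<tau> (Q n ^ k)) \<longlonglongrightarrow> M k" for k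
    unfolding Q sum_commutators_eq_quadratic_form M_def \<kappa>_def by (rule tendsto_quadratic_form_sign_kernel)
  have Q_in_A: "Q n \<in> A" for n
    unfolding Q sum_commutators_eq_quadratic_form quadratic_form_def
    by (intro sum_in_A scale_in_A mult_in_A Z_in_A) auto
  have Q_sa: "selfadjoint (Q n)" for n
  proof -
    have "1 / of_nat n = complex_of_real (1 / real n)" by simp
    thus ?thesis unfolding Q
      by (simp only:) (intro selfadjoint_scale_real selfadjoint_sum,
        auto intro!: selfadjoint_commutator assms(6))
  qed
  note limit = tendsto_moments_psd[OF Q_in_A Q_sa lim]
  have "norm (M k) \<le> 2 * 4 ^ k" for k
    unfolding M_def \<kappa>_def by (rule norm_free_moment_le) (rule norm_fps_nth_tan_le)
  hence "\<bar>Re (M k)\<bar> \<le> 2 * 4 ^ k" for k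
    using abs_Re_le_cmod order.trans by blast
  \<comment> \<open>The constants 2 and 4 come from the Catalan bound.\<close>
  then interpret bounded_moment_sequence "\<lambda>k. Re (M k)" 2 4
    by unfold_locales (auto simp: M_def limit(2)[unfolded M_def])
  obtain B :: "ell2 cop set" and \<sigma> Y where B: "tracial_ncps B \<sigma>" "Y \<in> B" "selfadjoint Y"
    and \<sigma>: "\<And>k. \<sigma> (Y ^ k) = complex_of_real (Re (M k))"
    using realization by blast
  have \<sigma>_M: "\<sigma> (Y ^ k) = M k" for k unfolding \<sigma> by (rule limit(1)[symmetric])
  have "R_transform \<sigma> Y = fps_tan 1"
    unfolding R_transform_def
    by (rule fps_ext) (simp add: free_cumulant_replicate[of \<sigma> Y \<kappa>] \<sigma>_M M_def \<kappa>_def del: replicate_Suc)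
  hence "tan has_fps_expansion R_transform \<sigma> Y" by (simp add: has_fps_expansion_tan')
  moreover have "converges_in_distribution \<tau> Q \<sigma> Y"
    using lim by (simp add: converges_in_distribution_def \<sigma>_M)
  ultimately show ?thesis using B by blast
qed

end
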